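(* Let $H$ be a fixed graph, and let $\tau(H)$ denote the maximum number of edges in a connected component of $H$. In the $H$-minor game: (i) if $\tau(H)=1$, then $\frac{n^2}{2e(H)-2}$ is a sharp threshold both for the {\tt CleverMaker}–{\tt CleverBreaker} game and for the {\tt RandomMaker}–{\tt CleverBreaker} game; (ii) if $\tau(H)=2$, then $2n$ is a sharp threshold both for the {\tt CleverMaker}–{\tt CleverBreaker} game and for the {\tt RandomMaker}–{\tt CleverBreaker} game; (iii) if $H$ is a forest and $\tau(H)\geq 3$, then $n$ is a sharp threshold for the {\tt CleverMaker}–{\tt CleverBreaker} game, and $n$ is a threshold for the {\tt RandomMaker}–{\tt CleverBreaker} game; (iv) if $H$ is not a forest, then $\frac n2$ is a sharp threshold both for the {\tt CleverMaker}–{\tt CleverBreaker} game and for the {\tt RandomMaker}–{\tt CleverBreaker} game.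
   Context: A $(1:b)$ biased Maker–Breaker game on $K_n$ is played on the board $E(K_n)$: in each round Maker claims one unclaimed edge and then Breaker claims $b$ unclaimed edges (fewer if fewer remain), until all edges are claimed. $M$ denotes the graph of Maker's edges at the end. For a monotone increasing graph property $\mathcal P$, Maker wins if $M\in\mathcal P$, otherwise Breaker wins. In the $H$-minor game, Maker wins iff $H$ is a minor of $M$; $G$ has $H$ as a minor if there are pairwise disjoint non-empty sets $S_v\subseteq V(G)$, $v\in V(H)$, with each $G[S_v]$ connected and, for every $vw\in E(H)$, an edge of $G$ between $S_v$ and $S_w$. {\tt RandomMaker} chooses each of its edges uniformly at random among the currently unclaimed edges; {\tt CleverBreaker} (resp. {\tt CleverMaker}) follows a strategy maximizing its probability of winning against the opponent's strategy (against a clever opponent this means: the player with a winning strategy wins). For $X,Y\in\{\text{Random},\text{Clever}\}$, a function $f(n)$ is a threshold for the XMaker–YBreaker game if the probability that XMaker wins tends to $1$ as $n\to\infty$ whenever $b=o(f(n))$ and tends to $0$ whenever $b=\omega(f(n))$; $f(n)$ is a sharp threshold if for every fixed $\epsilon>0$ this probability tends to $1$ for $b=(1-\epsilon)f(n)$ and to $0$ for $b=(1+\epsilon)f(n)$. *)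

theory Defs
  imports
    "HOL-Probability.Probability_Mass_Function"
    "HOL-Library.Landau_Symbols"
    "HOL-Library.Ramsey"
begin

section \<open>Finite simple graphs\<close>

text \<open>
  A graph is given by its vertex set and its edge set; edges are two-element sets of vertices,
  so the edge set of the complete graph on \<open>V\<close> is \<open>nsets V 2\<close>.
\<close>

definition simple_graph :: "'a set \<Rightarrow> 'a set set \<Rightarrow> bool" where
  "simple_graph V E \<longleftrightarrow> finite V \<and> E \<subseteq> nsets V 2"

definition reachable_in :: "'a set set \<Rightarrow> 'a set \<Rightarrow> 'a \<Rightarrow> 'a \<Rightarrow> bool" where
  "reachable_in E S = (\<lambda>x y. x \<in> S \<and> y \<in> S \<and> {x, y} \<in> E)\<^sup>*\<^sup>*"

definition connected_in :: "'a set set \<Rightarrow> 'a set \<Rightarrow> bool" where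
  "connected_in E S \<longleftrightarrow> (\<forall>u\<in>S. \<forall>v\<in>S. reachable_in E S u v)"

definition graph_component :: "'a set \<Rightarrow> 'a set set \<Rightarrow> 'a \<Rightarrow> 'a set" where
  "graph_component V E v = {u \<in> V. reachable_in E V v u}"

text \<open>The value \<open>0\<close> is inserted only to cover the graph without vertices.\<close>

definition max_component_edges :: "'a set \<Rightarrow> 'a set set \<Rightarrow> nat" where
  "max_component_edges V E =
     Max (insert 0 ((\<lambda>v. card {e \<in> E. e \<subseteq> graph_component V E v}) ` V))"

definition is_cycle :: "'a set set \<Rightarrow> 'a list \<Rightarrow> bool" where
  "is_cycle E xs \<longleftrightarrow> 3 \<le> length xs \<and> distinct xs \<and>
     (\<forall>i<length xs. {xs ! i, xs ! (Suc i mod length xs)} \<in> E)"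

definition forest :: "'a set set \<Rightarrow> bool" where
  "forest E \<longleftrightarrow> (\<nexists>xs. is_cycle E xs)"

text \<open>The graph \<open>(VG, EG)\<close> has the graph \<open>(VH, EH)\<close> as a minor.\<close>

definition has_minor :: "'b set \<Rightarrow> 'b set set \<Rightarrow> 'a set \<Rightarrow> 'a set set \<Rightarrow> bool" where
  "has_minor VG EG VH EH \<longleftrightarrow>
     (\<exists>S :: 'a \<Rightarrow> 'b set.
        disjoint_family_on S VH \<and>
        (\<forall>v\<in>VH. S v \<noteq> {} \<and> S v \<subseteq> VG \<and> connected_in EG (S v)) \<and>
        (\<forall>v w. {v, w} \<in> EH \<longrightarrow> (\<exists>x\<in>S v. \<exists>y\<in>S w. {x, y} \<in> EG)))"


section \<open>Biased Maker--Breaker games\<close>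

text \<open>
  A history lists the completed rounds in chronological order, each round as the pair of the
  element claimed by Maker and the set of elements claimed by Breaker.
\<close>

type_synonym 'e history = "('e \<times> 'e set) list"

definition maker_set :: "'e history \<Rightarrow> 'e set" where
  "maker_set h = fst ` set h"

definition breaker_set :: "'e history \<Rightarrow> 'e set" where
  "breaker_set h = \<Union> (snd ` set h)"

definition free :: "'e set \<Rightarrow> 'e history \<Rightarrow> 'e set" where
  "free X h = X - maker_set h - breaker_set h"

text \<open>
  Clever players use deterministic strategies that may depend on the whole history.
  Breaker's strategy also sees the element that Maker has just claimed in the current round.
\<close>

definition maker_strategies :: "'e set \<Rightarrow> ('e history \<Rightarrow> 'e) set" where
  "maker_strategies X = {s. \<forall>h. free X h \<noteq> {} \<longrightarrow> s h \<in> free X h}"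

definition breaker_strategies :: "'e set \<Rightarrow> nat \<Rightarrow> ('e history \<Rightarrow> 'e \<Rightarrow> 'e set) set" where
  "breaker_strategies X b =
     {t. \<forall>h. \<forall>e\<in>free X h.
           t h e \<subseteq> free X h - {e} \<and> card (t h e) = min b (card (free X h - {e}))}"

text \<open>
  The argument \<open>\<mu>\<close> is Maker's behaviour: a distribution of the next claimed element, given the
  history. Once the board is exhausted the history no longer changes.
\<close>

primrec play ::
  "'e set \<Rightarrow> ('e history \<Rightarrow> 'e pmf) \<Rightarrow> ('e history \<Rightarrow> 'e \<Rightarrow> 'e set) \<Rightarrow> nat \<Rightarrow> 'e history pmf" where
  "play X \<mu> t 0 = return_pmf []"
| "play X \<mu> t (Suc k) = bind_pmf (play X \<mu> t k)
     (\<lambda>h. if free X h = {} then return_pmf h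
          else map_pmf (\<lambda>e. h @ [(e, t h e)]) (\<mu> h))"

text \<open>
  Every round uses up at least one element, so \<open>card X\<close> rounds exhaust a finite board \<open>X\<close>.
\<close>

definition win_prob ::
  "'e set \<Rightarrow> ('e set \<Rightarrow> bool) \<Rightarrow> ('e history \<Rightarrow> 'e pmf) \<Rightarrow> ('e history \<Rightarrow> 'e \<Rightarrow> 'e set) \<Rightarrow> real" where
  "win_prob X P \<mu> t = measure_pmf.prob (play X \<mu> t (card X)) {h. P (maker_set h)}"

definition random_maker :: "'e set \<Rightarrow> 'e history \<Rightarrow> 'e pmf" where
  "random_maker X h = pmf_of_set (free X h)"

definition clever_maker :: "('e history \<Rightarrow> 'e) \<Rightarrow> 'e history \<Rightarrow> 'e pmf" where
  "clever_maker s h = return_pmf (s h)"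

definition maker_has_winning_strategy :: "'e set \<Rightarrow> nat \<Rightarrow> ('e set \<Rightarrow> bool) \<Rightarrow> bool" where
  "maker_has_winning_strategy X b P \<longleftrightarrow>
     (\<exists>s\<in>maker_strategies X. \<forall>t\<in>breaker_strategies X b. win_prob X P (clever_maker s) t = 1)"

definition clever_clever_prob :: "'e set \<Rightarrow> nat \<Rightarrow> ('e set \<Rightarrow> bool) \<Rightarrow> real" where
  "clever_clever_prob X b P = (if maker_has_winning_strategy X b P then 1 else 0)"

definition random_clever_prob :: "'e set \<Rightarrow> nat \<Rightarrow> ('e set \<Rightarrow> bool) \<Rightarrow> real" where
  "random_clever_prob X b P = (INF t\<in>breaker_strategies X b. win_prob X P (random_maker X) t)"

lemma breaker_strategies_nonempty: "breaker_strategies X b \<noteq> {}"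
proof -
  have "\<exists>T. T \<subseteq> free X h - {e} \<and> card T = min b (card (free X h - {e}))" for h and e :: 'a
    by (metis min.cobounded2 obtain_subset_with_card_n)
  then obtain t where "t h e \<subseteq> free X h - {e} \<and> card (t h e) = min b (card (free X h - {e}))"
    for h and e :: 'a
    by metis
  then have "t \<in> breaker_strategies X b"
    by (simp add: breaker_strategies_def)
  then show ?thesis by blast
qed


section \<open>The minor game on the complete graph\<close>

abbreviation complete_edges :: "nat \<Rightarrow> nat set set" where
  "complete_edges n \<equiv> nsets {..<n} 2"

definition minor_game_clever_clever :: "'a set \<Rightarrow> 'a set set \<Rightarrow> nat \<Rightarrow> nat \<Rightarrow> real" where
  "minor_game_clever_clever V E n b =
     clever_clever_prob (complete_edges n) b (\<lambda>M. has_minor {..<n} M V E)"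

definition minor_game_random_clever :: "'a set \<Rightarrow> 'a set set \<Rightarrow> nat \<Rightarrow> nat \<Rightarrow> real" where
  "minor_game_random_clever V E n b =
     random_clever_prob (complete_edges n) b (\<lambda>M. has_minor {..<n} M V E)"


section \<open>Thresholds\<close>

text \<open>In the following, \<open>p n b\<close> is Maker's winning probability on \<open>n\<close> vertices with bias \<open>b\<close>.\<close>

definition threshold :: "(nat \<Rightarrow> nat \<Rightarrow> real) \<Rightarrow> (nat \<Rightarrow> real) \<Rightarrow> bool" where
  "threshold p f \<longleftrightarrow>
     (\<forall>b :: nat \<Rightarrow> nat. (\<lambda>n. real (b n)) \<in> o(f) \<longrightarrow> (\<lambda>n. p n (b n)) \<longlonglongrightarrow> 1) \<and>
     (\<forall>b :: nat \<Rightarrow> nat. (\<lambda>n. real (b n)) \<in> \<omega>(f) \<longrightarrow> (\<lambda>n. p n (b n)) \<longlonglongrightarrow> 0)"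

text \<open>
  Biases are integers, so \<open>b = (1 \<plusminus> \<epsilon>) f(n)\<close> is read up to rounding (in either direction).
\<close>

definition sharp_threshold :: "(nat \<Rightarrow> nat \<Rightarrow> real) \<Rightarrow> (nat \<Rightarrow> real) \<Rightarrow> bool" where
  "sharp_threshold p f \<longleftrightarrow>
     (\<forall>\<epsilon>>0.
        (\<forall>b :: nat \<Rightarrow> nat. (\<forall>n. \<bar>real (b n) - (1 - \<epsilon>) * f n\<bar> < 1) \<longrightarrow> (\<lambda>n. p n (b n)) \<longlonglongrightarrow> 1) \<and>
        (\<forall>b :: nat \<Rightarrow> nat. (\<forall>n. \<bar>real (b n) - (1 + \<epsilon>) * f n\<bar> < 1) \<longrightarrow> (\<lambda>n. p n (b n)) \<longlonglongrightarrow> 0))"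

text \<open>The degenerate case of a sharp threshold \<open>f = \<infinity>\<close>: no bias is too large for Maker.\<close>

definition infinite_threshold :: "(nat \<Rightarrow> nat \<Rightarrow> real) \<Rightarrow> bool" where
  "infinite_threshold p \<longleftrightarrow> (\<forall>b :: nat \<Rightarrow> nat. (\<lambda>n. p n (b n)) \<longlonglongrightarrow> 1)"

end

theory Submission
  imports Defs "HOL-Real_Asymp.Real_Asymp"
begin

text \<open>
  The game is determined, so it suffices to find Breaker strategies beating every Maker, and lower bounds
  for RandomMaker; only the forest case needs an explicit strategy of CleverMaker.

  Breaker. A minor has at most as many edges as the graph, which settles \<open>\<tau> = 1\<close> by counting rounds.
  With bias \<open>2 n\<close> Breaker isolates each edge of Maker. With bias \<open>n\<close> he keeps exactly one vertex of each
  nontrivial component of Maker alive and no free edges between live vertices; as there are at least as many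
  dead as live vertices, killing one new vertex costs at most \<open>n\<close> edges. Choosing which end of Maker's edge
  survives, he confines Maker to stars (no \<open>P\<^sub>4\<close>) or to maximum degree 2 (no \<open>K\<^sub>1\<^sub>,\<^sub>3\<close>).
  With bias \<open>n / 2\<close> he splits the free edges into about \<open>n / 2\<close> forests, each acyclic together with Maker's graph,
  and restores this by deleting at most one edge from each other forest.

  Maker. Against bias \<open>(1 - \<epsilon>) n / 2\<close> RandomMaker plays \<open>(1 + \<epsilon> / 2) n\<close> rounds while a constant fraction of
  the board is free, so the expected number of short cycles is bounded. Destroying them leaves a graph of large girth
  with \<open>(1 + \<epsilon> / 4) n\<close> edges. Contracting the stars of a small dominating set preserves \<open>|E| - |V|\<close> and
  halves \<open>|V|\<close>; repeating this gives a minor of large average degree, hence a clique minor.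
  CleverMaker embeds a tree with bias \<open>(1 - \<epsilon>) n\<close> by growing branch sets one after the other: each round adds
  a fresh vertex with almost \<open>n\<close> free edges, so the boundary of the current branch set gains about \<open>\<epsilon> n\<close>
  whatever Breaker does. For bias below \<open>2 n\<close> RandomMaker's almost-matching has so many free edges that
  disjoint paths with two edges keep appearing.
\<close>

section \<open>Determinacy of Maker--Breaker games\<close>

text \<open>In a position lost for Maker, Breaker has a reply to every edge. One strategy therefore
  holds any Maker, random or clever, at winning probability exactly 0; conversely, a positive
  probability for RandomMaker makes CleverMaker the winner. This is what allows both games to share
  their bounds.

  The obstacle on Maker's side is that Breaker adapts to the past, so Maker's graph is not a uniform
  random graph. What survives is that a round hits a given edge with probability at most
  \<open>1 / D\<close>, where \<open>D\<close> bounds the number of free edges from below. This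
  bounds the probability of owning any fixed edge set, and first moments are all that is needed.

  At bias close to \<open>n / 2\<close> Maker owns barely more than \<open>n\<close> edges, far too
  few for a direct density argument. Large girth helps because a contraction then loses no edges
  except the contracted ones, so a tiny excess of edges over vertices can be turned into a large
  ratio.

  For forests RandomMaker only inherits the bound near \<open>n / 2\<close> from clique minors,
  while Breaker needs \<open>n\<close>; hence the threshold up to constants in that case.\<close>

lemma maker_set_snoc [simp]: "maker_set (h @ [(e, T)]) = insert e (maker_set h)"
  by (auto simp: maker_set_def)

lemma breaker_set_snoc [simp]: "breaker_set (h @ [(e, T)]) = T \<union> breaker_set h"
  by (auto simp: breaker_set_def)

lemma maker_set_Nil [simp]: "maker_set [] = {}"
  by (simp add: maker_set_def)

lemma free_Nil [simp]: "free X [] = X"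
  by (simp add: free_def maker_set_def breaker_set_def)

lemma free_snoc: "free X (h @ [(e, T)]) = free X h - {e} - T"
  by (auto simp: free_def)

text \<open>
  A history-free form of winning positions: Maker owns \<open>M\<close>, the elements of \<open>F\<close> are free, and Maker is to move.
\<close>

inductive maker_wins :: "nat \<Rightarrow> ('e set \<Rightarrow> bool) \<Rightarrow> 'e set \<Rightarrow> 'e set \<Rightarrow> bool"
  for b :: nat and P :: "'e set \<Rightarrow> bool" where
  won: "P M \<Longrightarrow> maker_wins b P M F"
| move: "e \<in> F \<Longrightarrow>
    (\<And>T. T \<subseteq> F - {e} \<Longrightarrow> card T = min b (card (F - {e})) \<Longrightarrow>
       maker_wins b P (insert e M) (F - {e} - T)) \<Longrightarrow>
    maker_wins b P M F"

text \<open>Covers RandomMaker and every CleverMaker at once, so that facts about plays are proved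
  once for both.\<close>

definition legal_maker :: "'e set \<Rightarrow> ('e history \<Rightarrow> 'e pmf) \<Rightarrow> bool" where
  "legal_maker X \<mu> \<longleftrightarrow> (\<forall>h. free X h \<noteq> {} \<longrightarrow> set_pmf (\<mu> h) \<subseteq> free X h)"

lemma legal_random_maker: "finite X \<Longrightarrow> legal_maker X (random_maker X)"
  by (auto simp: legal_maker_def random_maker_def free_def)

lemma legal_clever_maker: "s \<in> maker_strategies X \<Longrightarrow> legal_maker X (clever_maker s)"
  by (auto simp: legal_maker_def clever_maker_def maker_strategies_def)

text \<open>The invariant may mention the round counter. The counter keeps running on an exhausted
  board, and \<open>stop\<close> takes care of those idle rounds.\<close>

lemma play_invariant:
  assumes "I [] 0"
    and step: "\<And>h k e. I h k \<Longrightarrow> free X h \<noteq> {} \<Longrightarrow> e \<in> set_pmf (\<mu> h) \<Longrightarrow> I (h @ [(e, t h e)]) (Suc k)"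
    and stop: "\<And>h k. I h k \<Longrightarrow> free X h = {} \<Longrightarrow> I h (Suc k)"
    and "h \<in> set_pmf (play X \<mu> t k)"
  shows "I h k"
  using assms(4)
proof (induction k arbitrary: h)
  case 0
  then show ?case using assms(1) by simp
next
  case (Suc k)
  then obtain g where g: "g \<in> set_pmf (play X \<mu> t k)"
    and h: "h \<in> set_pmf (if free X g = {} then return_pmf g else map_pmf (\<lambda>e. g @ [(e, t g e)]) (\<mu> g))"
    by (auto simp del: set_map_pmf)
  show ?case using Suc.IH[OF g] h step stop by (auto split: if_splits)
qed

lemma breaker_move:
  assumes "t \<in> breaker_strategies X b" "e \<in> free X h"
  shows "t h e \<subseteq> free X h - {e}" "card (t h e) = min b (card (free X h - {e}))"
  using assms by (auto simp: breaker_strategies_def)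

lemma play_maker_set_subset:
  assumes "legal_maker X \<mu>" "h \<in> set_pmf (play X \<mu> t k)"
  shows "maker_set h \<subseteq> X"
proof -
  have "(\<lambda>h k. maker_set h \<subseteq> X) h k"
    by (rule play_invariant[OF _ _ _ assms(2)])
       (use assms(1) in \<open>auto simp: legal_maker_def free_def\<close>)
  then show ?thesis .
qed

lemma card_free_play:
  assumes "finite X" "legal_maker X \<mu>" "h \<in> set_pmf (play X \<mu> t k)"
  shows "card (free X h) \<le> card X - k"
proof -
  have "(\<lambda>h k. card (free X h) \<le> card X - k) h k"
  proof (rule play_invariant[OF _ _ _ assms(3)])
    fix h k e
    assume h: "card (free X h) \<le> card X - k" "free X h \<noteq> {}" "e \<in> set_pmf (\<mu> h)"
    have fin: "finite (free X h)" using assms(1) by (simp add: free_def)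
    have e: "e \<in> free X h" using assms(2) h by (auto simp: legal_maker_def)
    have "card (free X h - {e} - t h e) \<le> card (free X h - {e})"
      using fin by (intro card_mono) auto
    also have "\<dots> < card (free X h)" using e fin by (meson card_Diff1_less)
    finally show "card (free X (h @ [(e, t h e)])) \<le> card X - Suc k"
      using h by (simp add: free_snoc)
  qed auto
  then show ?thesis .
qed

text \<open>In a winning position some edge keeps all replies winning; once \<open>won\<close>
  applies, any free edge does so by monotonicity. At the end the board is empty, and there only
  \<open>won\<close> can justify the position.\<close>

lemma maker_has_winning_strategyI:
  assumes "finite X" and mono: "\<And>A B. A \<subseteq> B \<Longrightarrow> P A \<Longrightarrow> P B"
    and win: "maker_wins b P {} X"
  shows "maker_has_winning_strategy X b P"
proof -
  define good where "good M F e \<longleftrightarrow> e \<in> F \<and> (\<forall>T. T \<subseteq> F - {e} \<longrightarrow> card T = min b (card (F - {e})) \<longrightarrow>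
       maker_wins b P (insert e M) (F - {e} - T))" for M F e
  have ex: "\<exists>e. good M F e" if "maker_wins b P M F" "F \<noteq> {}" for M F
    using that(1)
  proof cases
    case won
    from that(2) obtain e where "e \<in> F" by auto
    then have "good M F e" unfolding good_def
      using won mono[of M "insert e M"] by (auto intro: maker_wins.won)
    then show ?thesis ..
  next
    case (move e)
    then show ?thesis unfolding good_def by blast
  qed
  define s where "s h = (if maker_wins b P (maker_set h) (free X h)
     then SOME e. good (maker_set h) (free X h) e else SOME e. e \<in> free X h)" for h
  have s_good: "good (maker_set h) (free X h) (s h)"
    if "maker_wins b P (maker_set h) (free X h)" "free X h \<noteq> {}" for h
    using ex[OF that] that unfolding s_def by (auto intro: someI_ex)
  have s_strat: "s \<in> maker_strategies X"
  proof -
    have "s h \<in> free X h" if "free X h \<noteq> {}" for h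
    proof (cases "maker_wins b P (maker_set h) (free X h)")
      case True
      then show ?thesis using s_good[OF True that] by (simp add: good_def)
    next
      case False
      then show ?thesis using that by (auto simp: s_def intro: someI_ex)
    qed
    then show ?thesis by (simp add: maker_strategies_def)
  qed
  have "win_prob X P (clever_maker s) t = 1" if t: "t \<in> breaker_strategies X b" for t
  proof -
    have "P (maker_set h)" if h: "h \<in> set_pmf (play X (clever_maker s) t (card X))" for h
    proof -
      have "(\<lambda>h k. maker_wins b P (maker_set h) (free X h)) h (card X)"
      proof (rule play_invariant[OF _ _ _ h])
        fix h e and k :: nat
        assume I: "maker_wins b P (maker_set h) (free X h)" and ne: "free X h \<noteq> {}"
          and e: "e \<in> set_pmf (clever_maker s h)"
        have "e = s h" using e by (simp add: clever_maker_def)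
        then have g: "good (maker_set h) (free X h) e" using s_good[OF I ne] by simp
        then have "e \<in> free X h" by (simp add: good_def)
        from breaker_move[OF t this] g
        show "maker_wins b P (maker_set (h @ [(e, t h e)])) (free X (h @ [(e, t h e)]))"
          by (simp add: good_def free_snoc)
      qed (use win in auto)
      moreover have "free X h = {}"
        using card_free_play[OF assms(1) legal_clever_maker[OF s_strat] h] assms(1)
        by (simp add: free_def)
      ultimately have "maker_wins b P (maker_set h) {}" by simp
      then show ?thesis by cases auto
    qed
    then show ?thesis unfolding win_prob_def
      by (subst measure_pmf.prob_eq_1) (auto simp: AE_measure_pmf_iff)
  qed
  then show ?thesis using s_strat unfolding maker_has_winning_strategy_def by blast
qed

text \<open>If \<open>move\<close> fails for an edge, some reply leads to a lost position again. The
  reply does not depend on how the edge was chosen, so a single strategy works against all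
  behaviours \<mu>.\<close>

lemma breaker_beats_all:
  assumes lose: "\<not> maker_wins b P {} X"
  obtains t where "t \<in> breaker_strategies X b"
    and "\<And>\<mu>. legal_maker X \<mu> \<Longrightarrow> win_prob X P \<mu> t = 0"
proof -
  have legal: "\<exists>T. T \<subseteq> F \<and> card T = min b (card F)" for F :: "'a set"
    by (metis min.cobounded2 obtain_subset_with_card_n)
  define opt where "opt M F e T \<longleftrightarrow> T \<subseteq> F - {e} \<and> card T = min b (card (F - {e})) \<and>
     (\<not> maker_wins b P M F \<longrightarrow> \<not> maker_wins b P (insert e M) (F - {e} - T))" for M F e T
  have ex: "\<exists>T. opt M F e T" if "e \<in> F" for M F e
  proof (cases "maker_wins b P M F")
    case True
    then show ?thesis using legal[of "F - {e}"] by (simp add: opt_def)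
  next
    case False
    then have "\<exists>T. T \<subseteq> F - {e} \<and> card T = min b (card (F - {e})) \<and>
        \<not> maker_wins b P (insert e M) (F - {e} - T)"
      using maker_wins.move[of e F b P M] that by (metis (no_types))
    with False show ?thesis by (simp add: opt_def)
  qed
  define tt where "tt M F e = (SOME T. opt M F e T)" for M F e
  have tt: "opt M F e (tt M F e)" if "e \<in> F" for M F e
    unfolding tt_def using ex[OF that] by (rule someI_ex)
  define t where "t h e = tt (maker_set h) (free X h) e" for h e
  have t: "t \<in> breaker_strategies X b"
    using tt by (auto simp: t_def breaker_strategies_def opt_def)
  have "win_prob X P \<mu> t = 0" if "legal_maker X \<mu>" for \<mu>
  proof -
    have "\<not> P (maker_set h)" if h: "h \<in> set_pmf (play X \<mu> t k)" for h k
    proof -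
      have "(\<lambda>h k. \<not> maker_wins b P (maker_set h) (free X h)) h k"
      proof (rule play_invariant[OF _ _ _ h])
        fix h e and k :: nat
        assume I: "\<not> maker_wins b P (maker_set h) (free X h)" and ne: "free X h \<noteq> {}"
          and e: "e \<in> set_pmf (\<mu> h)"
        have "e \<in> free X h" using e ne \<open>legal_maker X \<mu>\<close> by (auto simp: legal_maker_def)
        from tt[OF this, of "maker_set h"] I
        show "\<not> maker_wins b P (maker_set (h @ [(e, t h e)])) (free X (h @ [(e, t h e)]))"
          by (simp add: opt_def t_def free_snoc)
      qed (use lose in auto)
      then show ?thesis by (auto intro: maker_wins.won)
    qed
    then show ?thesis unfolding win_prob_def
      by (subst measure_pmf.prob_eq_0) (auto simp: AE_measure_pmf_iff)
  qed
  then show ?thesis by (rule that[OF t])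
qed

lemma clever_clever_prob_1:
  assumes "finite X" "\<And>A B. A \<subseteq> B \<Longrightarrow> P A \<Longrightarrow> P B" "maker_wins b P {} X"
  shows "clever_clever_prob X b P = 1"
  using maker_has_winning_strategyI[OF assms] by (simp add: clever_clever_prob_def)

lemma clever_clever_prob_0:
  assumes "\<not> maker_wins b P {} X"
  shows "clever_clever_prob X b P = 0"
proof -
  obtain t where "t \<in> breaker_strategies X b" "\<And>\<mu>. legal_maker X \<mu> \<Longrightarrow> win_prob X P \<mu> t = 0"
    using breaker_beats_all[OF assms] by blast
  then have "\<not> maker_has_winning_strategy X b P"
    using legal_clever_maker unfolding maker_has_winning_strategy_def by (metis zero_neq_one)
  then show ?thesis by (simp add: clever_clever_prob_def)
qed

lemma random_clever_prob_le:
  assumes "t \<in> breaker_strategies X b"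
  shows "random_clever_prob X b P \<le> win_prob X P (random_maker X) t"
  unfolding random_clever_prob_def
  by (rule cINF_lower[OF _ assms]) (auto intro!: bdd_belowI[of _ 0] simp: win_prob_def)

lemma random_clever_prob_ge:
  assumes "\<And>t. t \<in> breaker_strategies X b \<Longrightarrow> c \<le> win_prob X P (random_maker X) t"
  shows "c \<le> random_clever_prob X b P"
  unfolding random_clever_prob_def
  by (rule cINF_greatest) (use assms breaker_strategies_nonempty in auto)

lemma random_clever_prob_nonneg: "0 \<le> random_clever_prob X b P"
  by (rule random_clever_prob_ge) (simp add: win_prob_def)

lemma random_clever_prob_le_1: "random_clever_prob X b P \<le> 1"
proof -
  obtain t where "t \<in> breaker_strategies X b" using breaker_strategies_nonempty[of X b] by auto
  from random_clever_prob_le[OF this] show ?thesis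
    by (rule order_trans) (simp add: win_prob_def)
qed

lemma random_clever_prob_0:
  assumes "finite X" "\<not> maker_wins b P {} X"
  shows "random_clever_prob X b P = 0"
proof -
  obtain t where "t \<in> breaker_strategies X b" "\<And>\<mu>. legal_maker X \<mu> \<Longrightarrow> win_prob X P \<mu> t = 0"
    using breaker_beats_all[OF assms(2)] by blast
  then have "random_clever_prob X b P \<le> 0"
    using random_clever_prob_le[of t X b P] legal_random_maker[OF assms(1)] by simp
  then show ?thesis using random_clever_prob_nonneg[of X b P] by simp
qed

text \<open>A positive probability against the best Breaker excludes the strategy from
  \<open>breaker_beats_all\<close>; this transfers RandomMaker's lower bounds to
  CleverMaker.\<close>

lemma clever_clever_prob_1_if_random:
  assumes "finite X" "\<And>A B. A \<subseteq> B \<Longrightarrow> P A \<Longrightarrow> P B" "random_clever_prob X b P > 0"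
  shows "clever_clever_prob X b P = 1"
proof (cases "maker_wins b P {} X")
  case True
  then show ?thesis by (intro clever_clever_prob_1 assms(1)) (rule assms(2))
next
  case False
  then show ?thesis using random_clever_prob_0[OF assms(1) False] assms(3) by simp
qed

text \<open>Breaker has to use his whole bias, but a reply that restores the invariant may be
  smaller: it is padded arbitrarily, and \<open>anti\<close> says that losing further free elements
  does no harm.\<close>

lemma maker_loses_by_invariant:
  assumes "finite F" "I M F"
    and lost: "\<And>M F. I M F \<Longrightarrow> \<not> P M"
    and anti: "\<And>M F F'. I M F \<Longrightarrow> F' \<subseteq> F \<Longrightarrow> I M F'"
    and reply: "\<And>M F e. finite F \<Longrightarrow> I M F \<Longrightarrow> e \<in> F \<Longrightarrow>
       \<exists>T. T \<subseteq> F - {e} \<and> card T \<le> b \<and> I (insert e M) (F - {e} - T)"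
  shows "\<not> maker_wins b P M F"
proof
  assume "maker_wins b P M F"
  then show False using assms(1,2)
  proof (induction)
    case (won M F)
    then show ?case using lost by blast
  next
    case (move e F M)
    obtain T where T: "T \<subseteq> F - {e}" "card T \<le> b" "I (insert e M) (F - {e} - T)"
      using reply[OF move.prems move.hyps(1)] by blast
    have fin: "finite (F - {e})" using move.prems by simp
    have "card T \<le> card (F - {e})" using T fin by (intro card_mono) auto
    then have le: "card T \<le> min b (card (F - {e}))" using T(2) by simp
    have "\<exists>T'. T \<subseteq> T' \<and> T' \<subseteq> F - {e} \<and> card T' = min b (card (F - {e}))"
      by (rule exists_subset_between[OF le _ T(1) fin]) (rule min.cobounded2)
    then obtain T' where T': "T \<subseteq> T'" "T' \<subseteq> F - {e}" "card T' = min b (card (F - {e}))"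
      by blast
    have "I (insert e M) (F - {e} - T')" by (rule anti[OF T(3)]) (use T'(1) in blast)
    moreover have "finite (F - {e} - T')" using fin by simp
    ultimately show False using move.IH[OF T'(2,3)] by simp
  qed
qed

section \<open>The game against RandomMaker\<close>

lemma finite_free: "finite X \<Longrightarrow> finite (free X h)"
  by (simp add: free_def)

lemma set_random_maker: "finite X \<Longrightarrow> free X h \<noteq> {} \<Longrightarrow> set_pmf (random_maker X h) = free X h"
  by (simp add: random_maker_def finite_free)

lemma card_claimed_play:
  assumes "finite X" "legal_maker X \<mu>" "t \<in> breaker_strategies X b" "h \<in> set_pmf (play X \<mu> t k)"
  shows "card (X - free X h) \<le> k * (b + 1)"
proof -
  have "(\<lambda>h k. card (X - free X h) \<le> k * (b + 1)) h k"
  proof (rule play_invariant[OF _ _ _ assms(4)])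
    fix h k e
    assume h: "card (X - free X h) \<le> k * (b + 1)" "free X h \<noteq> {}" "e \<in> set_pmf (\<mu> h)"
    have e: "e \<in> free X h" using assms(2) h by (auto simp: legal_maker_def)
    have "X - free X (h @ [(e, t h e)]) \<subseteq> (X - free X h) \<union> {e} \<union> t h e"
      by (auto simp: free_snoc)
    moreover have "finite (t h e)"
      using breaker_move(1)[OF assms(3) e] finite_free[OF assms(1), of h] by (meson finite_Diff finite_subset)
    ultimately have "card (X - free X (h @ [(e, t h e)])) \<le> card ((X - free X h) \<union> {e} \<union> t h e)"
      using assms(1) by (intro card_mono) auto
    also have "\<dots> \<le> card ((X - free X h) \<union> {e}) + card (t h e)" by (rule card_Un_le)
    also have "card ((X - free X h) \<union> {e}) \<le> card (X - free X h) + card {e}" by (rule card_Un_le)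
    also have "card (t h e) \<le> b" using breaker_move(2)[OF assms(3) e] by simp
    finally show "card (X - free X (h @ [(e, t h e)])) \<le> Suc k * (b + 1)" using h(1) by simp
  qed (auto simp: intro: le_trans)
  then show ?thesis .
qed

lemma card_free_play_ge:
  assumes "finite X" "legal_maker X \<mu>" "t \<in> breaker_strategies X b" "h \<in> set_pmf (play X \<mu> t k)"
  shows "card X \<le> card (free X h) + k * (b + 1)"
proof -
  have sub: "free X h \<subseteq> X" by (auto simp: free_def)
  have "card X = card (free X h) + card (X - free X h)"
    using card_Diff_subset[of "free X h" X] card_mono[of X "free X h"] assms(1) sub
    by (simp add: finite_subset)
  then show ?thesis using card_claimed_play[OF assms] by simp
qed

lemma finite_set_pmf_play:
  assumes "finite X"
  shows "finite (set_pmf (play X (random_maker X) t k))"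
proof (induction k)
  case (Suc k)
  then show ?case using set_random_maker[OF assms] finite_free[OF assms]
    by (auto simp: set_map_pmf)
qed simp

lemma play_Suc_nonempty:
  assumes "\<And>h. h \<in> set_pmf (play X \<mu> t k) \<Longrightarrow> free X h \<noteq> {}"
  shows "play X \<mu> t (Suc k) = bind_pmf (play X \<mu> t k) (\<lambda>h. map_pmf (\<lambda>e. h @ [(e, t h e)]) (\<mu> h))"
  using assms by (auto intro!: bind_pmf_cong)

text \<open>The bound concerns only the first \<open>k - 1\<close> rounds: the board is then not yet
  exhausted when round \<open>k\<close> begins, so each of the \<open>k\<close> rounds adds a new
  element.\<close>

lemma card_maker_set_play:
  assumes X: "finite X" "legal_maker X \<mu>" "t \<in> breaker_strategies X b"
    and "h \<in> set_pmf (play X \<mu> t k)" "(k - 1) * (b + 1) < card X"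
  shows "card (maker_set h) = k"
  using assms(4,5)
proof (induction k arbitrary: h)
  case 0
  then show ?case by simp
next
  case (Suc k)
  have ne: "free X g \<noteq> {}" if "g \<in> set_pmf (play X \<mu> t k)" for g
    using card_free_play_ge[OF X that] Suc.prems(2) by auto
  obtain g e where g: "g \<in> set_pmf (play X \<mu> t k)" and h: "h = g @ [(e, t g e)]" and e: "e \<in> set_pmf (\<mu> g)"
  proof -
    have "h \<in> set_pmf (bind_pmf (play X \<mu> t k) (\<lambda>h. map_pmf (\<lambda>e. h @ [(e, t h e)]) (\<mu> h)))"
      using Suc.prems(1) by (simp only: play_Suc_nonempty[OF ne])
    then show thesis using that by auto
  qed
  have "(k - 1) * (b + 1) \<le> k * (b + 1)" by (intro mult_right_mono) auto
  then have "card (maker_set g) = k" using Suc.IH[OF g] Suc.prems(2) by simp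
  moreover have "e \<notin> maker_set g" using e ne[OF g] X(2) by (auto simp: legal_maker_def free_def)
  moreover have "finite (maker_set g)" using play_maker_set_subset[OF X(2) g] X(1) finite_subset by auto
  ultimately show ?case by (simp add: h)
qed

lemma expectation_play_Suc:
  fixes f :: "'e history \<Rightarrow> real"
  assumes X: "finite X" and ne: "\<And>h. h \<in> set_pmf (play X (random_maker X) t k) \<Longrightarrow> free X h \<noteq> {}"
  shows "measure_pmf.expectation (play X (random_maker X) t (Suc k)) f =
     measure_pmf.expectation (play X (random_maker X) t k)
       (\<lambda>h. (\<Sum>e\<in>free X h. f (h @ [(e, t h e)])) / real (card (free X h)))"
proof -
  let ?p = "play X (random_maker X) t k"
  let ?S = "set_pmf ?p"
  let ?q = "\<lambda>h. map_pmf (\<lambda>e. h @ [(e, t h e)]) (random_maker X h)"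
  have fin: "finite ?S" by (rule finite_set_pmf_play[OF X])
  have "measure_pmf.expectation (bind_pmf ?p ?q) f =
      (\<Sum>h\<in>?S. pmf ?p h *\<^sub>R measure_pmf.expectation (?q h) f)"
    by (rule pmf_expectation_bind[OF fin]) (use set_random_maker[OF X ne] finite_free[OF X] in auto)
  also have "\<dots> = (\<Sum>h\<in>?S. pmf ?p h *\<^sub>R ((\<Sum>e\<in>free X h. f (h @ [(e, t h e)])) / real (card (free X h))))"
  proof (rule sum.cong[OF refl])
    fix h assume "h \<in> ?S"
    then have "measure_pmf.expectation (?q h) f = (\<Sum>e\<in>free X h. f (h @ [(e, t h e)])) / real (card (free X h))"
      by (simp add: random_maker_def integral_pmf_of_set finite_free[OF X] ne)
    then show "pmf ?p h *\<^sub>R measure_pmf.expectation (?q h) f =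
        pmf ?p h *\<^sub>R ((\<Sum>e\<in>free X h. f (h @ [(e, t h e)])) / real (card (free X h)))" by simp
  qed
  also have "\<dots> = measure_pmf.expectation ?p
       (\<lambda>h. (\<Sum>e\<in>free X h. f (h @ [(e, t h e)])) / real (card (free X h)))"
    by (subst integral_measure_pmf[OF fin]) auto
  finally show ?thesis using play_Suc_nonempty[of X "random_maker X" t k, OF ne] by simp
qed

lemma expectation_mono_pmf:
  fixes f g :: "'a \<Rightarrow> real"
  assumes "finite (set_pmf p)" "\<And>x. x \<in> set_pmf p \<Longrightarrow> f x \<le> g x"
  shows "measure_pmf.expectation p f \<le> measure_pmf.expectation p g"
  using assms by (intro integral_mono_AE integrable_measure_pmf_finite) (auto simp: AE_measure_pmf_iff)

lemma prob_eq_expectation: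
  "measure_pmf.prob p {x. Q x} = measure_pmf.expectation p (\<lambda>x. of_bool (Q x) :: real)"
proof -
  have "measure_pmf.expectation p (\<lambda>x. of_bool (Q x) :: real) =
      measure_pmf.expectation p (indicator {x. Q x} :: 'a \<Rightarrow> real)"
    by (intro Bochner_Integration.integral_cong) (auto simp: indicator_def)
  then show ?thesis by simp
qed

text \<open>In each of the \<open>k\<close> rounds at least \<open>D\<close> elements are free, so a
  given one is hit with probability at most \<open>1 / D\<close> whatever Breaker did. The bound has
  the form of a union bound over the \<open>k ^ card A\<close> ways to assign rounds to the elements
  of \<open>A\<close>; the induction proves it by asking which element was claimed last.\<close>

lemma prob_maker_set_superset:
  fixes D :: real
  assumes X: "finite X" and t: "t \<in> breaker_strategies X b" and D: "D > 0"
    and "real ((k - 1) * (b + 1)) + D \<le> real (card X)" and "finite A"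
  shows "measure_pmf.prob (play X (random_maker X) t k) {h. A \<subseteq> maker_set h} \<le> (real k / D) ^ card A"
  using assms(4,5)
proof (induction k arbitrary: A)
  case 0
  then show ?case by (cases "A = {}") (auto simp: card_gt_0_iff zero_power)
next
  case (Suc k)
  let ?p = "play X (random_maker X) t k"
  have fin: "finite (set_pmf ?p)" by (rule finite_set_pmf_play[OF X])
  have legal: "legal_maker X (random_maker X)" by (rule legal_random_maker[OF X])
  have D_le: "D \<le> real (card (free X h))" if "h \<in> set_pmf ?p" for h
  proof -
    have "real (card X) \<le> real (card (free X h) + k * (b + 1))"
      using card_free_play_ge[OF X legal t that] by (rule of_nat_mono)
    then show ?thesis using Suc.prems(1) by simp
  qed
  have ne: "free X h \<noteq> {}" if "h \<in> set_pmf ?p" for h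
    using D_le[OF that] D by auto
  have IH: "measure_pmf.prob ?p {h. B \<subseteq> maker_set h} \<le> (real k / D) ^ card B" if "finite B" for B
  proof (rule Suc.IH[OF _ that])
    have "real ((k - 1) * (b + 1)) \<le> real (k * (b + 1))" by (intro of_nat_mono mult_right_mono) auto
    then show "real ((k - 1) * (b + 1)) + D \<le> real (card X)" using Suc.prems(1) by simp
  qed
  have "measure_pmf.prob (play X (random_maker X) t (Suc k)) {h. A \<subseteq> maker_set h} =
      measure_pmf.expectation ?p (\<lambda>h. (\<Sum>e\<in>free X h. of_bool (A \<subseteq> insert e (maker_set h))) / real (card (free X h)))"
    unfolding prob_eq_expectation by (subst expectation_play_Suc[OF X ne]) auto
  also have "\<dots> \<le> measure_pmf.expectation ?p
      (\<lambda>h. of_bool (A \<subseteq> maker_set h) + (\<Sum>a\<in>A. of_bool (A - {a} \<subseteq> maker_set h)) / D)"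
  proof (rule expectation_mono_pmf[OF fin])
    fix h assume h: "h \<in> set_pmf ?p"
    let ?F = "free X h" and ?M = "maker_set h"
    have F: "finite ?F" "card ?F > 0" using finite_free[OF X] ne[OF h] by (auto simp: card_gt_0_iff)
    have "(\<Sum>e\<in>?F. of_bool (A \<subseteq> insert e ?M)) \<le>
        (\<Sum>e\<in>?F. of_bool (A \<subseteq> ?M) + (\<Sum>a\<in>A. of_bool (a = e \<and> A - {a} \<subseteq> ?M)) :: real)"
    proof (rule sum_mono)
      fix e assume "e \<in> ?F"
      show "(of_bool (A \<subseteq> insert e ?M) :: real) \<le> of_bool (A \<subseteq> ?M) + (\<Sum>a\<in>A. of_bool (a = e \<and> A - {a} \<subseteq> ?M))"
      \<comment> \<open>Either \<open>A\<close> was complete before, or \<open>e\<close> is its only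
        missing element.\<close>
      proof (cases "A \<subseteq> insert e ?M \<and> \<not> A \<subseteq> ?M")
        case True
        then have "e \<in> A" "A - {e} \<subseteq> ?M" by auto
        then have "(of_bool (e = e \<and> A - {e} \<subseteq> ?M) :: real) \<le> (\<Sum>a\<in>A. of_bool (a = e \<and> A - {a} \<subseteq> ?M))"
          using Suc.prems(2) by (intro member_le_sum) auto
        then show ?thesis using True \<open>A - {e} \<subseteq> ?M\<close> by simp
      next
        case False
        then have "(of_bool (A \<subseteq> insert e ?M) :: real) \<le> of_bool (A \<subseteq> ?M)" by auto
        moreover have "(0::real) \<le> (\<Sum>a\<in>A. of_bool (a = e \<and> A - {a} \<subseteq> ?M))" by (intro sum_nonneg) auto
        ultimately show ?thesis by linarith
      qed
    qed
    also have "\<dots> = real (card ?F) * of_bool (A \<subseteq> ?M) +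
        (\<Sum>a\<in>A. \<Sum>e\<in>?F. of_bool (a = e \<and> A - {a} \<subseteq> ?M))"
      by (simp add: sum.distrib sum.swap[of _ A])
    also have "(\<Sum>a\<in>A. \<Sum>e\<in>?F. of_bool (a = e \<and> A - {a} \<subseteq> ?M)) \<le> (\<Sum>a\<in>A. of_bool (A - {a} \<subseteq> ?M) :: real)"
    proof (rule sum_mono)
      fix a assume "a \<in> A"
      have "(\<Sum>e\<in>?F. of_bool (a = e \<and> A - {a} \<subseteq> ?M)) =
          (\<Sum>e\<in>?F. if a = e then of_bool (A - {a} \<subseteq> ?M) else 0 :: real)"
        by (intro sum.cong) auto
      also have "\<dots> \<le> of_bool (A - {a} \<subseteq> ?M)" using F(1) by (simp add: sum.delta')
      finally show "(\<Sum>e\<in>?F. of_bool (a = e \<and> A - {a} \<subseteq> ?M)) \<le> (of_bool (A - {a} \<subseteq> ?M) :: real)" .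
    qed
    finally have "(\<Sum>e\<in>?F. of_bool (A \<subseteq> insert e ?M)) / real (card ?F) \<le>
        of_bool (A \<subseteq> ?M) + (\<Sum>a\<in>A. of_bool (A - {a} \<subseteq> ?M)) / real (card ?F)"
      using F(2) by (simp add: field_simps)
    also have "(\<Sum>a\<in>A. of_bool (A - {a} \<subseteq> ?M)) / real (card ?F) \<le> (\<Sum>a\<in>A. of_bool (A - {a} \<subseteq> ?M)) / D"
      using D_le[OF h] D by (intro divide_left_mono sum_nonneg) auto
    finally show "(\<Sum>e\<in>?F. of_bool (A \<subseteq> insert e ?M)) / real (card ?F) \<le>
        of_bool (A \<subseteq> ?M) + (\<Sum>a\<in>A. of_bool (A - {a} \<subseteq> ?M)) / D" by simp
  qed
  also have "\<dots> = measure_pmf.prob ?p {h. A \<subseteq> maker_set h} +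
      (\<Sum>a\<in>A. measure_pmf.prob ?p {h. A - {a} \<subseteq> maker_set h}) / D"
    unfolding prob_eq_expectation using integrable_measure_pmf_finite[OF fin]
    by (subst Bochner_Integration.integral_add) (auto simp: Bochner_Integration.integral_sum)
  also have "\<dots> \<le> (real k / D) ^ card A + (\<Sum>a\<in>A. (real k / D) ^ (card A - 1)) / D"
    using IH Suc.prems(2) D
    by (intro add_mono divide_right_mono sum_mono) (auto simp: intro: order_trans[OF IH])
  also have "\<dots> = (real k / D) ^ card A + real (card A) * (real k / D) ^ (card A - 1) / D" by simp
  also have "\<dots> \<le> (real k / D + 1 / D) ^ card A"
  proof -
    \<comment> \<open>The first two terms of the binomial expansion, used with
      \<open>x = k / D\<close> and \<open>y = 1 / D\<close>.\<close>
    have bin: "x ^ n + real n * x ^ (n - 1) * y \<le> (x + y) ^ n" if "x \<ge> 0" "y \<ge> 0" for x y :: real and n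
    proof (induction n)
      case (Suc n)
      show ?case
      proof (cases n)
        case (Suc m)
        have "x ^ Suc n + real (Suc n) * x ^ (Suc n - 1) * y \<le> (x ^ n + real n * x ^ (n - 1) * y) * (x + y)"
          using that Suc by (simp add: algebra_simps)
        also have "\<dots> \<le> (x + y) ^ n * (x + y)" using Suc.IH that by (intro mult_right_mono) auto
        finally show ?thesis by (simp add: mult.commute)
      qed simp
    qed simp
    show ?thesis using bin[of "real k / D" "1 / D" "card A"] D by simp
  qed
  finally show ?case by (simp add: add_divide_distrib add.commute)
qed

text \<open>Markov's inequality for the number of events that occur.\<close>

lemma markov_count:
  assumes "finite I" "s > 0" and "\<And>i. i \<in> I \<Longrightarrow> measure_pmf.prob p {x. Q i x} \<le> c i"
  shows "measure_pmf.prob p {x. s \<le> real (card {i \<in> I. Q i x})} \<le> (\<Sum>i\<in>I. c i) / s"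
proof -
  have int: "integrable (measure_pmf p) (\<lambda>x. of_bool (Q i x) :: real)" for i
    by (rule measure_pmf.integrable_const_bound[where B = 1]) auto
  have "s * measure_pmf.prob p {x. s \<le> real (card {i \<in> I. Q i x})} =
      measure_pmf.expectation p (\<lambda>x. s * of_bool (s \<le> real (card {i \<in> I. Q i x})))"
    by (simp add: prob_eq_expectation)
  also have "\<dots> \<le> measure_pmf.expectation p (\<lambda>x. \<Sum>i\<in>I. of_bool (Q i x))"
  proof (rule integral_mono)
    show "integrable (measure_pmf p) (\<lambda>x. s * of_bool (s \<le> real (card {i \<in> I. Q i x})))"
      by (rule measure_pmf.integrable_const_bound[where B = "\<bar>s\<bar>"]) auto
    show "integrable (measure_pmf p) (\<lambda>x. \<Sum>i\<in>I. of_bool (Q i x) :: real)" using int by auto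
    show "s * of_bool (s \<le> real (card {i \<in> I. Q i x})) \<le> (\<Sum>i\<in>I. of_bool (Q i x))" for x
      using assms(1) by (auto simp: of_bool_def sum.If_cases Int_def)
  qed
  also have "\<dots> = (\<Sum>i\<in>I. measure_pmf.prob p {x. Q i x})"
    using int by (subst Bochner_Integration.integral_sum) (auto simp: prob_eq_expectation)
  also have "\<dots> \<le> (\<Sum>i\<in>I. c i)" by (intro sum_mono assms(3))
  finally show ?thesis using assms(2) by (simp add: field_simps)
qed

text \<open>Maker never gives elements back, so a monotone goal stays reached. The analysis can
  therefore stop while the board still has many free elements.\<close>

lemma prob_play_mono:
  assumes X: "finite X" and mono: "\<And>A B. A \<subseteq> B \<Longrightarrow> P A \<Longrightarrow> P B" and "k \<le> l"
  shows "measure_pmf.prob (play X \<mu> t k) {h. P (maker_set h)} \<le> measure_pmf.prob (play X \<mu> t l) {h. P (maker_set h)}"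
  using assms(3)
proof (induction l rule: dec_induct)
  case (step l)
  let ?q = "\<lambda>h. if free X h = {} then return_pmf h else map_pmf (\<lambda>e. h @ [(e, t h e)]) (\<mu> h)"
  let ?W = "{h. P (maker_set h)}"
  have "emeasure (play X \<mu> t l) ?W = (\<integral>\<^sup>+h. indicator ?W h \<partial>play X \<mu> t l)" by simp
  also have "\<dots> \<le> (\<integral>\<^sup>+h. emeasure (?q h) ?W \<partial>play X \<mu> t l)"
  proof (rule nn_integral_mono)
    fix h
    show "indicator ?W h \<le> emeasure (?q h) ?W"
    proof (cases "h \<in> ?W")
      case True
      have "P (maker_set g)" if "g \<in> set_pmf (?q h)" for g
      proof (rule mono)
        show "maker_set h \<subseteq> maker_set g" using that by (auto split: if_splits)
        show "P (maker_set h)" using True by simp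
      qed
      then have "set_pmf (?q h) \<subseteq> ?W" by blast
      then have "emeasure (?q h) ?W = 1"
        unfolding subset_iff
        by (intro measure_pmf.emeasure_eq_1_AE) (simp_all only: AE_measure_pmf_iff Ball_def simp_thms, simp)
      then show ?thesis by (simp add: indicator_def)
    qed simp
  qed
  also have "\<dots> = emeasure (play X \<mu> t (Suc l)) ?W" by simp
  finally have "measure_pmf.prob (play X \<mu> t l) ?W \<le> measure_pmf.prob (play X \<mu> t (Suc l)) ?W"
    by (simp add: measure_pmf.emeasure_eq_measure)
  with step.IH show ?case by simp
qed simp

lemma win_prob_ge_prefix:
  assumes X: "finite X" and mono: "\<And>A B. A \<subseteq> B \<Longrightarrow> P A \<Longrightarrow> P B" and "k \<le> card X"
  shows "measure_pmf.prob (play X \<mu> t k) {h. P (maker_set h)} \<le> win_prob X P \<mu> t"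
  unfolding win_prob_def by (rule prob_play_mono[OF X mono assms(3)])

text \<open>\<open>f\<close> is a potential whose average over the next edge shrinks by the factor
  \<open>a\<close>. The hypothesis \<open>step\<close> is multiplied out by the number of free
  elements, so that it is a pure counting statement.\<close>

lemma expectation_play_decay:
  fixes f :: "'e history \<Rightarrow> real"
  assumes X: "finite X" and "k \<le> l" "a \<ge> 0"
    and ne: "\<And>i h. k \<le> i \<Longrightarrow> i < l \<Longrightarrow> h \<in> set_pmf (play X (random_maker X) t i) \<Longrightarrow> free X h \<noteq> {}"
    and step: "\<And>i h. k \<le> i \<Longrightarrow> i < l \<Longrightarrow> h \<in> set_pmf (play X (random_maker X) t i) \<Longrightarrow>
      (\<Sum>e\<in>free X h. f (h @ [(e, t h e)])) \<le> a * f h * real (card (free X h))"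
  shows "measure_pmf.expectation (play X (random_maker X) t l) f \<le>
    a ^ (l - k) * measure_pmf.expectation (play X (random_maker X) t k) f"
  using assms(2) ne step
proof (induction l rule: dec_induct)
  case (step l)
  let ?p = "play X (random_maker X) t l"
  have ne: "free X h \<noteq> {}" if "h \<in> set_pmf ?p" for h
    using step.prems(1)[of l h] step.hyps that by simp
  have "measure_pmf.expectation (play X (random_maker X) t (Suc l)) f =
      measure_pmf.expectation ?p (\<lambda>h. (\<Sum>e\<in>free X h. f (h @ [(e, t h e)])) / real (card (free X h)))"
    by (rule expectation_play_Suc[OF X ne])
  also have "\<dots> \<le> measure_pmf.expectation ?p (\<lambda>h. a * f h)"
  proof (rule expectation_mono_pmf[OF finite_set_pmf_play[OF X]])
    fix h assume h: "h \<in> set_pmf ?p"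
    have "real (card (free X h)) > 0" using finite_free[OF X] ne[OF h] by (simp add: card_gt_0_iff)
    then show "(\<Sum>e\<in>free X h. f (h @ [(e, t h e)])) / real (card (free X h)) \<le> a * f h"
      using step.prems(2)[of l h] step.hyps h by (simp add: divide_le_eq)
  qed
  also have "\<dots> = a * measure_pmf.expectation ?p f" by simp
  also have "\<dots> \<le> a * (a ^ (l - k) * measure_pmf.expectation (play X (random_maker X) t k) f)"
    using step.IH step.prems assms(3) by (intro mult_left_mono) auto
  finally show ?case using step.hyps by (simp add: Suc_diff_le)
qed simp

section \<open>Structure and embeddings of the target graph\<close>

text \<open>Three edges forming a connected subgraph: a path, a star or a triangle. This is the
  local form of \<open>3 \<le> max_component_edges V E\<close>.\<close>

definition path3 :: "'a set set \<Rightarrow> bool" where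
  "path3 E \<longleftrightarrow> (\<exists>e\<in>E. \<exists>f\<in>E. \<exists>g\<in>E. e \<noteq> f \<and> f \<noteq> g \<and> e \<noteq> g \<and> e \<inter> f \<noteq> {} \<and> f \<inter> g \<noteq> {})"

lemma nsets_2D:
  assumes "e \<in> nsets V 2"
  obtains x y where "e = {x, y}" "x \<noteq> y" "x \<in> V" "y \<in> V"
  using assms by (auto simp: nsets_2_eq)

lemma Union_nsets_subset: "E \<subseteq> nsets V k \<Longrightarrow> \<Union>E \<subseteq> V"
  unfolding nsets_def by blast

lemma edge_subset_component:
  assumes "simple_graph V E" "v \<in> V" "e \<in> E" "e \<inter> graph_component V E v \<noteq> {}"
  shows "e \<subseteq> graph_component V E v"
proof
  fix y assume y: "y \<in> e"
  obtain x where x: "x \<in> e" "x \<in> V" "reachable_in E V v x"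
    using assms(4) by (auto simp: graph_component_def)
  have "e \<in> nsets V 2" using assms(1,3) by (auto simp: simple_graph_def)
  then have "y \<in> V" "x = y \<or> e = {x, y}" using x(1) y by (auto elim!: nsets_2D)
  moreover have "reachable_in E V v y"
    using \<open>x = y \<or> e = {x, y}\<close> x assms(3) \<open>y \<in> V\<close> unfolding reachable_in_def
    by (metis (mono_tags, lifting) rtranclp.rtrancl_into_rtrancl)
  ultimately show "y \<in> graph_component V E v" by (simp add: graph_component_def)
qed

lemma component_refl: "v \<in> V \<Longrightarrow> v \<in> graph_component V E v"
  by (simp add: graph_component_def reachable_in_def)

lemma card_component_edges_le:
  assumes "simple_graph V E" "v \<in> V"
  shows "card {e \<in> E. e \<subseteq> graph_component V E v} \<le> max_component_edges V E"
  using assms unfolding max_component_edges_def simple_graph_def by (intro Max_ge) auto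

lemma finite_simple_graph: "simple_graph V E \<Longrightarrow> finite E"
  unfolding simple_graph_def using finite_imp_finite_nsets finite_subset by blast

lemma max_component_edges_ge_3:
  assumes H: "simple_graph V E" and "path3 E"
  shows "3 \<le> max_component_edges V E"
proof -
  obtain e f g where efg: "e \<in> E" "f \<in> E" "g \<in> E" "e \<noteq> f" "f \<noteq> g" "e \<noteq> g" "e \<inter> f \<noteq> {}" "f \<inter> g \<noteq> {}"
    using assms(2) unfolding path3_def by blast
  then obtain v where v: "v \<in> e" "v \<in> f" by blast
  then have "v \<in> V" using H efg by (auto simp: simple_graph_def nsets_def)
  note sub = edge_subset_component[OF H this] and refl = component_refl[OF this, of E]
  have f: "f \<subseteq> graph_component V E v" using sub[OF efg(2)] v refl by blast
  then have "{e, f, g} \<subseteq> {e \<in> E. e \<subseteq> graph_component V E v}"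
    using efg sub[OF efg(1)] sub[OF efg(3)] v refl by blast
  then have "card {e, f, g} \<le> card {e \<in> E. e \<subseteq> graph_component V E v}"
    using finite_simple_graph[OF H] by (intro card_mono) auto
  also have "\<dots> \<le> max_component_edges V E" by (rule card_component_edges_le[OF H \<open>v \<in> V\<close>])
  finally show ?thesis using efg by simp
qed

lemma max_component_edges_ge_2:
  assumes H: "simple_graph V E" and ef: "e \<in> E" "f \<in> E" "e \<noteq> f" "e \<inter> f \<noteq> {}"
  shows "2 \<le> max_component_edges V E"
proof -
  obtain v where v: "v \<in> e" "v \<in> f" using ef by blast
  then have "v \<in> V" using H ef by (auto simp: simple_graph_def nsets_def)
  note sub = edge_subset_component[OF H this] and refl = component_refl[OF this, of E]
  have "{e, f} \<subseteq> {e \<in> E. e \<subseteq> graph_component V E v}"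
    using ef sub[OF ef(1)] sub[OF ef(2)] v refl by blast
  then have "card {e, f} \<le> card {e \<in> E. e \<subseteq> graph_component V E v}"
    using finite_simple_graph[OF H] by (intro card_mono) auto
  also have "\<dots> \<le> max_component_edges V E" by (rule card_component_edges_le[OF H \<open>v \<in> V\<close>])
  finally show ?thesis using ef by simp
qed

lemma component_subset_closed:
  assumes "\<And>e. e \<in> E \<Longrightarrow> e \<inter> A \<noteq> {} \<Longrightarrow> e \<subseteq> A" "v \<in> A"
  shows "graph_component V E v \<subseteq> A"
proof
  fix u assume "u \<in> graph_component V E v"
  then have "reachable_in E V v u" by (simp add: graph_component_def)
  then show "u \<in> A" unfolding reachable_in_def
  proof (induction rule: rtranclp_induct)
    case (step y z)
    then show ?case using assms(1)[of "{y, z}"] by auto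
  qed (rule assms(2))
qed

text \<open>A vertex set closed under adjacency contains the component of each of its vertices, so
  it is enough to know the edges that meet it.\<close>

lemma component_edges_subset:
  assumes H: "simple_graph V E" and "v \<in> A" "B \<subseteq> E"
    and closed: "\<And>e. e \<in> E \<Longrightarrow> e \<inter> A \<noteq> {} \<Longrightarrow> e \<in> B \<and> e \<subseteq> A"
  shows "card {e \<in> E. e \<subseteq> graph_component V E v} \<le> card B"
proof (rule card_mono)
  show "finite B" using finite_simple_graph[OF H] assms(3) finite_subset by blast
  have comp: "graph_component V E v \<subseteq> A" using closed assms(2) by (intro component_subset_closed) auto
  have "e \<noteq> {}" if "e \<in> E" for e using H that by (auto simp: simple_graph_def nsets_def)
  then show "{e \<in> E. e \<subseteq> graph_component V E v} \<subseteq> B" using comp closed by blast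
qed

lemma max_component_edges_leI:
  assumes "simple_graph V E" "\<And>v. v \<in> V \<Longrightarrow> card {e \<in> E. e \<subseteq> graph_component V E v} \<le> k"
  shows "max_component_edges V E \<le> k"
  using assms unfolding max_component_edges_def simple_graph_def by (subst Max_le_iff) auto

lemma max_component_edges_le_1:
  assumes H: "simple_graph V E" and disj: "\<And>e f. e \<in> E \<Longrightarrow> f \<in> E \<Longrightarrow> e \<noteq> f \<Longrightarrow> e \<inter> f = {}"
  shows "max_component_edges V E \<le> 1"
proof (rule max_component_edges_leI[OF H])
  fix v assume "v \<in> V"
  show "card {e \<in> E. e \<subseteq> graph_component V E v} \<le> 1"
  proof (cases "\<exists>e\<in>E. v \<in> e")
    case True
    then obtain e where "e \<in> E" "v \<in> e" by blast
    then have "card {e \<in> E. e \<subseteq> graph_component V E v} \<le> card {e}"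
      using disj by (intro component_edges_subset[OF H \<open>v \<in> e\<close>]) auto
    then show ?thesis by simp
  next
    case False
    then have "card {e \<in> E. e \<subseteq> graph_component V E v} \<le> card ({} :: 'a set set)"
      by (intro component_edges_subset[OF H, of v "{v}"]) auto
    then show ?thesis by simp
  qed
qed

text \<open>An edge and one neighbouring edge already exhaust their component: any third edge
  touching it meets one of the two and completes a \<open>path3\<close>.\<close>

lemma max_component_edges_le_2:
  assumes H: "simple_graph V E" and no: "\<not> path3 E"
  shows "max_component_edges V E \<le> 2"
proof (rule max_component_edges_leI[OF H])
  fix v assume "v \<in> V"
  show "card {e \<in> E. e \<subseteq> graph_component V E v} \<le> 2"
  proof (cases "\<exists>e\<in>E. v \<in> e")
    case True
    then obtain e where e: "e \<in> E" "v \<in> e" by blast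
    show ?thesis
    proof (cases "\<exists>f\<in>E. f \<noteq> e \<and> f \<inter> e \<noteq> {}")
      case True
      then obtain f where f: "f \<in> E" "f \<noteq> e" "f \<inter> e \<noteq> {}" by blast
      have "card {e \<in> E. e \<subseteq> graph_component V E v} \<le> card {e, f}"
      proof (rule component_edges_subset[OF H, of v "e \<union> f"])
        show "g \<in> {e, f} \<and> g \<subseteq> e \<union> f" if g: "g \<in> E" "g \<inter> (e \<union> f) \<noteq> {}" for g
        proof -
          have "g \<in> {e, f}"
          proof (rule ccontr)
            assume n: "g \<notin> {e, f}"
            have "g \<inter> e \<noteq> {} \<or> g \<inter> f \<noteq> {}" using g(2) by blast
            then have "path3 E" unfolding path3_def using n e f g(1) by blast
            with no show False ..
          qed
          then show ?thesis by blast
        qed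
      qed (use e f in auto)
      also have "\<dots> \<le> 2" by (simp add: card_insert_if)
      finally show ?thesis .
    next
      case False
      then have "card {e \<in> E. e \<subseteq> graph_component V E v} \<le> card {e}"
        using e by (intro component_edges_subset[OF H \<open>v \<in> e\<close>]) auto
      then show ?thesis by simp
    qed
  next
    case False
    then have "card {e \<in> E. e \<subseteq> graph_component V E v} \<le> card ({} :: 'a set set)"
      by (intro component_edges_subset[OF H, of v "{v}"]) auto
    then show ?thesis by simp
  qed
qed

section \<open>Embedding graphs whose components have at most two edges\<close>

fun cherry_verts :: "'a \<times> 'a \<times> 'a \<Rightarrow> 'a set" where
  "cherry_verts (x, c, y) = {x, c, y}"

text \<open>A path with two edges, its centre in the middle. Triples are ordered, so each such path
  occurs in both directions.\<close>

fun is_cherry :: "'a set set \<Rightarrow> 'a \<times> 'a \<times> 'a \<Rightarrow> bool" where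
  "is_cherry M (x, c, y) \<longleftrightarrow> x \<noteq> c \<and> c \<noteq> y \<and> x \<noteq> y \<and> {x, c} \<in> M \<and> {c, y} \<in> M"

lemma embed_matching:
  assumes "finite E" "E \<subseteq> nsets V 2" "disjoint E" "finite M'" "M' \<subseteq> nsets W 2" "disjoint M'"
    and "card E \<le> card M'"
  shows "\<exists>\<phi>. inj_on \<phi> (\<Union>E) \<and> \<phi> ` \<Union>E \<subseteq> \<Union>M' \<and> (\<forall>e\<in>E. \<phi> ` e \<in> M')"
  using assms
proof (induction E arbitrary: M' rule: finite_induct)
  case (insert e E)
  then have "card M' > 0" by auto
  then have "M' \<noteq> {}" by auto
  then obtain m where m: "m \<in> M'" by blast
  have card: "card E \<le> card (M' - {m})" using insert.hyps insert.prems m by simp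
  obtain \<phi> where \<phi>: "inj_on \<phi> (\<Union>E)" "\<phi> ` \<Union>E \<subseteq> \<Union>(M' - {m})" "\<forall>e\<in>E. \<phi> ` e \<in> M' - {m}"
  proof -
    have 1: "E \<subseteq> nsets V 2" "M' - {m} \<subseteq> nsets W 2" "finite (M' - {m})"
      using insert.prems by auto
    have 2: "disjoint E" "disjoint (M' - {m})"
      by (rule pairwise_subset[OF insert.prems(2)], blast)
        (rule pairwise_subset[OF insert.prems(5)], blast)
    from insert.IH[OF 1(1) 2(1) 1(3,2) 2(2) card] show ?thesis using that by (elim exE conjE)
  qed
  obtain x y where e: "e = {x, y}" "x \<noteq> y" using insert.prems(1) by (auto elim!: nsets_2D)
  obtain p q where m2: "m = {p, q}" "p \<noteq> q" using insert.prems(4) m by (auto elim!: nsets_2D)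
  have disj: "e \<inter> \<Union>E = {}"
  proof -
    have "disjnt e f" if "f \<in> E" for f
      using that insert.hyps(2) by (intro pairwiseD[OF insert.prems(2)]) auto
    then show ?thesis by (auto simp: disjnt_def)
  qed
  have disjm: "m \<inter> \<Union>(M' - {m}) = {}"
  proof -
    have "disjnt m f" if "f \<in> M' - {m}" for f
      using that m by (intro pairwiseD[OF insert.prems(5)]) auto
    then show ?thesis by (auto simp: disjnt_def)
  qed
  define \<psi> where "\<psi> = \<phi>(x := p, y := q)"
  have eq: "\<psi> v = \<phi> v" if "v \<in> \<Union>E" for v using that disj e by (auto simp: \<psi>_def)
  have xy: "\<psi> x = p" "\<psi> y = q" using e by (auto simp: \<psi>_def)
  have "inj_on \<psi> (\<Union>E)" using \<phi>(1) eq by (simp add: inj_on_def)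
  moreover have img: "\<psi> ` \<Union>E \<subseteq> \<Union>(M' - {m})" using \<phi>(2) eq by (simp add: image_subset_iff)
  moreover have "\<psi> ` e = m" "inj_on \<psi> e" using xy e m2 by auto
  ultimately have inj: "inj_on \<psi> (e \<union> \<Union>E)"
    using disjm by (subst inj_on_Un) blast
  moreover have "\<psi> ` f = \<phi> ` f" if "f \<in> E" for f using eq that by (intro image_cong) auto
  moreover have "\<psi> ` \<Union>(insert e E) \<subseteq> \<Union>M'" using img \<open>\<psi> ` e = m\<close> m by auto
  ultimately show ?case using \<phi>(3) \<open>\<psi> ` e = m\<close> m by (intro exI[of _ \<psi>]) auto
qed auto

text \<open>\<open>A\<close> is the edge set of the component of \<open>e\<close>. Without three
  connected edges it is a single edge or two edges with a common vertex, and either fits into a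
  cherry.\<close>

lemma embed_in_cherry:
  assumes e: "e \<in> E" and "E \<subseteq> nsets V 2" "\<not> path3 E" "is_cherry M p"
  shows "\<exists>A \<psi>. e \<in> A \<and> A \<subseteq> E \<and> (\<forall>g\<in>E - A. g \<inter> \<Union>A = {}) \<and>
    inj_on \<psi> (\<Union>A) \<and> \<psi> ` \<Union>A \<subseteq> cherry_verts p \<and> (\<forall>e\<in>A. \<psi> ` e \<in> M)"
proof -
    obtain px pc py where pp: "p = (px, pc, py)" by (cases p)
    have cherry: "px \<noteq> pc" "pc \<noteq> py" "px \<noteq> py" "{px, pc} \<in> M" "{pc, py} \<in> M"
      using assms(4) pp by auto
    show ?thesis
    proof (cases "\<exists>f\<in>E. f \<noteq> e \<and> f \<inter> e \<noteq> {}")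
      case True
      then obtain f where f: "f \<in> E" "f \<noteq> e" "f \<inter> e \<noteq> {}" by blast
      then obtain c where c: "c \<in> e" "c \<in> f" by blast
      obtain x where x: "e = {x, c}" "x \<noteq> c" using e assms(2) c(1) by (auto elim!: nsets_2D)
      obtain y where y: "f = {c, y}" "y \<noteq> c" using f assms(2) c(2) by (auto elim!: nsets_2D)
      have xy: "x \<noteq> y" using x y f by auto
      define \<psi> where "\<psi> v = (if v = x then px else if v = c then pc else py)" for v
      have [simp]: "\<psi> x = px" "\<psi> c = pc" "\<psi> y = py" using x y xy by (auto simp: \<psi>_def)
      show ?thesis
      proof (intro exI[of _ "{e, f}"] exI[of _ \<psi>] conjI ballI)
        fix g assume that: "g \<in> E - {e, f}"
        show "g \<inter> \<Union>{e, f} = {}"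
        proof (rule ccontr)
          assume "g \<inter> \<Union>{e, f} \<noteq> {}"
          then have "g \<inter> e \<noteq> {} \<or> g \<inter> f \<noteq> {}" by blast
          then have "path3 E" unfolding path3_def using that e f by blast
          with assms(3) show False ..
        qed
      next
        show "inj_on \<psi> (\<Union>{e, f})" using x y xy cherry by (auto simp: inj_on_def)
        show "\<psi> ` \<Union>{e, f} \<subseteq> cherry_verts p" using x y pp by auto
        fix g assume "g \<in> {e, f}"
        then show "\<psi> ` g \<in> M" using x y cherry by (auto simp: insert_commute)
      qed (use e f in auto)
    next
      case False
      obtain x c where x: "e = {x, c}" "x \<noteq> c" using e assms(2) by (auto elim!: nsets_2D)
      define \<psi> where "\<psi> v = (if v = x then px else pc)" for v
      have [simp]: "\<psi> x = px" "\<psi> c = pc" using x by (auto simp: \<psi>_def)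
      show ?thesis
        by (intro exI[of _ "{e}"] exI[of _ \<psi>]) (use e False x cherry pp in \<open>auto simp: inj_on_def\<close>)
    qed
qed

text \<open>Each component uses up one cherry and has at least one edge, so \<open>card E\<close>
  cherries suffice. Strong induction, because a component may take two edges away at once.\<close>

lemma embed_cherries:
  assumes "finite E" "E \<subseteq> nsets V 2" "\<not> path3 E" "finite P" "disjoint_family_on cherry_verts P"
    and "\<And>p. p \<in> P \<Longrightarrow> is_cherry M p" "card E \<le> card P"
  shows "\<exists>\<phi>. inj_on \<phi> (\<Union>E) \<and> \<phi> ` \<Union>E \<subseteq> \<Union>(cherry_verts ` P) \<and> (\<forall>e\<in>E. \<phi> ` e \<in> M)"
  using assms
proof (induction "card E" arbitrary: E P rule: less_induct)
  case less
  show ?case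
  proof (cases "E = {}")
    case False
    then obtain e where e: "e \<in> E" by blast
    then have "card E > 0" using less.prems(1) by (auto simp: card_gt_0_iff)
    then have "card P > 0" using less.prems(7) by linarith
    then obtain p where p: "p \<in> P" by (auto simp: card_gt_0_iff)
    have "\<exists>A \<psi>. e \<in> A \<and> A \<subseteq> E \<and> (\<forall>g\<in>E - A. g \<inter> \<Union>A = {}) \<and>
      inj_on \<psi> (\<Union>A) \<and> \<psi> ` \<Union>A \<subseteq> cherry_verts p \<and> (\<forall>e\<in>A. \<psi> ` e \<in> M)"
      by (rule embed_in_cherry[OF e less.prems(2,3) less.prems(6)[OF p]])
    then obtain A \<psi> where A: "e \<in> A" "A \<subseteq> E" "\<forall>g\<in>E - A. g \<inter> \<Union>A = {}"
      and \<psi>: "inj_on \<psi> (\<Union>A)" "\<psi> ` \<Union>A \<subseteq> cherry_verts p" "\<forall>e\<in>A. \<psi> ` e \<in> M"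
      by (elim exE conjE)
    have finA: "finite A" using A(2) less.prems(1) finite_subset by blast
    have "card A \<noteq> 0" using A(1) finA by auto
    then have cA: "card A \<ge> 1" by simp
    have cE: "card (E - A) = card E - card A" using A(2) finA by (simp add: card_Diff_subset)
    have "\<not> path3 (E - A)" using less.prems(3) unfolding path3_def by blast
    moreover have "disjoint_family_on cherry_verts (P - {p})"
      using less.prems(5) by (auto simp: disjoint_family_on_def)
    ultimately obtain \<phi> where \<phi>: "inj_on \<phi> (\<Union>(E - A))" "\<phi> ` \<Union>(E - A) \<subseteq> \<Union>(cherry_verts ` (P - {p}))"
        "\<forall>e\<in>E - A. \<phi> ` e \<in> M"
      using less.hyps[of "E - A" "P - {p}"] less.prems cA cE \<open>card E > 0\<close> p
      by (force simp: card_Diff_singleton)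
    have disj: "\<Union>A \<inter> \<Union>(E - A) = {}" using A(3) by blast
    have disjp: "cherry_verts p \<inter> \<Union>(cherry_verts ` (P - {p})) = {}"
      using less.prems(5) p by (auto simp: disjoint_family_on_def)
    define \<theta> where "\<theta> v = (if v \<in> \<Union>A then \<psi> v else \<phi> v)" for v
    have eqA: "\<theta> ` B = \<psi> ` B" if "B \<subseteq> \<Union>A" for B using that by (intro image_cong) (auto simp: \<theta>_def)
    have eqE: "\<theta> ` B = \<phi> ` B" if "B \<subseteq> \<Union>(E - A)" for B
      using that disj by (intro image_cong) (auto simp: \<theta>_def)
    have split: "\<Union>E = \<Union>A \<union> \<Union>(E - A)" using A(2) by blast
    have "inj_on \<theta> (\<Union>A)" using \<psi>(1) by (auto simp: \<theta>_def inj_on_def)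
    moreover have "inj_on \<theta> (\<Union>(E - A))" using \<phi>(1) disj unfolding \<theta>_def inj_on_def by (metis disjoint_iff)
    moreover have "\<theta> ` \<Union>A \<inter> \<theta> ` \<Union>(E - A) = {}"
      unfolding eqA[OF subset_refl] eqE[OF subset_refl] using \<psi>(2) \<phi>(2) disjp by blast
    ultimately have c1: "inj_on \<theta> (\<Union>E)" unfolding split by (subst inj_on_Un) blast
    have c2: "\<theta> ` \<Union>E \<subseteq> \<Union>(cherry_verts ` P)"
    proof -
      have "\<theta> ` \<Union>E = \<theta> ` \<Union>A \<union> \<theta> ` \<Union>(E - A)" by (simp only: split image_Un)
      also have "\<dots> \<subseteq> cherry_verts p \<union> \<Union>(cherry_verts ` (P - {p}))"
        unfolding eqA[OF subset_refl] eqE[OF subset_refl] using \<psi>(2) \<phi>(2) by (rule Un_mono)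
      also have "\<dots> \<subseteq> \<Union>(cherry_verts ` P)" using p by blast
      finally show ?thesis .
    qed
    have c3: "\<theta> ` g \<in> M" if "g \<in> E" for g
    proof (cases "g \<in> A")
      case True
      then have "\<theta> ` g = \<psi> ` g" by (intro eqA) auto
      then show ?thesis using True \<psi>(3) by simp
    next
      case False
      then have "\<theta> ` g = \<phi> ` g" using that by (intro eqE) auto
      then show ?thesis using False that \<phi>(3) by simp
    qed
    show ?thesis by (rule exI[of _ \<theta>], intro conjI ballI c1 c2 c3)
  next
    case True
    show ?thesis unfolding True by (rule exI[of _ "\<lambda>_. undefined"]) simp
  qed
qed

text \<open>All branch sets are singletons. The map \<phi> places the vertices that lie on edges;
  the isolated ones go to arbitrary remaining vertices, for which \<open>card V \<le> n\<close>
  makes room.\<close>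

lemma has_minor_embedding:
  assumes H: "simple_graph V E" and inj: "inj_on \<phi> (\<Union>E)" and img: "\<phi> ` \<Union>E \<subseteq> {..<n}"
    and edges: "\<And>e. e \<in> E \<Longrightarrow> \<phi> ` e \<in> M" and n: "card V \<le> n"
  shows "has_minor {..<n} M V E"
proof -
  have "E \<subseteq> nsets V 2" and V1: "finite V" using H by (simp_all add: simple_graph_def)
  note V = V1 Union_nsets_subset[OF this(1)]
  have fin: "finite (\<Union>E)" by (rule finite_subset[OF V(2,1)])
  have "card (V - \<Union>E) = card V - card (\<Union>E)" using V fin by (simp add: card_Diff_subset)
  also have "\<dots> \<le> n - card (\<phi> ` \<Union>E)" using n inj by (simp add: card_image)
  also have "\<dots> = card ({..<n} - \<phi> ` \<Union>E)" using img fin by (subst card_Diff_subset) auto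
  finally have "\<exists>g. inj_on g (V - \<Union>E) \<and> g ` (V - \<Union>E) \<subseteq> {..<n} - \<phi> ` \<Union>E"
    using V by (subst inj_on_iff_card_le) auto
  then obtain g where g: "inj_on g (V - \<Union>E)" "g ` (V - \<Union>E) \<subseteq> {..<n} - \<phi> ` \<Union>E" by blast
  define \<psi> where "\<psi> v = (if v \<in> \<Union>E then \<phi> v else g v)" for v
  have inj\<psi>: "inj_on \<psi> V" unfolding inj_on_def
  proof (intro ballI impI)
    fix u v assume uv: "u \<in> V" "v \<in> V" "\<psi> u = \<psi> v"
    have ne: "g w \<noteq> \<phi> w'" if "w \<in> V - \<Union>E" "w' \<in> \<Union>E" for w w'
      using g(2) that by blast
    show "u = v"
      using uv ne[of u v] ne[of v u] inj_onD[OF inj, of u v] inj_onD[OF g(1), of u v]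
      by (auto simp: \<psi>_def simp del: Union_iff split: if_splits)
  qed
  show ?thesis unfolding has_minor_def
  proof (intro exI[of _ "\<lambda>v. {\<psi> v}"] conjI ballI allI impI)
    show "disjoint_family_on (\<lambda>v. {\<psi> v}) V" using inj\<psi> by (auto simp: disjoint_family_on_def inj_on_def)
  next
    fix v assume "v \<in> V"
    have "\<psi> v \<in> {..<n}"
    proof (cases "v \<in> \<Union>E")
      case True
      then have "\<psi> v = \<phi> v" by (simp only: \<psi>_def if_True)
      then show ?thesis using subsetD[OF img imageI[OF True]] by simp
    next
      case False
      then have "\<psi> v = g v" by (simp only: \<psi>_def if_False)
      then show ?thesis using subsetD[OF g(2) imageI[OF DiffI[OF \<open>v \<in> V\<close> False]]] by simp
    qed
    then show "{\<psi> v} \<subseteq> {..<n}" by simp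
    show "connected_in M {\<psi> v}" by (simp add: connected_in_def reachable_in_def)
  next
    fix v w assume e: "{v, w} \<in> E"
    have "v \<in> \<Union>E" "w \<in> \<Union>E" by (rule UnionI[OF e], simp)+
    then have "\<psi> v = \<phi> v" "\<psi> w = \<phi> w" by (simp_all only: \<psi>_def if_True)
    then show "\<exists>x\<in>{\<psi> v}. \<exists>y\<in>{\<psi> w}. {x, y} \<in> M" using edges[OF e] by simp
  qed simp
qed

lemma reachable_in_mono:
  assumes "E \<subseteq> E'" "A \<subseteq> B" "reachable_in E A u v"
  shows "reachable_in E' B u v"
proof -
  have "reachable_in E A \<le> reachable_in E' B"
    unfolding reachable_in_def using assms(1,2) by (intro rtranclp_mono) auto
  then show ?thesis using assms(3) by blast
qed

lemma connected_in_mono: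
  assumes "E \<subseteq> E'" "connected_in E A"
  shows "connected_in E' A"
  using assms(2) reachable_in_mono[OF assms(1) order_refl] unfolding connected_in_def by simp

lemma has_minor_mono:
  assumes "M \<subseteq> M'" "has_minor W M V E"
  shows "has_minor W M' V E"
proof -
  obtain S where S: "disjoint_family_on S V"
    "\<And>v. v \<in> V \<Longrightarrow> S v \<noteq> {} \<and> S v \<subseteq> W \<and> connected_in M (S v)"
    "\<And>v w. {v, w} \<in> E \<Longrightarrow> \<exists>x\<in>S v. \<exists>y\<in>S w. {x, y} \<in> M"
    using assms(2) unfolding has_minor_def by blast
  show ?thesis unfolding has_minor_def
  proof (intro exI[of _ S] conjI ballI allI impI)
    fix v w assume "{v, w} \<in> E"
    from S(3)[OF this] show "\<exists>x\<in>S v. \<exists>y\<in>S w. {x, y} \<in> M'" using assms(1) by blast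
  qed (use S connected_in_mono[OF assms(1)] in simp_all)
qed

section \<open>Leaves and parent orders of forests\<close>

lemma forest_leaf:
  assumes "finite V" "V \<noteq> {}" "E \<subseteq> nsets V 2" "forest E"
  shows "\<exists>v\<in>V. \<exists>u. \<forall>e\<in>E. v \<in> e \<longrightarrow> e = {v, u}"
proof (rule ccontr)
  assume neg: "\<not> ?thesis"
  have other: "\<exists>w. {v, w} \<in> E \<and> w \<noteq> u" if "v \<in> V" for v u
  proof -
    obtain e where e: "e \<in> E" "v \<in> e" "e \<noteq> {v, u}"
    proof (rule ccontr)
      assume "\<not> thesis"
      then have "\<forall>e\<in>E. v \<in> e \<longrightarrow> e = {v, u}" using that by metis
      then have "\<exists>v\<in>V. \<exists>u. \<forall>e\<in>E. v \<in> e \<longrightarrow> e = {v, u}"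
        by (intro bexI[OF _ \<open>v \<in> V\<close>] exI)
      with neg show False ..
    qed
    have "e \<in> nsets V 2" using e(1) assms(3) by (rule subsetD[rotated])
    then obtain x y where "e = {x, y}" by (rule nsets_2D)
    then have "e = {v, x} \<or> e = {v, y}" using e(2) by (auto simp: insert_commute)
    then show ?thesis using e(1,3) by blast
  qed
  \<comment> \<open>If there were no leaf, the first vertex of a longest path would have a second
    neighbour; this neighbour lies on the path and closes a cycle.\<close>
  define is_path where "is_path xs \<longleftrightarrow> xs \<noteq> [] \<and> distinct xs \<and> set xs \<subseteq> V \<and>
      (\<forall>i. Suc i < length xs \<longrightarrow> {xs ! i, xs ! Suc i} \<in> E)" for xs
  obtain v where "v \<in> V" using assms(2) by blast
  then have "is_path [v]" by (simp add: is_path_def)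
  moreover have "\<forall>xs. is_path xs \<longrightarrow> length xs < Suc (card V)"
    using assms(1) by (metis card_mono distinct_card is_path_def less_Suc_eq_le)
  ultimately have "\<exists>xs. is_path xs \<and> (\<forall>ys. is_path ys \<longrightarrow> length ys \<le> length xs)"
    by (rule ex_has_greatest_nat)
  then obtain xs where xs: "is_path xs" and max: "\<And>ys. is_path ys \<Longrightarrow> length ys \<le> length xs"
    by (elim exE conjE) simp
  define x0 where "x0 = xs ! 0"
  have x0: "x0 \<in> V" using xs by (auto simp: x0_def is_path_def)
  \<comment> \<open>For a path with one vertex \<open>xs ! 1\<close> is unspecified;
    \<open>other\<close> still gives a neighbour different from that value.\<close>
  obtain w where w: "{x0, w} \<in> E" "w \<noteq> xs ! 1" using other[OF x0] by blast
  have wV: "w \<in> V" "w \<noteq> x0" using w(1) assms(3) by (auto simp: nsets_def card_2_iff doubleton_eq_iff)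
  have "w \<in> set xs"
  proof (rule ccontr)
    assume "w \<notin> set xs"
    have "{(w # xs) ! i, (w # xs) ! Suc i} \<in> E" if "Suc i < length (w # xs)" for i
      using that w(1) xs by (cases i) (auto simp: x0_def is_path_def insert_commute)
    then have "is_path (w # xs)" using \<open>w \<notin> set xs\<close> wV xs by (auto simp: is_path_def)
    from max[OF this] show False by simp
  qed
  then obtain j where j: "j < length xs" "xs ! j = w" by (auto simp: in_set_conv_nth)
  have "xs ! j \<noteq> xs ! 0" "xs ! j \<noteq> xs ! 1" using j w wV by (simp_all add: x0_def)
  then have "j \<noteq> 0" "j \<noteq> 1" by metis+
  then have j2: "j \<ge> 2" by simp
  have "is_cycle E (take (Suc j) xs)" unfolding is_cycle_def
  proof (intro conjI allI impI)
    show "3 \<le> length (take (Suc j) xs)" using j j2 by simp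
    show "distinct (take (Suc j) xs)" using xs by (simp add: is_path_def)
    fix i assume "i < length (take (Suc j) xs)"
    then have i: "i < Suc j" using j by simp
    have len: "length (take (Suc j) xs) = Suc j" using j by simp
    show "{take (Suc j) xs ! i, take (Suc j) xs ! (Suc i mod length (take (Suc j) xs))} \<in> E"
    proof (cases "i = j")
      case True
      then show ?thesis using w(1) j len by (simp add: x0_def insert_commute)
    next
      case False
      then show ?thesis using i j xs len by (simp add: is_path_def)
    qed
  qed
  with assms(4) show False by (auto simp: forest_def)
qed

lemma forest_subset: "forest E \<Longrightarrow> E' \<subseteq> E \<Longrightarrow> forest E'"
  by (auto simp: forest_def is_cycle_def subset_iff)

text \<open>A leaf is split off and numbered last. Every positive index gets a parent, so
  \<open>p\<close> describes a tree that contains the forest.\<close>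

lemma forest_order:
  assumes "finite V" "E \<subseteq> nsets V 2" "forest E"
  shows "\<exists>f p. bij_betw f {..<card V} V \<and> (\<forall>i. 0 < i \<longrightarrow> i < card V \<longrightarrow> p i < i) \<and>
     (\<forall>e\<in>E. \<exists>i. 0 < i \<and> i < card V \<and> e = {f i, f (p i)})"
  using assms
proof (induction "card V" arbitrary: V E)
  case 0
  then have "V = {}" by simp
  then have "E = {}" using 0(3) by (force simp: nsets_def)
  with 0 show ?case by (auto simp: bij_betw_def)
next
  case (Suc k)
  then have "V \<noteq> {}" by auto
  then obtain v u where v: "v \<in> V" and u: "\<And>e. e \<in> E \<Longrightarrow> v \<in> e \<Longrightarrow> e = {v, u}"
    using forest_leaf[OF Suc.prems(1) _ Suc.prems(2,3)] by blast
  let ?V = "V - {v}" and ?E = "{e \<in> E. v \<notin> e}"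
  have k: "card ?V = k" "card V = Suc k" using Suc.hyps(2) Suc.prems(1) v by simp_all
  have "?E \<subseteq> nsets ?V 2" using Suc.prems(2) by (auto simp: nsets_def)
  moreover have "forest ?E" by (rule forest_subset[OF Suc.prems(3)]) auto
  ultimately obtain f p where f: "bij_betw f {..<k} ?V" and p: "\<And>i. 0 < i \<Longrightarrow> i < k \<Longrightarrow> p i < i"
    and E: "\<And>e. e \<in> ?E \<Longrightarrow> \<exists>i. 0 < i \<and> i < k \<and> e = {f i, f (p i)}"
    using Suc.hyps(1)[of ?V ?E] k Suc.prems(1) by (metis (no_types, lifting) finite_Diff)
  \<comment> \<open>If \<open>u\<close> is not another vertex, \<open>v\<close> is isolated and gets
    the default parent 0.\<close>
  define j where "j = (if u \<in> ?V then (SOME i. i < k \<and> f i = u) else 0)"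
  have j: "j < k \<and> f j = u" if "u \<in> ?V"
  proof -
    have "u \<in> f ` {..<k}" using bij_betw_imp_surj_on[OF f] that by simp
    then have ex: "\<exists>i. i < k \<and> f i = u" by auto
    have "j = (SOME i. i < k \<and> f i = u)" using that by (simp add: j_def)
    then show ?thesis using someI_ex[OF ex] by simp
  qed
  define f' where "f' = f(k := v)"
  define p' where "p' = p(k := j)"
  have c1: "bij_betw f' {..<Suc k} V"
  proof -
    have "bij_betw f' {..<k} ?V" using f by (rule bij_betw_cong[THEN iffD1, rotated]) (auto simp: f'_def)
    then have "bij_betw f' ({..<k} \<union> {k}) (?V \<union> {f' k})"
      by (intro bij_betw_combine) (auto simp: f'_def)
    then show ?thesis using v by (simp add: f'_def lessThan_Suc insert_absorb Un_commute)
  qed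
  have c2: "\<forall>i. 0 < i \<longrightarrow> i < Suc k \<longrightarrow> p' i < i"
  proof (intro allI impI)
    fix i assume i: "0 < i" "i < Suc k"
    show "p' i < i"
    proof (cases "i = k")
      case True
      then show ?thesis using i j by (cases "u \<in> ?V") (auto simp: p'_def j_def)
    next
      case False
      then show ?thesis using i p by (simp add: p'_def)
    qed
  qed
  have c3: "\<forall>e\<in>E. \<exists>i. 0 < i \<and> i < Suc k \<and> e = {f' i, f' (p' i)}"
  proof
    fix e assume eE: "e \<in> E"
    show "\<exists>i. 0 < i \<and> i < Suc k \<and> e = {f' i, f' (p' i)}"
    proof (cases "v \<in> e")
      case True
      then have e: "e = {v, u}" using u eE by blast
      have "{v, u} \<in> nsets V 2" using subsetD[OF Suc.prems(2) eE] e by simp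
      then have uV: "u \<in> ?V" by auto
      then show ?thesis using j[OF uV] e by (intro exI[of _ k]) (simp add: f'_def p'_def)
    next
      case False
      then have "e \<in> ?E" using eE by simp
      from E[OF this] obtain i where i: "0 < i" "i < k" "e = {f i, f (p i)}" by (elim exE conjE)
      then show ?thesis using p[OF i(1,2)] by (intro exI[of _ i]) (simp add: f'_def p'_def)
    qed
  qed
  have "bij_betw f' {..<Suc k} V \<and> (\<forall>i. 0 < i \<longrightarrow> i < Suc k \<longrightarrow> p' i < i) \<and>
     (\<forall>e\<in>E. \<exists>i. 0 < i \<and> i < Suc k \<and> e = {f' i, f' (p' i)})"
    using c1 c2 c3 by (rule conjI[OF _ conjI])
  then show ?case unfolding k(2) by (intro exI)
qed

section \<open>Obstructions to minors\<close>

lemma has_minorE: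
  assumes "has_minor W M V E"
  obtains S where "\<And>v w. v \<in> V \<Longrightarrow> w \<in> V \<Longrightarrow> v \<noteq> w \<Longrightarrow> S v \<inter> S w = {}"
    and "\<And>v. v \<in> V \<Longrightarrow> S v \<noteq> {}" "\<And>v. v \<in> V \<Longrightarrow> S v \<subseteq> W" "\<And>v. v \<in> V \<Longrightarrow> connected_in M (S v)"
    and "\<And>v w. {v, w} \<in> E \<Longrightarrow> \<exists>x y. x \<in> S v \<and> y \<in> S w \<and> {x, y} \<in> M"
proof -
  obtain S where S: "disjoint_family_on S V"
    "\<forall>v\<in>V. S v \<noteq> {} \<and> S v \<subseteq> W \<and> connected_in M (S v)"
    "\<forall>v w. {v, w} \<in> E \<longrightarrow> (\<exists>x\<in>S v. \<exists>y\<in>S w. {x, y} \<in> M)"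
    using assms unfolding has_minor_def by (elim exE conjE)
  show ?thesis
  proof (rule that[of S])
    show "S v \<inter> S w = {}" if "v \<in> V" "w \<in> V" "v \<noteq> w" for v w
      using disjoint_family_onD[OF S(1) that] .
    show "\<exists>x y. x \<in> S v \<and> y \<in> S w \<and> {x, y} \<in> M" if "{v, w} \<in> E" for v w
      using S(3) that by meson
  qed (use S(2) in simp_all)
qed

lemma connected_in_step:
  assumes "connected_in M S" "x \<in> S" "y \<in> S" "x \<noteq> y"
  obtains z where "z \<in> S" "{x, z} \<in> M"
proof -
  have "(\<lambda>x y. x \<in> S \<and> y \<in> S \<and> {x, y} \<in> M)\<^sup>*\<^sup>* x y"
    using assms(1-3) unfolding connected_in_def reachable_in_def by simp
  then show ?thesis using that assms(4) by (cases rule: converse_rtranclpE) auto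
qed

lemma connected_in_const:
  assumes "connected_in M S" "x \<in> S" "y \<in> S" and "\<And>u v. {u, v} \<in> M \<Longrightarrow> c u = c v"
  shows "c x = c y"
proof -
  have "(\<lambda>x y. x \<in> S \<and> y \<in> S \<and> {x, y} \<in> M)\<^sup>*\<^sup>* x y"
    using assms(1-3) unfolding connected_in_def reachable_in_def by simp
  then show ?thesis
  proof (induction rule: rtranclp_induct)
    case (step y z)
    then show ?case using assms(4)[of y z] by simp
  qed simp
qed

text \<open>Each edge of \<open>E\<close> selects an edge of \<open>M\<close> between its two branch
  sets, and disjointness of the branch sets recovers the edge of \<open>E\<close> from it.\<close>

lemma has_minor_card_edges_le:
  assumes "has_minor W M V E" "E \<subseteq> nsets V 2" "finite M"
  shows "card E \<le> card M"
proof -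
  obtain S where S: "\<And>v w. v \<in> V \<Longrightarrow> w \<in> V \<Longrightarrow> v \<noteq> w \<Longrightarrow> S v \<inter> S w = {}"
    and edge: "\<And>v w. {v, w} \<in> E \<Longrightarrow> \<exists>x y. x \<in> S v \<and> y \<in> S w \<and> {x, y} \<in> M"
    using has_minorE[OF assms(1)] by metis
  have ex: "\<exists>f. \<exists>v w x y. e = {v, w} \<and> v \<in> V \<and> w \<in> V \<and> f = {x, y} \<and> x \<in> S v \<and> y \<in> S w \<and> f \<in> M" if e: "e \<in> E" for e
  proof -
    obtain v w where vw: "e = {v, w}" "v \<in> V" "w \<in> V" using subsetD[OF assms(2) e] by (auto elim: nsets_2D)
    then obtain x y where "x \<in> S v" "y \<in> S w" "{x, y} \<in> M" using edge[of v w] e by auto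
    with vw show ?thesis by metis
  qed
  define g where "g e = (SOME f. \<exists>v w x y. e = {v, w} \<and> v \<in> V \<and> w \<in> V \<and> f = {x, y} \<and> x \<in> S v \<and> y \<in> S w \<and> f \<in> M)" for e
  have g: "\<exists>v w x y. e = {v, w} \<and> v \<in> V \<and> w \<in> V \<and> g e = {x, y} \<and> x \<in> S v \<and> y \<in> S w \<and> g e \<in> M" if "e \<in> E" for e
    unfolding g_def using ex[OF that] by (rule someI_ex)
  have uniq: "v = w" if "x \<in> S v" "x \<in> S w" "v \<in> V" "w \<in> V" for x v w
    using S[of v w] that by blast
  have "inj_on g E"
  proof (rule inj_onI)
    fix e e' assume e: "e \<in> E" "e' \<in> E" "g e = g e'"
    obtain v w x y where 1: "e = {v, w}" "v \<in> V" "w \<in> V" "g e = {x, y}" "x \<in> S v" "y \<in> S w"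
      using g[OF e(1)] by auto
    obtain v' w' x' y' where 2: "e' = {v', w'}" "v' \<in> V" "w' \<in> V" "g e' = {x', y'}" "x' \<in> S v'" "y' \<in> S w'"
      using g[OF e(2)] by auto
    have "{x, y} = {x', y'}" using 1 2 e by simp
    then consider "x = x'" "y = y'" | "x = y'" "y = x'" by (auto simp: doubleton_eq_iff)
    then show "e = e'"
    proof cases
      case 1: 1
      then have "v = v'" "w = w'" using uniq[of x v v'] uniq[of y w w'] \<open>x \<in> S v\<close> \<open>y \<in> S w\<close> 2 \<open>v \<in> V\<close> \<open>w \<in> V\<close> by simp_all
      then show ?thesis using \<open>e = {v, w}\<close> 2 by simp
    next
      case 3: 2
      then have "v = w'" "w = v'" using uniq[of x v w'] uniq[of y w v'] \<open>x \<in> S v\<close> \<open>y \<in> S w\<close> 2 \<open>v \<in> V\<close> \<open>w \<in> V\<close> by simp_all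
      then show ?thesis using \<open>e = {v, w}\<close> 2 by (simp add: insert_commute)
    qed
  qed
  moreover have "g ` E \<subseteq> M"
  proof
    fix f assume "f \<in> g ` E"
    then obtain e where "e \<in> E" "f = g e" by (rule imageE)
    then show "f \<in> M" using g[of e] by auto
  qed
  ultimately show ?thesis using assms(3) by (metis card_inj_on_le)
qed

text \<open>If the two edges leave the branch set of \<open>v\<close> at the same vertex, they meet.
  Otherwise connectivity gives an edge inside that branch set, which meets the first one at
  \<open>x1\<close>.\<close>

lemma matching_no_P3_minor:
  assumes "has_minor W M V E" and "v \<in> V" "u \<in> V" "w \<in> V" "u \<noteq> v" "w \<noteq> v" "u \<noteq> w"
    and "{v, u} \<in> E" "{v, w} \<in> E"
  shows "\<exists>e\<in>M. \<exists>f\<in>M. e \<noteq> f \<and> e \<inter> f \<noteq> {}"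
proof -
  obtain S where S: "\<And>v w. v \<in> V \<Longrightarrow> w \<in> V \<Longrightarrow> v \<noteq> w \<Longrightarrow> S v \<inter> S w = {}"
    and conn: "\<And>v. v \<in> V \<Longrightarrow> connected_in M (S v)"
    and edge: "\<And>v w. {v, w} \<in> E \<Longrightarrow> \<exists>x y. x \<in> S v \<and> y \<in> S w \<and> {x, y} \<in> M"
    using has_minorE[OF assms(1)] by metis
  obtain x1 y1 where 1: "x1 \<in> S v" "y1 \<in> S u" "{x1, y1} \<in> M" using edge[OF assms(8)] by auto
  obtain x2 y2 where 2: "x2 \<in> S v" "y2 \<in> S w" "{x2, y2} \<in> M" using edge[OF assms(9)] by auto
  have disj: "S u \<inter> S v = {}" "S w \<inter> S v = {}" "S u \<inter> S w = {}" using S assms(2-7) by simp_all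
  show ?thesis
  proof (cases "x1 = x2")
    case True
    have "{x1, y1} \<noteq> {x2, y2}" using 1 2 disj by (auto simp: doubleton_eq_iff)
    then show ?thesis using 1(3) 2(3) True by (intro bexI[of _ "{x1, y1}"] bexI[of _ "{x2, y2}"]) auto
  next
    case False
    obtain z where z: "z \<in> S v" "{x1, z} \<in> M"
      using connected_in_step[OF conn[OF assms(2)] 1(1) 2(1) False] by blast
    have "{x1, y1} \<noteq> {x1, z}" using 1 z disj by (auto simp: doubleton_eq_iff)
    then show ?thesis using 1(3) z(2) by (intro bexI[of _ "{x1, y1}"] bexI[of _ "{x1, z}"]) auto
  qed
qed

text \<open>\<open>c\<close> maps a vertex to the centre of its star. Connectivity puts all three
  edges into one star, so both outer edges contain its centre, although they run between disjoint
  pairs of branch sets.\<close>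

lemma stars_no_P4_minor:
  assumes "has_minor W M V E" and V: "a \<in> V" "b \<in> V" "d \<in> V" "f \<in> V" "distinct [a, b, d, f]"
    and E: "{a, b} \<in> E" "{b, d} \<in> E" "{d, f} \<in> E"
    and star: "\<And>x y. {x, y} \<in> M \<Longrightarrow> c x = c y \<and> (x = c x \<or> y = c y)"
  shows False
proof -
  obtain S where S: "\<And>v w. v \<in> V \<Longrightarrow> w \<in> V \<Longrightarrow> v \<noteq> w \<Longrightarrow> S v \<inter> S w = {}"
    and conn: "\<And>v. v \<in> V \<Longrightarrow> connected_in M (S v)"
    and edge: "\<And>v w. {v, w} \<in> E \<Longrightarrow> \<exists>x y. x \<in> S v \<and> y \<in> S w \<and> {x, y} \<in> M"
    using has_minorE[OF assms(1)] by metis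
  obtain x1 y1 where 1: "x1 \<in> S a" "y1 \<in> S b" "{x1, y1} \<in> M" using edge[OF E(1)] by auto
  obtain x2 y2 where 2: "x2 \<in> S b" "y2 \<in> S d" "{x2, y2} \<in> M" using edge[OF E(2)] by auto
  obtain x3 y3 where 3: "x3 \<in> S d" "y3 \<in> S f" "{x3, y3} \<in> M" using edge[OF E(3)] by auto
  have const: "c u = c v" if "{u, v} \<in> M" for u v using star[OF that] by simp
  have "c y1 = c x2" by (rule connected_in_const[OF conn[OF V(2)] 1(2) 2(1) const])
  moreover have "c y2 = c x3" by (rule connected_in_const[OF conn[OF V(3)] 2(2) 3(1) const])
  ultimately have "c x1 = c x3" using const 1(3) 2(3) by metis
  moreover have "x1 = c x1 \<or> y1 = c x1" "x3 = c x3 \<or> y3 = c x3" using star[OF 1(3)] star[OF 3(3)] by auto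
  ultimately have "c x1 \<in> S a \<union> S b" "c x1 \<in> S d \<union> S f" using 1 3 by auto
  moreover have "S a \<inter> S d = {}" "S a \<inter> S f = {}" "S b \<inter> S d = {}" "S b \<inter> S f = {}" using S V by auto
  ultimately show False by blast
qed

text \<open>The edge count of a spanning tree, in ordered pairs so that it can be compared with a
  degree sum. The tree grows from \<open>x0\<close>: as long as \<open>T\<close> is not all of
  \<open>S\<close>, some edge leaves it within \<open>S\<close>.\<close>

lemma connected_in_edge_pairs:
  assumes "connected_in M S" "finite S" "S \<noteq> {}" "\<And>x. {x} \<notin> M"
  shows "2 * (card S - 1) \<le> card {(x, y). x \<in> S \<and> y \<in> S \<and> {x, y} \<in> M}"
proof -
  let ?P = "\<lambda>T. {(x, y). x \<in> T \<and> y \<in> T \<and> {x, y} \<in> M}"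
  have fin: "finite (?P T)" if "finite T" for T
    by (rule finite_subset[of _ "T \<times> T"]) (use that in auto)
  obtain x0 where x0: "x0 \<in> S" using assms(3) by auto
  have "Suc k \<le> card S \<Longrightarrow> \<exists>T. x0 \<in> T \<and> T \<subseteq> S \<and> card T = Suc k \<and> 2 * k \<le> card (?P T)" for k
  proof (induction k)
    case 0
    then show ?case using x0 by (intro exI[of _ "{x0}"]) simp
  next
    case (Suc k)
    then have "\<exists>T. x0 \<in> T \<and> T \<subseteq> S \<and> card T = Suc k \<and> 2 * k \<le> card (?P T)" by simp
    then obtain T where T: "x0 \<in> T" "T \<subseteq> S" "card T = Suc k" "2 * k \<le> card (?P T)" by (elim exE conjE)
    have finT: "finite T" using T(2) assms(2) by (rule finite_subset)
    have "T \<noteq> S" using T(3) Suc.prems by auto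
    then obtain s where s: "s \<in> S" "s \<notin> T" using T(2) by auto
    have "\<exists>x z. x \<in> T \<and> z \<in> S \<and> z \<notin> T \<and> {x, z} \<in> M"
    proof (rule ccontr)
      assume no: "\<not> ?thesis"
      have "(\<lambda>x y. x \<in> S \<and> y \<in> S \<and> {x, y} \<in> M)\<^sup>*\<^sup>* x0 s"
        using assms(1) x0 s(1) unfolding connected_in_def reachable_in_def by simp
      then have "s \<in> T"
      proof (induction rule: rtranclp_induct)
        case (step y z)
        then show ?case using no by metis
      qed (rule T(1))
      with s show False by simp
    qed
    then obtain x z where xz: "x \<in> T" "z \<in> S" "z \<notin> T" "{x, z} \<in> M" by (elim exE conjE)
    have "x \<noteq> z" using xz by auto
    have "card (?P T) + 2 = card (?P T \<union> {(x, z), (z, x)})"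
      using xz \<open>x \<noteq> z\<close> fin[OF finT] by (subst card_Un_disjoint) auto
    also have "\<dots> \<le> card (?P (insert z T))"
      using xz finT by (intro card_mono fin) (auto simp: insert_commute)
    finally have "2 * Suc k \<le> card (?P (insert z T))" using T(4) by simp
    moreover have "card (insert z T) = Suc (Suc k)" using xz finT T(3) by simp
    ultimately show ?case using T xz by (intro exI[of _ "insert z T"]) simp
  qed
  from this[of "card S - 1"] have "\<exists>T. x0 \<in> T \<and> T \<subseteq> S \<and> card T = card S \<and> 2 * (card S - 1) \<le> card (?P T)"
    using assms(2,3) by (simp add: card_gt_0_iff Suc_leI)
  then obtain T where "T \<subseteq> S" "card T = card S" "2 * (card S - 1) \<le> card (?P T)" by (elim exE conjE)
  moreover from this have "T = S" using assms(2) by (simp add: card_subset_eq)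
  ultimately show ?thesis by simp
qed

text \<open>The degrees in the branch set of the centre \<open>b\<close> sum to at most
  \<open>2 * card (S b)\<close>. A spanning tree inside and the three edges to the other branch sets
  already contribute one more than that.\<close>

lemma max_degree_2_no_K13_minor:
  assumes "has_minor W M V E" "finite W" and V: "a \<in> V" "b \<in> V" "d \<in> V" "f \<in> V" "distinct [a, b, d, f]"
    and E: "{b, a} \<in> E" "{b, d} \<in> E" "{b, f} \<in> E"
    and deg: "\<And>x. card {y. {x, y} \<in> M} \<le> 2" "\<And>x. finite {y. {x, y} \<in> M}" and loop: "\<And>x. {x} \<notin> M"
  shows False
proof -
  obtain S where S0: "disjoint_family_on S V"
    "\<forall>v\<in>V. S v \<noteq> {} \<and> S v \<subseteq> W \<and> connected_in M (S v)"
    "\<forall>v w. {v, w} \<in> E \<longrightarrow> (\<exists>x\<in>S v. \<exists>y\<in>S w. {x, y} \<in> M)"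
    using assms(1) unfolding has_minor_def by (elim exE conjE)
  note S = disjoint_family_onD[OF S0(1)]
  have ne: "S v \<noteq> {}" and sub: "S v \<subseteq> W" and conn: "connected_in M (S v)" if "v \<in> V" for v
    using S0(2) that by simp_all
  have edge: "\<exists>x y. x \<in> S v \<and> y \<in> S w \<and> {x, y} \<in> M" if "{v, w} \<in> E" for v w
    using S0(3) that by meson
  obtain x1 y1 where 1: "x1 \<in> S b" "y1 \<in> S a" "{x1, y1} \<in> M" using edge[OF E(1)] by auto
  obtain x2 y2 where 2: "x2 \<in> S b" "y2 \<in> S d" "{x2, y2} \<in> M" using edge[OF E(2)] by auto
  obtain x3 y3 where 3: "x3 \<in> S b" "y3 \<in> S f" "{x3, y3} \<in> M" using edge[OF E(3)] by auto
  have fin: "finite (S b)" using sub[OF V(2)] assms(2) by (rule finite_subset)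
  have disj: "S a \<inter> S b = {}" "S d \<inter> S b = {}" "S f \<inter> S b = {}" "S a \<inter> S d = {}" "S a \<inter> S f = {}" "S d \<inter> S f = {}"
    using S V by auto
  let ?in = "{(x, y). x \<in> S b \<and> y \<in> S b \<and> {x, y} \<in> M}"
  let ?all = "Sigma (S b) (\<lambda>x. {y. {x, y} \<in> M})"
  let ?out = "{(x1, y1), (x2, y2), (x3, y3)}"
  have finall: "finite ?all" using fin deg(2) by (intro finite_SigmaI)
  have in_all: "?in \<subseteq> ?all" by auto
  then have finin: "finite ?in" using finall by (rule finite_subset)
  have "y1 \<noteq> y2" "y1 \<noteq> y3" "y2 \<noteq> y3" using 1 2 3 disj by auto
  then have "card ?out = 3" by simp
  have "2 * (card (S b) - 1) + 3 \<le> card ?in + card ?out"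
    using connected_in_edge_pairs[OF conn[OF V(2)] fin ne[OF V(2)] loop] \<open>card ?out = 3\<close> by simp
  also have "\<dots> = card (?in \<union> ?out)" using finin 1 2 3 disj by (intro card_Un_disjoint[symmetric]) auto
  also have "\<dots> \<le> card ?all" using finall in_all 1 2 3 by (intro card_mono) auto
  also have "\<dots> = (\<Sum>x\<in>S b. card {y. {x, y} \<in> M})" using fin deg(2) by (simp add: card_SigmaI)
  also have "\<dots> \<le> (\<Sum>x\<in>S b. 2)" using deg(1) by (intro sum_mono)
  finally have "2 * (card (S b) - 1) + 3 \<le> 2 * card (S b)" by simp
  moreover have "card (S b) > 0" using fin ne[OF V(2)] by (simp add: card_gt_0_iff)
  ultimately show False by simp
qed

section \<open>Acyclic graphs as graphs in which every edge is a bridge\<close>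

definition conn :: "'a set set \<Rightarrow> 'a \<Rightarrow> 'a \<Rightarrow> bool" where
  "conn E = (\<lambda>x y. {x, y} \<in> E)\<^sup>*\<^sup>*"

text \<open>Acyclicity in a form that can be maintained when edges are inserted and deleted, without
  handling cycles as vertex lists.\<close>

definition all_bridges :: "'a set set \<Rightarrow> bool" where
  "all_bridges E \<longleftrightarrow> (\<forall>x y. {x, y} \<in> E \<longrightarrow> \<not> conn (E - {{x, y}}) x y)"

lemma conn_refl [simp]: "conn E x x"
  by (simp add: conn_def)

lemma conn_edge: "{x, y} \<in> E \<Longrightarrow> conn E x y"
  by (simp add: conn_def r_into_rtranclp)

lemma conn_trans: "conn E x y \<Longrightarrow> conn E y z \<Longrightarrow> conn E x z"
  unfolding conn_def by (rule rtranclp_trans)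

lemma conn_sym: "conn E x y \<Longrightarrow> conn E y x"
  unfolding conn_def
proof (induction rule: rtranclp_induct)
  case (step y z)
  have "{z, y} \<in> E" using step.hyps(2) by (simp add: insert_commute)
  then show ?case using step.IH by (rule converse_rtranclp_into_rtranclp)
qed simp

lemma conn_mono: "E \<subseteq> E' \<Longrightarrow> conn E x y \<Longrightarrow> conn E' x y"
  unfolding conn_def by (rule rtranclp_mono[THEN predicate2D]) auto

lemma connected_in_conn:
  assumes "connected_in M S" "x \<in> S" "y \<in> S" and "\<And>u v. u \<in> S \<Longrightarrow> v \<in> S \<Longrightarrow> {u, v} \<in> M \<Longrightarrow> {u, v} \<in> M'"
  shows "conn M' x y"
proof -
  have "(\<lambda>x y. x \<in> S \<and> y \<in> S \<and> {x, y} \<in> M)\<^sup>*\<^sup>* x y"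
    using assms(1-3) unfolding connected_in_def reachable_in_def by simp
  then show ?thesis
  proof (induction rule: rtranclp_induct)
    case (step y z)
    then show ?case using assms(4)[of y z] conn_trans[OF step.IH conn_edge] by simp
  qed simp
qed

text \<open>A cycle of the target, followed through its branch sets, yields a closed route in
  \<open>M\<close>. The edge \<open>{x, y}\<close> between the first two branch sets is not a
  bridge, as the rest of the route joins its ends.\<close>

lemma minor_of_bridges_forest:
  assumes "has_minor W M V E" "all_bridges M" "E \<subseteq> nsets V 2"
  shows "forest E"
  unfolding forest_def
proof
  assume "\<exists>xs. is_cycle E xs"
  then obtain xs where xs: "is_cycle E xs" by (rule exE)
  define l where "l = length xs"
  have l: "3 \<le> l" "distinct xs" "\<And>i. i < l \<Longrightarrow> {xs ! i, xs ! (Suc i mod l)} \<in> E"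
    using xs by (simp_all add: is_cycle_def l_def)
  obtain S where S: "\<And>v w. v \<in> V \<Longrightarrow> w \<in> V \<Longrightarrow> v \<noteq> w \<Longrightarrow> S v \<inter> S w = {}"
    and conn: "\<And>v. v \<in> V \<Longrightarrow> connected_in M (S v)"
    and edge: "\<And>v w. {v, w} \<in> E \<Longrightarrow> \<exists>x y. x \<in> S v \<and> y \<in> S w \<and> {x, y} \<in> M"
    using has_minorE[OF assms(1)] by metis
  define T where "T i = S (xs ! i)" for i
  have inV: "xs ! i \<in> V" if "i < l" for i
    using subsetD[OF assms(3) l(3)[OF that]] by simp
  have disj: "T i \<inter> T j = {}" if "i < l" "j < l" "i \<noteq> j" for i j
    unfolding T_def using that l(2) inV by (intro S) (simp_all add: nth_eq_iff_index_eq l_def)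
  have next_edge: "\<exists>x y. x \<in> T i \<and> y \<in> T (Suc i mod l) \<and> {x, y} \<in> M" if "i < l" for i
    unfolding T_def by (rule edge[OF l(3)[OF that]])
  obtain x y where xy: "x \<in> T 0" "y \<in> T 1" "{x, y} \<in> M" using next_edge[of 0] l(1) by auto
  let ?M = "M - {{x, y}}"
  have inside: "conn ?M u v" if "u \<in> T i" "v \<in> T i" "i < l" for i u v
  proof (rule connected_in_conn[OF _ that(1,2)])
    show "connected_in M (T i)" unfolding T_def by (rule conn[OF inV[OF that(3)]])
    fix p q assume pq: "p \<in> T i" "q \<in> T i" "{p, q} \<in> M"
    have "{p, q} \<noteq> {x, y}"
    proof
      assume "{p, q} = {x, y}"
      then have "x \<in> T i" "y \<in> T i" using pq by (auto simp: doubleton_eq_iff)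
      then show False using disj[of 0 i] disj[of 1 i] xy that(3) l(1) by (cases "i = 0") auto
    qed
    then show "{p, q} \<in> ?M" using pq by simp
  qed
  have across: "\<exists>p q. p \<in> T i \<and> q \<in> T (Suc i mod l) \<and> {p, q} \<in> ?M" if i: "0 < i" "i < l" for i
  proof -
    obtain p q where pq: "p \<in> T i" "q \<in> T (Suc i mod l)" "{p, q} \<in> M" using next_edge[OF i(2)] by auto
    have "{p, q} \<noteq> {x, y}"
    proof
      assume "{p, q} = {x, y}"
      then consider "p = x" | "p = y" "q = x" by (auto simp: doubleton_eq_iff)
      then show False
      proof cases
        case 1
        then show False using disj[of 0 i] i xy pq by auto
      next
        case 2
        \<comment> \<open>Coming back along the same edge would need a cycle of length two; this is
          where \<open>3 \<le> l\<close> enters.\<close>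
        then have "i = 1" using disj[of 1 i] i xy pq l(1) by auto
        then show False using disj[of 0 2] 2 xy pq l(1) by (auto simp: numeral_2_eq_2)
      qed
    qed
    then show ?thesis using pq by blast
  qed
  have "\<forall>v\<in>T (Suc i). conn ?M y v" if "Suc i < l" for i
    using that
  proof (induction i)
    case 0
    then show ?case using inside[of y 1] xy by simp
  next
    case (Suc i)
    obtain p q where pq: "p \<in> T (Suc i)" "q \<in> T (Suc (Suc i))" "{p, q} \<in> ?M"
      using across[of "Suc i"] Suc.prems by auto
    have "conn ?M y q" using Suc pq by (intro conn_trans[OF _ conn_edge[OF pq(3)]]) simp
    then show ?case using inside[OF pq(2)] Suc.prems by (auto intro: conn_trans)
  qed
  from this[of "l - 2"] have last: "\<forall>v\<in>T (l - 1). conn ?M y v" using l(1) by (simp add: Suc_diff_Suc numeral_2_eq_2)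
  obtain p q where pq: "p \<in> T (l - 1)" "q \<in> T 0" "{p, q} \<in> ?M"
    using across[of "l - 1"] l(1) by auto
  have "conn ?M y q" using last pq by (intro conn_trans[OF _ conn_edge[OF pq(3)]]) simp
  moreover have "conn ?M q x" by (rule inside[OF pq(2) xy(1)]) (use l(1) in simp)
  ultimately have "conn ?M y x" by (rule conn_trans)
  then have "conn ?M x y" by (rule conn_sym)
  then show False using assms(2) xy(3) unfolding all_bridges_def by metis
qed

section \<open>Strategies of Breaker\<close>

text \<open>The board is exhausted after \<open>k - 1\<close> rounds, before Maker can own
  \<open>k\<close> elements.\<close>

lemma maker_loses_few_edges:
  assumes "finite X" "card X \<le> (k - 1) * (b + 1)" "k \<ge> 1" and P: "\<And>M. finite M \<Longrightarrow> P M \<Longrightarrow> k \<le> card M"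
  shows "\<not> maker_wins b P {} X"
proof -
  \<comment> \<open>\<open>m\<close> is the number of rounds played. Once the board is exhausted,
    the truncated subtraction is 0.\<close>
  define I where "I M F \<longleftrightarrow> finite M \<and> finite F \<and>
    (\<exists>m. card M \<le> m \<and> m \<le> k - 1 \<and> card F \<le> card X - m * (b + 1))" for M F :: "'a set"
  show ?thesis
  proof (rule maker_loses_by_invariant[where I = I])
    show "finite X" by fact
    show "I {} X" using assms(1) by (auto simp: I_def)
  next
    fix M F assume "I M F"
    then show "\<not> P M" using P[of M] assms(3) by (auto simp: I_def)
  next
    fix M F F' :: "'a set" assume I: "I M F" and sub: "F' \<subseteq> F"
    then have "card F' \<le> card F" "finite F'" by (auto simp: I_def intro: card_mono finite_subset)
    then show "I M F'" using I unfolding I_def by (meson le_trans)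
  next
    fix M F :: "'a set" and e assume I: "I M F" and e: "e \<in> F"
    then obtain m where m: "card M \<le> m" "m \<le> k - 1" "card F \<le> card X - m * (b + 1)" and fin: "finite M" "finite F"
      by (auto simp: I_def)
    have "card F > 0" using e fin by (auto simp: card_gt_0_iff)
    then have "m * (b + 1) < (k - 1) * (b + 1)" using m(3) assms(2) by linarith
    then have mk: "Suc m \<le> k - 1" by (simp add: Suc_leI del: mult_Suc_right)
    obtain T where T: "T \<subseteq> F - {e}" "card T = min b (card (F - {e}))"
      by (metis min.cobounded2 obtain_subset_with_card_n)
    have "card (F - {e} - T) = card F - 1 - min b (card F - 1)"
      using T e fin finite_subset[OF T(1)] by (simp add: card_Diff_subset)
    also have "\<dots> \<le> card X - Suc m * (b + 1)" using m(3) by simp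
    finally have "card (F - {e} - T) \<le> card X - Suc m * (b + 1)" .
    moreover have "card (insert e M) \<le> Suc m" using m(1) fin by (simp add: card_insert_if)
    ultimately have "I (insert e M) (F - {e} - T)" using fin mk unfolding I_def by blast
    then show "\<exists>T. T \<subseteq> F - {e} \<and> card T \<le> b \<and> I (insert e M) (F - {e} - T)"
      using T by (intro exI[of _ T]) simp
  qed
qed

lemma card_edges_at_le:
  assumes "F \<subseteq> nsets W 2" "finite Z" "\<And>z. {x, z} \<in> F \<Longrightarrow> z \<in> Z"
  shows "card {f \<in> F. x \<in> f} \<le> card Z"
proof -
  have "{f \<in> F. x \<in> f} \<subseteq> (\<lambda>z. {x, z}) ` Z"
  proof
    fix f assume f: "f \<in> {f \<in> F. x \<in> f}"
    then have "f \<in> nsets W 2" using assms(1) by (auto dest: subsetD)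
    then obtain u v where "f = {u, v}" by (rule nsets_2D)
    then obtain z where "f = {x, z}" using f by (auto simp: insert_commute)
    then show "f \<in> (\<lambda>z. {x, z}) ` Z" using assms(3)[of z] f by simp
  qed
  then have "card {f \<in> F. x \<in> f} \<le> card ((\<lambda>z. {x, z}) ` Z)" using assms(2) by (intro card_mono) auto
  also have "\<dots> \<le> card Z" by (rule card_image_le[OF assms(2)])
  finally show ?thesis .
qed

text \<open>Breaker takes every free edge that meets Maker's new edge, at most \<open>n\<close> at
  either end, so no later edge can touch an earlier one.\<close>

lemma maker_loses_matching:
  assumes "2 * n \<le> b" and P: "\<And>M. P M \<Longrightarrow> \<exists>e\<in>M. \<exists>f\<in>M. e \<noteq> f \<and> e \<inter> f \<noteq> {}"
  shows "\<not> maker_wins b P {} (complete_edges n)"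
proof -
  define I where "I M F \<longleftrightarrow> F \<subseteq> complete_edges n \<and> (\<forall>e\<in>M. \<forall>f\<in>M \<union> F. e \<noteq> f \<longrightarrow> e \<inter> f = {})"
    for M F :: "nat set set"
  show ?thesis
  proof (rule maker_loses_by_invariant[where I = I])
    show "finite (complete_edges n)" by (simp add: finite_imp_finite_nsets)
    show "I {} (complete_edges n)" by (simp add: I_def)
  next
    fix M F assume "I M F"
    then show "\<not> P M" using P[of M] unfolding I_def by (metis UnI1)
  next
    fix M F F' :: "nat set set" assume "I M F" "F' \<subseteq> F"
    then show "I M F'" unfolding I_def by (meson UnE UnI1 UnI2 subsetD subset_trans)
  next
    fix M F :: "nat set set" and e assume fin: "finite F" and I: "I M F" and e: "e \<in> F"
    have F: "F \<subseteq> complete_edges n" using I by (simp add: I_def)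
    have "e \<in> complete_edges n" using F e by (rule subsetD)
    then obtain x y where xy: "e = {x, y}" by (rule nsets_2D)
    define T where "T = {f \<in> F - {e}. f \<inter> e \<noteq> {}}"
    have at: "card {f \<in> F. v \<in> f} \<le> n" for v
      using card_edges_at_le[OF F, of "{..<n}" v] F by fastforce
    have "T \<subseteq> {f \<in> F. x \<in> f} \<union> {f \<in> F. y \<in> f}" unfolding T_def xy by auto
    then have "card T \<le> card ({f \<in> F. x \<in> f} \<union> {f \<in> F. y \<in> f})" using fin by (intro card_mono) auto
    also have "\<dots> \<le> card {f \<in> F. x \<in> f} + card {f \<in> F. y \<in> f}" by (rule card_Un_le)
    also have "\<dots> \<le> b" using at[of x] at[of y] assms(1) by simp
    finally have "card T \<le> b" .
    moreover have "I (insert e M) (F - {e} - T)"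
      unfolding I_def
    proof (intro conjI ballI impI)
      show "F - {e} - T \<subseteq> complete_edges n" using F by auto
      fix g f assume g: "g \<in> insert e M" and f: "f \<in> insert e M \<union> (F - {e} - T)" and ne: "g \<noteq> f"
      have old: "g \<inter> f = {}" if "g \<in> M" "f \<in> M \<union> F" "g \<noteq> f" for g f using I that by (simp add: I_def)
      have new: "e \<inter> f = {}" if "f \<in> F - {e} - T" for f using that unfolding T_def by auto
      show "g \<inter> f = {}" using g f ne old[of g f] old[of f g] new[of f] e by (auto simp: Int_commute)
    qed
    ultimately show "\<exists>T. T \<subseteq> F - {e} \<and> card T \<le> b \<and> I (insert e M) (F - {e} - T)"
      by (intro exI[of _ T]) (auto simp: T_def)
  qed
qed

text \<open>
  \<open>D\<close> holds the dead vertices, which lie on no free edge, and \<open>L\<close> one live vertex of each nontrivial component.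
\<close>

definition one_alive :: "nat \<Rightarrow> nat set set \<Rightarrow> nat set set \<Rightarrow> nat set \<Rightarrow> nat set \<Rightarrow> bool" where
  "one_alive n M F D L \<longleftrightarrow> M \<subseteq> complete_edges n \<and> F \<subseteq> complete_edges n \<and> D \<subseteq> {..<n} \<and> L \<subseteq> {..<n} \<and>
     \<Union>M \<subseteq> D \<union> L \<and> D \<inter> L = {} \<and> card L \<le> card D \<and> (\<forall>f\<in>F. f \<inter> D = {} \<and> \<not> f \<subseteq> L)"

text \<open>The free edges at \<open>d\<close> lead to vertices that are not dead, at most
  \<open>n - card D\<close> of them, and those from \<open>l\<close> to live vertices number at most
  \<open>card L\<close>. Since \<open>card L \<le> card D\<close>, the total is at most
  \<open>n\<close>. The inequality persists, as a round adds one dead vertex and at most one live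
  vertex.\<close>

lemma one_alive_reply:
  assumes "finite F" and J: "one_alive n M F D L" and e: "{d, l} \<in> F" "l \<notin> L \<or> d \<notin> L"
  obtains T where "T \<subseteq> F - {{d, l}}" "card T \<le> n"
    "one_alive n (insert {d, l} M) (F - {{d, l}} - T) (insert d D) (insert l (L - {d}))"
proof -
  have F: "F \<subseteq> complete_edges n" and fD: "\<And>f. f \<in> F \<Longrightarrow> f \<inter> D = {}" and fL: "\<And>f. f \<in> F \<Longrightarrow> \<not> f \<subseteq> L"
    and DL: "D \<subseteq> {..<n}" "L \<subseteq> {..<n}" "card L \<le> card D" "D \<inter> L = {}"
    and M: "M \<subseteq> complete_edges n" "\<Union>M \<subseteq> D \<union> L"
    using J by (simp_all add: one_alive_def)
  have fin: "finite D" "finite L" by (rule finite_subset[OF DL(1)], simp) (rule finite_subset[OF DL(2)], simp)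
  have edge: "{d, l} \<in> complete_edges n" using F e(1) by (rule subsetD)
  then have dl: "d < n" "l < n" "d \<noteq> l" by auto
  have nD: "d \<notin> D" "l \<notin> D" using fD[OF e(1)] by auto
  define T where "T = {f \<in> F - {{d, l}}. d \<in> f \<or> f \<subseteq> insert l L}"
  have "T \<subseteq> {f \<in> F. d \<in> f} \<union> {f \<in> F. f \<subseteq> insert l L}" unfolding T_def by auto
  then have "card T \<le> card ({f \<in> F. d \<in> f} \<union> {f \<in> F. f \<subseteq> insert l L})" using assms(1) by (intro card_mono) auto
  also have "\<dots> \<le> card {f \<in> F. d \<in> f} + card {f \<in> F. f \<subseteq> insert l L}" by (rule card_Un_le)
  also have "card {f \<in> F. d \<in> f} \<le> card ({..<n} - D)"
  proof (rule card_edges_at_le[OF F])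
    fix z assume "{d, z} \<in> F"
    then show "z \<in> {..<n} - D" using fD[of "{d, z}"] subsetD[OF F, of "{d, z}"] by auto
  qed simp
  also have "card ({..<n} - D) = n - card D" using DL fin by (simp add: card_Diff_subset)
  also have "card {f \<in> F. f \<subseteq> insert l L} \<le> card L"
  proof -
    let ?G = "{f \<in> F. f \<subseteq> insert l L}"
    have mem: "l \<in> f" if "f \<in> ?G" for f
    proof (rule ccontr)
      assume "l \<notin> f"
      then have "f \<subseteq> L" using that by auto
      then show False using fL that by auto
    qed
    then have "?G = {f \<in> ?G. l \<in> f}" by auto
    moreover have "card {f \<in> ?G. l \<in> f} \<le> card L"
    proof (rule card_edges_at_le[of _ "{..<n}"])
      show "?G \<subseteq> complete_edges n" using F by auto
      fix z assume z: "{l, z} \<in> ?G"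
      then have "{l, z} \<in> F" by simp
      from subsetD[OF F this] have "l \<noteq> z" by simp
      moreover have "z \<in> insert l L" using z by simp
      ultimately show "z \<in> L" by simp
    qed (rule fin)
    ultimately show ?thesis by simp
  qed
  also have "n - card D + card L \<le> n"
    using DL card_mono[OF _ DL(1)] by simp
  finally have "card T \<le> n" by simp
  moreover have "T \<subseteq> F - {{d, l}}" unfolding T_def by auto
  moreover have "one_alive n (insert {d, l} M) (F - {{d, l}} - T) (insert d D) (insert l (L - {d}))"
    unfolding one_alive_def
  proof (intro conjI ballI)
    show "insert {d, l} M \<subseteq> complete_edges n" using M(1) edge by simp
    show "F - {{d, l}} - T \<subseteq> complete_edges n" using F by auto
    show "insert d D \<subseteq> {..<n}" "insert l (L - {d}) \<subseteq> {..<n}" using DL dl by auto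
    show "\<Union>(insert {d, l} M) \<subseteq> insert d D \<union> insert l (L - {d})" using M(2) by auto
    show "insert d D \<inter> insert l (L - {d}) = {}" using DL(4) dl nD by auto
    have "card (insert l (L - {d})) \<le> Suc (card (L - {d}))" using fin by (simp add: card_insert_if)
    also have "\<dots> \<le> Suc (card L)" using fin by (simp add: card_Diff1_le)
    finally show "card (insert l (L - {d})) \<le> card (insert d D)" using DL(3) fin nD by simp
  next
    fix f assume f: "f \<in> F - {{d, l}} - T"
    then have "f \<in> F" "d \<notin> f" "\<not> f \<subseteq> insert l L" by (auto simp: T_def)
    then show "f \<inter> insert d D = {}" "\<not> f \<subseteq> insert l (L - {d})" using fD[of f] by auto
  qed
  ultimately show thesis by (intro that[of T])
qed

text \<open>An end \<open>d\<close> of Maker's edge outside \<open>L\<close> is new to his graph. It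
  is killed and becomes a leaf, with the surviving end as its centre. Hence every vertex that is not
  dead is its own centre, and new edges can only attach leaves to centres.\<close>

lemma maker_loses_stars:
  assumes "n \<le> b" and P: "\<And>M c. P M \<Longrightarrow> (\<And>x y. {x, y} \<in> M \<Longrightarrow> c x = c y \<and> (x = c x \<or> y = c y)) \<Longrightarrow> False"
  shows "\<not> maker_wins b P {} (complete_edges n)"
proof -
  define I where "I M F \<longleftrightarrow> (\<exists>D L c. one_alive n M F D L \<and>
      (\<forall>x y. {x, y} \<in> M \<longrightarrow> c x = c y \<and> (x = c x \<or> y = c y)) \<and> (\<forall>v. v \<notin> D \<longrightarrow> c v = (v :: nat)))" for M F
  show ?thesis
  proof (rule maker_loses_by_invariant[where I = I])
    show "finite (complete_edges n)" by (simp add: finite_imp_finite_nsets)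
    have "one_alive n {} (complete_edges n) {} {}" by (auto simp: one_alive_def nsets_def)
    then show "I {} (complete_edges n)" unfolding I_def by (intro exI[of _ "{}"] exI[of _ id]) simp
  next
    fix M F assume "I M F"
    then obtain c where "\<And>x y. {x, y} \<in> M \<Longrightarrow> c x = c y \<and> (x = c x \<or> y = c y)"
      unfolding I_def by metis
    then show "\<not> P M" using P[of M c] by metis
  next
    fix M F F' assume "I M F" and sub: "F' \<subseteq> F"
    moreover have "one_alive n M F' D L" if "one_alive n M F D L" for D L
      using that sub unfolding one_alive_def by (meson subset_eq)
    ultimately show "I M F'" unfolding I_def by metis
  next
    fix M F e assume fin: "finite F" and "I M F" and e: "e \<in> F"
    then obtain D L c where J: "one_alive n M F D L"
      and c: "\<And>x y. {x, y} \<in> M \<Longrightarrow> c x = c y \<and> (x = c x \<or> y = c y)" and cD: "\<And>v. v \<notin> D \<Longrightarrow> c v = v"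
      unfolding I_def by metis
    have "e \<in> complete_edges n" using J e by (auto simp: one_alive_def)
    then obtain x y where xy: "e = {x, y}" by (rule nsets_2D)
    have "\<not> e \<subseteq> L" using J e by (auto simp: one_alive_def)
    then obtain d l where dl: "e = {d, l}" "d \<notin> L" using xy by (auto simp: insert_commute)
    obtain T where T: "T \<subseteq> F - {{d, l}}" "card T \<le> n"
      "one_alive n (insert {d, l} M) (F - {{d, l}} - T) (insert d D) (insert l (L - {d}))"
      by (rule one_alive_reply[OF fin J e[unfolded dl(1)]]) (use dl(2) in auto)
    have nD: "d \<notin> D" "l \<notin> D" "d \<noteq> l" using J e dl \<open>e \<in> complete_edges n\<close> by (auto simp: one_alive_def)
    have dM: "d \<notin> \<Union>M" using J dl nD by (auto simp: one_alive_def)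
    define c' where "c' = c(d := l)"
    have "c' p = c' q \<and> (p = c' p \<or> q = c' q)" if "{p, q} \<in> insert {d, l} M" for p q
    proof (cases "{p, q} = {d, l}")
      case True
      have "c' d = l" "c' l = l" using nD cD[of l] by (simp_all add: c'_def)
      then show ?thesis using True by (auto simp: doubleton_eq_iff)
    next
      case False
      then have pq: "{p, q} \<in> M" using that by simp
      then have "p \<noteq> d" "q \<noteq> d" using dM by auto
      then have "c' p = c p" "c' q = c q" by (simp_all add: c'_def)
      then show ?thesis using c[OF pq] by metis
    qed
    moreover have "\<forall>v. v \<notin> insert d D \<longrightarrow> c' v = v" using cD by (simp add: c'_def)
    ultimately have "I (insert e M) (F - {e} - T)" using T(3) unfolding I_def dl(1) by metis
    then show "\<exists>T. T \<subseteq> F - {e} \<and> card T \<le> b \<and> I (insert e M) (F - {e} - T)"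
      using T(1,2) assms(1) dl(1) by (intro exI[of _ T]) simp
  qed
qed

text \<open>The opposite choice: the end \<open>l\<close> new to Maker's graph survives, now with
  degree 1, and the other end dies with degree at most 2. So Maker only prolongs paths at their live
  ends.\<close>

lemma maker_loses_max_degree_2:
  assumes "n \<le> b" and P: "\<And>M. P M \<Longrightarrow> M \<subseteq> complete_edges n \<Longrightarrow> (\<And>x. card {y. {x, y} \<in> M} \<le> 2) \<Longrightarrow> False"
  shows "\<not> maker_wins b P {} (complete_edges n)"
proof -
  define I where "I M F \<longleftrightarrow> (\<exists>D L. one_alive n M F D L \<and>
      (\<forall>x. card {y. {x, y} \<in> M} \<le> 2) \<and> (\<forall>x\<in>L. card {y. {x, y} \<in> M} \<le> 1))" for M F
  show ?thesis
  proof (rule maker_loses_by_invariant[where I = I])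
    show "finite (complete_edges n)" by (simp add: finite_imp_finite_nsets)
    have "one_alive n {} (complete_edges n) {} {}" by (auto simp: one_alive_def nsets_def)
    then show "I {} (complete_edges n)" unfolding I_def by (intro exI[of _ "{}"]) simp
  next
    fix M F assume "I M F"
    then show "\<not> P M" using P[of M] unfolding I_def one_alive_def by metis
  next
    fix M F F' assume "I M F" and sub: "F' \<subseteq> F"
    moreover have "one_alive n M F' D L" if "one_alive n M F D L" for D L
      using that sub unfolding one_alive_def by (meson subset_eq)
    ultimately show "I M F'" unfolding I_def by metis
  next
    fix M F e assume fin: "finite F" and "I M F" and e: "e \<in> F"
    then obtain D L where J: "one_alive n M F D L"
      and deg: "\<And>x. card {y. {x, y} \<in> M} \<le> 2" and degL: "\<And>x. x \<in> L \<Longrightarrow> card {y. {x, y} \<in> M} \<le> 1"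
      unfolding I_def by metis
    have "e \<in> complete_edges n" using J e by (auto simp: one_alive_def)
    then obtain x y where xy: "e = {x, y}" by (rule nsets_2D)
    have "\<not> e \<subseteq> L" using J e by (auto simp: one_alive_def)
    then obtain d l where dl: "e = {d, l}" "l \<notin> L" using xy by (auto simp: insert_commute)
    obtain T where T: "T \<subseteq> F - {{d, l}}" "card T \<le> n"
      "one_alive n (insert {d, l} M) (F - {{d, l}} - T) (insert d D) (insert l (L - {d}))"
      by (rule one_alive_reply[OF fin J e[unfolded dl(1)]]) (use dl(2) in auto)
    have nD: "d \<notin> D" "l \<notin> D" "d \<noteq> l" using J e dl \<open>e \<in> complete_edges n\<close> by (auto simp: one_alive_def)
    have M: "M \<subseteq> complete_edges n" "\<Union>M \<subseteq> D \<union> L" using J by (simp_all add: one_alive_def)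
    have finN: "finite {y. {x, y} \<in> M}" for x
    proof (rule finite_subset)
      show "{y. {x, y} \<in> M} \<subseteq> {..<n}" using subsetD[OF M(1)] by fastforce
    qed simp
    have fresh: "{y. {v, y} \<in> M} = {}" if "v \<notin> D" "v \<notin> L" for v using M(2) that by auto
    have nbrs: "{y. {v, y} \<in> insert {d, l} M} =
       (if v = d then insert l {y. {v, y} \<in> M} else if v = l then insert d {y. {v, y} \<in> M} else {y. {v, y} \<in> M})" for v
      using nD(3) by (auto simp: doubleton_eq_iff)
    have ins: "card (insert a {y. {v, y} \<in> M}) \<le> Suc (card {y. {v, y} \<in> M})" for a v
      using finN by (simp add: card_insert_if)
    have d1: "card {y. {d, y} \<in> M} \<le> 1" using degL[of d] fresh[of d] nD by (cases "d \<in> L") auto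
    have l0: "card {y. {l, y} \<in> M} = 0" using fresh[of l] nD dl by simp
    have 1: "card {y. {v, y} \<in> insert {d, l} M} \<le> 2" for v
      unfolding nbrs using deg[of v] d1 l0 ins[of l d] ins[of d l] by auto
    have 2: "card {y. {v, y} \<in> insert {d, l} M} \<le> 1" if "v \<in> insert l (L - {d})" for v
      unfolding nbrs using degL[of v] that l0 ins[of d l] by auto
    have "I (insert e M) (F - {e} - T)" using T(3) 1 2 unfolding I_def dl(1) by metis
    then show "\<exists>T. T \<subseteq> F - {e} \<and> card T \<le> b \<and> I (insert e M) (F - {e} - T)"
      using T(1,2) assms(1) dl(1) by (intro exI[of _ T]) simp
  qed
qed

section \<open>Breaker keeps Maker's graph acyclic\<close>

lemma conn_insertD:
  assumes "conn (insert {x, y} A) u v"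
  shows "conn A u v \<or> (conn A u x \<and> conn A y v) \<or> (conn A u y \<and> conn A x v)"
  using assms unfolding conn_def[of "insert {x, y} A"]
proof (induction rule: rtranclp_induct)
  case (step v w)
  show ?case
  proof (cases "{v, w} \<in> A")
    case True
    then show ?thesis using step.IH conn_edge[OF True] conn_trans by metis
  next
    case False
    then have "{v, w} = {x, y}" using step.hyps(2) by simp
    then consider "v = x" "w = y" | "v = y" "w = x" by (auto simp: doubleton_eq_iff)
    then show ?thesis
    proof cases
      case 1
      then show ?thesis using step.IH by auto
    next
      case 2
      then show ?thesis using step.IH by auto
    qed
  qed
qed simp

lemma all_bridges_subset:
  assumes "all_bridges A" "B \<subseteq> A"
  shows "all_bridges B"
  unfolding all_bridges_def
proof (intro allI impI notI)
  fix x y assume "{x, y} \<in> B" "conn (B - {{x, y}}) x y"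
  then have "{x, y} \<in> A" "conn (A - {{x, y}}) x y"
    using assms(2) conn_mono[of "B - {{x, y}}" "A - {{x, y}}"] by auto
  then show False using assms(1) unfolding all_bridges_def by metis
qed

lemma all_bridges_insert:
  assumes A: "all_bridges A" and xy: "\<not> conn A x y"
  shows "all_bridges (insert {x, y} A)"
  unfolding all_bridges_def
proof (intro allI impI notI)
  fix p q assume pq: "{p, q} \<in> insert {x, y} A" "conn (insert {x, y} A - {{p, q}}) p q"
  show False
  proof (cases "{p, q} = {x, y}")
    case True
    then have "conn A p q" using pq(2) by (intro conn_mono[of "insert {x, y} A - {{p, q}}" A]) auto
    then show False using xy True conn_sym[of A p q] by (auto simp: doubleton_eq_iff)
  next
    case False
    then have pqA: "{p, q} \<in> A" using pq(1) by simp
    have "insert {x, y} A - {{p, q}} = insert {x, y} (A - {{p, q}})" using False by auto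
    then have "conn (insert {x, y} (A - {{p, q}})) p q" using pq(2) by simp
    from conn_insertD[OF this]
    have "conn A p x \<and> conn A y q \<or> conn A p y \<and> conn A x q"
    proof (elim disjE conjE)
      assume "conn (A - {{p, q}}) p q"
      then show ?thesis using A pqA unfolding all_bridges_def by metis
    qed (use conn_mono[of "A - {{p, q}}" A] in auto)
    then have "conn A x y" using conn_edge[OF pqA] conn_sym conn_trans by metis
    with xy show False ..
  qed
qed

text \<open>The exchange property of forests. The new edge closes at most one cycle, and this cycle
  uses an edge of \<open>G\<close> because \<open>M\<close> with the new edge is acyclic. Such an
  edge is found in a minimal \<open>H \<subseteq> G\<close> that connects \<open>x\<close> and
  \<open>y\<close> together with \<open>M\<close>.\<close>

lemma all_bridges_exchange:
  assumes A: "all_bridges (M \<union> G)" and e: "all_bridges (insert {x, y} M)" "{x, y} \<notin> M"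
    and G: "finite G" "G \<subseteq> nsets W 2" "M \<inter> G = {}"
  shows "\<exists>R\<subseteq>G. card R \<le> 1 \<and> all_bridges (insert {x, y} (M \<union> (G - R)))"
proof (cases "conn (M \<union> G) x y")
  case False
  then show ?thesis using all_bridges_insert[OF A] by (intro exI[of _ "{}"]) simp
next
  case True
  define Q where "Q H \<longleftrightarrow> H \<subseteq> G \<and> conn (M \<union> H) x y" for H
  have "Q G" using True by (simp add: Q_def)
  then obtain H where H: "Q H" and min: "\<And>H'. Q H' \<Longrightarrow> card H \<le> card H'"
    using ex_has_least_nat[of Q G card] by metis
  have finH: "finite H" using H G(1) by (auto simp: Q_def intro: finite_subset)
  have "\<not> conn M x y"
  proof
    assume "conn M x y"
    then have "conn (insert {x, y} M - {{x, y}}) x y" by (rule conn_mono[rotated]) (use e(2) in auto)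
    then show False using e(1) unfolding all_bridges_def by (metis insertI1)
  qed
  then have "H \<noteq> {}" using H by (auto simp: Q_def)
  then obtain f where f: "f \<in> H" by auto
  have fG: "f \<in> G" using f H by (auto simp: Q_def)
  obtain p q where pq: "f = {p, q}" using subsetD[OF G(2) fG] by (rule nsets_2D)
  have less: "card (H - {f}) < card H" using f finH by (meson card_Diff1_less)
  have notQ: "\<not> Q (H - {f})" using min[of "H - {f}"] less by auto
  then have sep: "\<not> conn (M \<union> (H - {f})) x y" using H by (auto simp: Q_def)
  have "insert {p, q} (M \<union> (H - {f})) = M \<union> H" using f pq by auto
  then have "conn (insert {p, q} (M \<union> (H - {f}))) x y" using H by (simp add: Q_def)
  from conn_insertD[OF this] sep
  have "conn (M \<union> (H - {f})) x p \<and> conn (M \<union> (H - {f})) q y \<or>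
      conn (M \<union> (H - {f})) x q \<and> conn (M \<union> (H - {f})) p y" by simp
  moreover have "conn (M \<union> (G - {f})) u v" if "conn (M \<union> (H - {f})) u v" for u v
    using that by (rule conn_mono[rotated]) (use H in \<open>auto simp: Q_def\<close>)
  ultimately have ends: "conn (M \<union> (G - {f})) x p \<and> conn (M \<union> (G - {f})) q y \<or>
      conn (M \<union> (G - {f})) x q \<and> conn (M \<union> (G - {f})) p y" by metis
  \<comment> \<open>A connection that avoids \<open>f\<close> would join the ends of
    \<open>f\<close> without using it, although \<open>f\<close> is a bridge.\<close>
  have "\<not> conn (M \<union> (G - {f})) x y"
  proof
    assume c: "conn (M \<union> (G - {f})) x y"
    from ends have "conn (M \<union> (G - {f})) p q"
    proof (elim disjE conjE)
      assume "conn (M \<union> (G - {f})) x p" "conn (M \<union> (G - {f})) q y"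
      from conn_trans[OF conn_sym[OF this(1)] conn_trans[OF c conn_sym[OF this(2)]]] show ?thesis .
    next
      assume "conn (M \<union> (G - {f})) x q" "conn (M \<union> (G - {f})) p y"
      from conn_trans[OF this(2) conn_trans[OF conn_sym[OF c] this(1)]] show ?thesis .
    qed
    moreover have "M \<union> (G - {f}) = M \<union> G - {{p, q}}" using fG G(3) pq by auto
    moreover have "{p, q} \<in> M \<union> G" using fG pq by simp
    ultimately show False using A unfolding all_bridges_def by metis
  qed
  moreover have "all_bridges (M \<union> (G - {f}))" by (rule all_bridges_subset[OF A]) auto
  ultimately have "all_bridges (insert {x, y} (M \<union> (G - {f})))" by (intro all_bridges_insert)
  then show ?thesis using fG by (intro exI[of _ "{f}"]) simp
qed

text \<open>In its own colour class Maker's edge merely moves from \<open>F\<close> to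
  \<open>M\<close>, so that class stays acyclic with \<open>M\<close>. Each of the other
  \<open>t - 1\<close> classes costs Breaker at most one edge, which explains
  \<open>t \<le> b + 1\<close>.\<close>

lemma maker_loses_forests:
  fixes col :: "'a set \<Rightarrow> nat"
  assumes X: "finite X" "X \<subseteq> nsets W 2" and t: "0 < t" "t \<le> b + 1"
    and col: "\<And>e. e \<in> X \<Longrightarrow> col e < t" and forests: "\<And>j. j < t \<Longrightarrow> all_bridges {e \<in> X. col e = j}"
    and P: "\<And>M. P M \<Longrightarrow> \<not> all_bridges M"
  shows "\<not> maker_wins b P {} X"
proof -
  define I where "I M F \<longleftrightarrow> M \<union> F \<subseteq> X \<and> M \<inter> F = {} \<and> (\<forall>j<t. all_bridges (M \<union> {f \<in> F. col f = j}))"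
    for M F :: "'a set set"
  show ?thesis
  proof (rule maker_loses_by_invariant[where I = I])
    show "finite X" by fact
    show "I {} X" using forests by (simp add: I_def)
  next
    fix M F assume "I M F"
    then have "all_bridges M" using t(1) all_bridges_subset unfolding I_def by (metis Un_upper1)
    then show "\<not> P M" using P[of M] by auto
  next
    fix M F F' assume I: "I M F" and sub: "F' \<subseteq> F"
    have "all_bridges (M \<union> {f \<in> F'. col f = j})" if "j < t" for j
      by (rule all_bridges_subset[of "M \<union> {f \<in> F. col f = j}"]) (use I sub that in \<open>auto simp: I_def\<close>)
    moreover have "M \<union> F' \<subseteq> X" "M \<inter> F' = {}" using I sub by (auto simp: I_def)
    ultimately show "I M F'" by (simp add: I_def)
  next
    fix M F e assume fin: "finite F" and I: "I M F" and e: "e \<in> F"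
    have MF: "M \<union> F \<subseteq> X" "M \<inter> F = {}" and ab: "\<And>j. j < t \<Longrightarrow> all_bridges (M \<union> {f \<in> F. col f = j})"
      using I by (simp_all add: I_def)
    have eX: "e \<in> X" using e MF by auto
    obtain x y where xy: "e = {x, y}" using subsetD[OF X(2) eX] by (rule nsets_2D)
    have eM: "e \<notin> M" using e MF(2) by auto
    have iM: "all_bridges (insert e M)"
      by (rule all_bridges_subset[OF ab[OF col[OF eX]]]) (use e in auto)
    define good where "good j R \<longleftrightarrow> R \<subseteq> {f \<in> F. col f = j} \<and> card R \<le> 1 \<and>
        all_bridges (insert e (M \<union> ({f \<in> F. col f = j} - R)))" for j R
    have ex: "\<exists>R. good j R" if "j < t" for j
    proof -
      have "\<exists>R\<subseteq>{f \<in> F. col f = j}. card R \<le> 1 \<and> all_bridges (insert {x, y} (M \<union> ({f \<in> F. col f = j} - R)))"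
        by (rule all_bridges_exchange[OF ab[OF that]]) (use iM eM xy fin MF X in auto)
      then obtain R where "R \<subseteq> {f \<in> F. col f = j}" "card R \<le> 1"
        "all_bridges (insert {x, y} (M \<union> ({f \<in> F. col f = j} - R)))" by (elim exE conjE)
      then have "good j R" unfolding good_def xy by (intro conjI)
      then show ?thesis ..
    qed
    define R where "R j = (SOME R. good j R)" for j
    have R: "good j (R j)" if "j < t" for j unfolding R_def using ex[OF that] by (rule someI_ex)
    define J where "J = {..<t} - {col e}"
    define T where "T = (\<Union>j\<in>J. R j)"
    have TF: "T \<subseteq> F - {e}" using R unfolding T_def J_def good_def by fastforce
    have "card T \<le> (\<Sum>j\<in>J. card (R j))" unfolding T_def by (rule card_UN_le) (simp add: J_def)
    also have "\<dots> \<le> (\<Sum>j\<in>J. 1)" using R by (intro sum_mono) (simp add: J_def good_def)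
    also have "\<dots> = t - 1" using col[OF eX] by (simp add: J_def)
    also have "\<dots> \<le> b" using t by simp
    finally have cT: "card T \<le> b" .
    have "all_bridges (insert e M \<union> {f \<in> F - {e} - T. col f = j})" if j: "j < t" for j
    proof (cases "j = col e")
      case True
      show ?thesis by (rule all_bridges_subset[OF ab[OF j]]) (use e True in auto)
    next
      case False
      then have "R j \<subseteq> T" using j unfolding T_def J_def by auto
      have "all_bridges (insert e (M \<union> ({f \<in> F. col f = j} - R j)))" using R[OF j] by (simp add: good_def)
      then show ?thesis by (rule all_bridges_subset) (use \<open>R j \<subseteq> T\<close> in auto)
    qed
    then have "I (insert e M) (F - {e} - T)" using MF eX unfolding I_def by auto
    then show "\<exists>T. T \<subseteq> F - {e} \<and> card T \<le> b \<and> I (insert e M) (F - {e} - T)"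
      using TF cT by (intro exI[of _ T]) simp
  qed
qed

text \<open>A vertex other than the two centres has at most one neighbour, so an edge that is not a
  bridge can only join the centres. A detour between them gets stuck at the first leaf.\<close>

lemma all_bridges_double_star:
  assumes loop: "\<And>v. {v} \<notin> A" and uniq: "\<And>v w w'. v \<notin> {p, q} \<Longrightarrow> {v, w} \<in> A \<Longrightarrow> {v, w'} \<in> A \<Longrightarrow> w = w'"
  shows "all_bridges A"
  unfolding all_bridges_def
proof (intro allI impI notI)
  fix x y assume xy: "{x, y} \<in> A" and c: "conn (A - {{x, y}}) x y"
  have ne: "x \<noteq> y" using loop[of x] xy by auto
  have leaf: "v \<in> {p, q}" if v: "{v, w} = {x, y}" "conn (A - {{x, y}}) v w" "v \<noteq> w" for v w
  proof (rule ccontr)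
    assume "v \<notin> {p, q}"
    obtain z where z: "{v, z} \<in> A - {{x, y}}"
      using v(2,3) unfolding conn_def by (cases rule: converse_rtranclpE) auto
    then have "z = w" using uniq[OF \<open>v \<notin> {p, q}\<close>, of z w] v(1) xy by auto
    then show False using z v(1) by simp
  qed
  have xpq: "x \<in> {p, q}" "y \<in> {p, q}"
    using leaf[of x y] leaf[of y x] c ne conn_sym[OF c] by (auto simp: insert_commute)
  have "v = x \<or> (v \<notin> {x, y} \<and> {v, x} \<in> A)" if "conn (A - {{x, y}}) x v" for v
    using that unfolding conn_def
  proof (induction rule: rtranclp_induct)
    case (step v w)
    have vw: "{v, w} \<in> A" "{v, w} \<noteq> {x, y}" using step.hyps(2) by auto
    have "w \<noteq> v" using loop[of v] vw(1) by auto
    show ?case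
    proof (cases "v = x")
      case True
      then show ?thesis using vw \<open>w \<noteq> v\<close> by (auto simp: insert_commute)
    next
      case False
      then have v: "v \<notin> {x, y}" "{v, x} \<in> A" using step.IH by auto
      then have "v \<notin> {p, q}" using xpq ne by auto
      then show ?thesis using uniq[OF _ vw(1) v(2)] by simp
    qed
  qed simp
  from this[OF c] ne show False by auto
qed

text \<open>
  Colour class \<open>c\<close> is a spanning double star with the centres \<open>2 c\<close> and \<open>2 c + 1\<close>.
\<close>

definition star_colour :: "nat set \<Rightarrow> nat" where
  "star_colour e = (if even (Min e) = even (Max e) then Min e div 2 else Max e div 2)"

lemma star_colour_pair:
  "star_colour {v, w} = (if even v = even w then min v w div 2 else max v w div 2)"
  by (cases "v \<le> w") (auto simp: star_colour_def min_def max_def)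

text \<open>The vertices are grouped into the pairs \<open>2 c\<close>, \<open>2 c + 1\<close>. Of
  the four edges between two pairs, those joining equal parities belong to the lower pair and the
  others to the higher one. So a vertex outside pair \<open>c\<close> has just one possible
  neighbour in class \<open>c\<close>.\<close>

lemma star_colour_neighbour:
  assumes "star_colour {v, w} = c" "v div 2 \<noteq> c"
  shows "w = (if c < v div 2 then 2 * c + v mod 2 else 2 * c + (1 - v mod 2))"
proof (cases "even v = even w")
  case True
  then have "min v w div 2 = c" using assms(1) by (simp add: star_colour_pair)
  then have "w \<le> v" "w div 2 = c" using assms(2) by (auto simp: min_def split: if_splits)
  moreover have "c < v div 2" using calculation assms(2) div_le_mono[of w v 2] by linarith
  moreover have "w mod 2 = v mod 2" using True by presburger
  ultimately show ?thesis using div_mult_mod_eq[of w 2] by simp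
next
  case False
  then have "max v w div 2 = c" using assms(1) by (simp add: star_colour_pair)
  then have "v \<le> w" "w div 2 = c" using assms(2) by (auto simp: max_def split: if_splits)
  moreover have "\<not> c < v div 2" using calculation div_le_mono[of v w 2] by linarith
  moreover have "w mod 2 = 1 - v mod 2" using False by presburger
  ultimately show ?thesis using div_mult_mod_eq[of w 2] by simp
qed

text \<open>There are \<open>(n + 1) div 2\<close> pairs, the last one possibly incomplete, hence as
  many double stars.\<close>

lemma maker_loses_acyclic:
  assumes "n \<le> 2 * b" "n > 0" and P: "\<And>M. P M \<Longrightarrow> \<not> all_bridges M"
  shows "\<not> maker_wins b P {} (complete_edges n)"
proof (rule maker_loses_forests[where col = star_colour and t = "(n + 1) div 2" and W = "{..<n}"])
  show "finite (complete_edges n)" by (simp add: finite_imp_finite_nsets)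
  show "0 < (n + 1) div 2" "(n + 1) div 2 \<le> b + 1" using assms(1,2) by auto
  show "star_colour e < (n + 1) div 2" if e: "e \<in> complete_edges n" for e
  proof -
    obtain x y where xy: "e = {x, y}" "x < n" "y < n" using e by (auto elim: nsets_2D)
    then have "min x y < n" "max x y < n" by auto
    then show ?thesis unfolding xy(1) star_colour_pair by (auto simp del: min_less_iff_conj max_less_iff_conj)
  qed
  show "all_bridges {e \<in> complete_edges n. star_colour e = j}" for j
  proof (rule all_bridges_double_star[of _ "2 * j" "2 * j + 1"])
    show "{v} \<notin> {e \<in> complete_edges n. star_colour e = j}" for v by (simp add: nsets_def)
    fix v w w' assume v: "v \<notin> {2 * j, 2 * j + 1}"
      and w: "{v, w} \<in> {e \<in> complete_edges n. star_colour e = j}"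
      and w': "{v, w'} \<in> {e \<in> complete_edges n. star_colour e = j}"
    have "v div 2 \<noteq> j" using v by auto
    then show "w = w'" using star_colour_neighbour[of v w j] star_colour_neighbour[of v w' j] w w' by simp
  qed
qed (use P in auto)

section \<open>CleverMaker builds a tree minor\<close>

lemma connected_in_insert:
  assumes "connected_in M S" "x \<in> S" "{x, z} \<in> M"
  shows "connected_in M (insert z S)"
proof -
  let ?r = "reachable_in M (insert z S)"
  have xz: "?r x z" "?r z x" using assms(2,3) unfolding reachable_in_def
    by (auto intro!: r_into_rtranclp simp: insert_commute)
  have tr: "?r u w" if "?r u v" "?r v w" for u v w using that unfolding reachable_in_def by (rule rtranclp_trans)
  have "reachable_in M S \<le> ?r" unfolding reachable_in_def by (intro rtranclp_mono) auto
  then have old: "?r u v" if "u \<in> S" "v \<in> S" for u v using assms(1) that unfolding connected_in_def by blast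
  have "?r u v" if "u \<in> insert z S" "v \<in> insert z S" for u v
  proof -
    have "?r u x" using that(1) xz(2) old[OF _ assms(2)] by auto
    moreover have "?r x v" using that(2) xz(1) old[OF assms(2)] by auto
    ultimately show ?thesis by (rule tr)
  qed
  then show ?thesis by (simp add: connected_in_def)
qed

text \<open>
  The free edges between the branch set \<open>A\<close> and the vertices outside the set \<open>U\<close> of all vertices used so far.
\<close>

definition boundary :: "'a set set \<Rightarrow> 'a set \<Rightarrow> 'a set \<Rightarrow> 'a set set" where
  "boundary F U A = {f \<in> F. f \<inter> A \<noteq> {} \<and> \<not> f \<subseteq> U}"

lemma sum_degrees:
  assumes "finite Z" "finite G" "\<And>f. f \<in> G \<Longrightarrow> card f = 2" "\<And>f. f \<in> G \<Longrightarrow> f \<subseteq> Z"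
  shows "(\<Sum>z\<in>Z. card {f \<in> G. z \<in> f}) = 2 * card G"
proof -
  have "(\<Sum>z\<in>Z. card {f \<in> G. z \<in> f}) = (\<Sum>z\<in>Z. \<Sum>f\<in>G. of_bool (z \<in> f))"
    using assms(2) by (intro sum.cong refl) (simp add: of_bool_def sum.If_cases Int_def)
  also have "\<dots> = (\<Sum>f\<in>G. \<Sum>z\<in>Z. of_bool (z \<in> f))" by (rule sum.swap)
  also have "\<dots> = (\<Sum>f\<in>G. 2)"
  proof (rule sum.cong[OF refl])
    fix f assume f: "f \<in> G"
    have "(\<Sum>z\<in>Z. of_bool (z \<in> f)) = card (Z \<inter> f)"
      using assms(1) by (simp add: of_bool_def sum.If_cases Int_def)
    also have "Z \<inter> f = f" using assms(4)[OF f] by auto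
    finally show "(\<Sum>z\<in>Z. of_bool (z \<in> f)) = (2 :: nat)" using assms(3)[OF f] by simp
  qed
  finally show ?thesis by simp
qed

text \<open>Double counting: vertices with at least \<open>h\<close> claimed edges number at most
  \<open>2 * m / h\<close>, and each of them takes at most \<open>c\<close> boundary edges. So some
  boundary edge leads to a vertex whose edges are mostly free, the kind that makes the boundary
  grow.\<close>

lemma good_extension:
  assumes F: "F \<subseteq> complete_edges n" and A: "A \<subseteq> U" "card A \<le> c" "finite A"
    and claimed: "card (complete_edges n - F) \<le> m" and big: "2 * c * m < card (boundary F U A) * h"
  shows "\<exists>x z. x \<in> A \<and> z \<notin> U \<and> z < n \<and> {x, z} \<in> F \<and> card {f \<in> complete_edges n - F. z \<in> f} < h"
proof (rule ccontr)
  assume neg: "\<not> ?thesis"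
  let ?G = "complete_edges n - F"
  define B where "B = {z \<in> {..<n}. h \<le> card {f \<in> ?G. z \<in> f}}"
  have bad: "z \<in> B" if "x \<in> A" "z \<notin> U" "{x, z} \<in> F" for x z
  proof (rule ccontr)
    have "z < n" using subsetD[OF F that(3)] by simp
    moreover assume "z \<notin> B"
    ultimately have "card {f \<in> ?G. z \<in> f} < h" by (simp add: B_def)
    with that \<open>z < n\<close> have "x \<in> A \<and> z \<notin> U \<and> z < n \<and> {x, z} \<in> F \<and> card {f \<in> ?G. z \<in> f} < h" by simp
    then have "\<exists>x z. x \<in> A \<and> z \<notin> U \<and> z < n \<and> {x, z} \<in> F \<and> card {f \<in> ?G. z \<in> f} < h" by (intro exI)
    with neg show False ..
  qed
  have "boundary F U A \<subseteq> (\<lambda>(x, z). {x, z}) ` (A \<times> B)"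
  proof
    fix f assume f: "f \<in> boundary F U A"
    then have "f \<in> F" by (simp add: boundary_def)
    obtain u v where "f = {u, v}" using subsetD[OF F \<open>f \<in> F\<close>] by (rule nsets_2D)
    moreover have "f \<inter> A \<noteq> {}" "\<not> f \<subseteq> U" using f by (simp_all add: boundary_def)
    ultimately obtain x z where xz: "f = {x, z}" "x \<in> A" "z \<notin> U"
      using A(1) by (auto simp: insert_commute)
    then have "z \<in> B" using bad \<open>f \<in> F\<close> by simp
    then show "f \<in> (\<lambda>(x, z). {x, z}) ` (A \<times> B)" using xz by auto
  qed
  moreover have finB: "finite B" by (simp add: B_def)
  ultimately have "card (boundary F U A) \<le> card ((\<lambda>(x, z). {x, z}) ` (A \<times> B))"
    using A(3) by (intro card_mono) auto
  also have "\<dots> \<le> card (A \<times> B)" using finB A(3) by (intro card_image_le) auto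
  also have "\<dots> \<le> c * card B" using A(2) by (simp add: card_cartesian_product)
  finally have "card (boundary F U A) * h \<le> c * (card B * h)" by (simp add: mult.assoc[symmetric])
  also have "card B * h = (\<Sum>z\<in>B. h)" by simp
  also have "\<dots> \<le> (\<Sum>z\<in>B. card {f \<in> ?G. z \<in> f})" by (intro sum_mono) (simp add: B_def)
  also have "\<dots> \<le> (\<Sum>z<n. card {f \<in> ?G. z \<in> f})" by (intro sum_mono2) (auto simp: B_def)
  also have "\<dots> = 2 * card ?G" 
    by (rule sum_degrees) (auto simp: nsets_def finite_imp_finite_nsets)
  also have "\<dots> \<le> 2 * m" using claimed by simp
  finally show False using big by simp
qed

text \<open>After \<open>r\<close> rounds \<open>i\<close> branch sets exist, with \<open>p\<close>
  giving their parents. Every round adds one vertex, whence the \<open>r + 1\<close>. The number of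
  rounds will be bounded by a constant, so few vertices are used and only linearly many edges are
  claimed.\<close>

definition tree_state :: "nat \<Rightarrow> nat \<Rightarrow> (nat \<Rightarrow> nat) \<Rightarrow> nat \<Rightarrow> (nat \<Rightarrow> nat set) \<Rightarrow> nat set set \<Rightarrow> nat set set \<Rightarrow> nat \<Rightarrow> bool" where
  "tree_state n b p i S M F r \<longleftrightarrow> F \<subseteq> complete_edges n \<and> card (complete_edges n - F) \<le> r * (b + 1) \<and>
     (\<forall>j<i. S j \<noteq> {} \<and> S j \<subseteq> {..<n} \<and> connected_in M (S j)) \<and>
     (\<forall>j<i. \<forall>j'<i. j \<noteq> j' \<longrightarrow> S j \<inter> S j' = {}) \<and>
     (\<forall>j. 0 < j \<longrightarrow> j < i \<longrightarrow> (\<exists>x\<in>S j. \<exists>y\<in>S (p j). {x, y} \<in> M)) \<and>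
     card (\<Union>j<i. S j) \<le> r + 1"

text \<open>A branch set not enlarged in this round loses only its edges to \<open>z\<close>, at
  most one for each used vertex, and what Breaker claims.\<close>

lemma boundary_after_move:
  assumes F: "F \<subseteq> complete_edges n" and T: "T \<subseteq> F - {{x, z}}" "card T \<le> b"
    and U: "A \<subseteq> U" "U \<subseteq> {..<n}" "card U \<le> c" "x \<in> U" "z \<notin> U"
  shows "card (boundary F U A) \<le> card (boundary (F - {{x, z}} - T) (insert z U) A) + c + b"
proof -
  have finF: "finite F" using F finite_imp_finite_nsets[of "{..<n}" 2] by (auto intro: finite_subset)
  have finU: "finite U" using U(2) by (rule finite_subset) simp
  let ?B = "boundary (F - {{x, z}} - T) (insert z U) A"
  have fin: "finite ?B" "finite T" using finF T(1) by (auto simp: boundary_def intro: finite_subset)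
  have "boundary F U A \<subseteq> ?B \<union> (\<lambda>u. {u, z}) ` U \<union> T"
  proof
    fix f assume f: "f \<in> boundary F U A"
    then have "f \<in> F" by (simp add: boundary_def)
    obtain u v where uv: "f = {u, v}" using subsetD[OF F \<open>f \<in> F\<close>] by (rule nsets_2D)
    have fA: "f \<inter> A \<noteq> {}" "\<not> f \<subseteq> U" using f by (simp_all add: boundary_def)
    show "f \<in> ?B \<union> (\<lambda>u. {u, z}) ` U \<union> T"
    proof (cases "f \<subseteq> insert z U \<or> f = {x, z}")
      case True
      then have "f \<subseteq> insert z U" using U(4) by auto
      then have "\<exists>u\<in>U. f = {u, z}" using uv fA U(1) by auto
      then show ?thesis by auto
    next
      case False
      then show ?thesis using fA \<open>f \<in> F\<close> by (auto simp: boundary_def)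
    qed
  qed
  then have "card (boundary F U A) \<le> card (?B \<union> (\<lambda>u. {u, z}) ` U \<union> T)"
    using fin finU by (intro card_mono) auto
  also have "\<dots> \<le> card (?B \<union> (\<lambda>u. {u, z}) ` U) + card T" by (rule card_Un_le)
  also have "card (?B \<union> (\<lambda>u. {u, z}) ` U) \<le> card ?B + card ((\<lambda>u. {u, z}) ` U)" by (rule card_Un_le)
  also have "card ((\<lambda>u. {u, z}) ` U) \<le> c" using card_image_le[OF finU] U(3) le_trans by blast
  finally show ?thesis using T(2) by simp
qed

lemma boundary_new_vertex:
  assumes F: "F \<subseteq> complete_edges n" and T: "T \<subseteq> F - {{x, z}}" "card T \<le> b"
    and U: "A \<subseteq> U" "U \<subseteq> {..<n}" "card U \<le> c" "x \<in> U" "z \<notin> U" "z < n"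
    and good: "card {f \<in> complete_edges n - F. z \<in> f} < h"
  shows "card (boundary F U A) + n \<le> card (boundary (F - {{x, z}} - T) (insert z U) (insert z A)) + 2 * c + b + h + 1"
proof -
  have finF: "finite F" using F finite_imp_finite_nsets[of "{..<n}" 2] by (auto intro: finite_subset)
  have finX: "finite (complete_edges n)" by (simp add: finite_imp_finite_nsets)
  have finU: "finite U" using U(2) by (rule finite_subset) simp
  let ?B = "boundary (F - {{x, z}} - T) (insert z U) (insert z A)"
  let ?G = "{f \<in> complete_edges n - F. z \<in> f}"
  let ?N = "(\<lambda>u. {u, z}) ` U"
  let ?Y = "(\<lambda>y. {z, y}) ` ({..<n} - insert z U)"
  have fin: "finite ?B" "finite T" "finite ?G" using finF finX T(1) by (auto simp: boundary_def intro: finite_subset)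
  have sub: "boundary F U A \<union> ?Y \<subseteq> ?B \<union> ?N \<union> T \<union> ?G"
  proof (intro Un_least subsetI)
    fix f assume f: "f \<in> boundary F U A"
    then have "f \<in> F" by (simp add: boundary_def)
    obtain u v where uv: "f = {u, v}" using subsetD[OF F \<open>f \<in> F\<close>] by (rule nsets_2D)
    have fA: "f \<inter> A \<noteq> {}" "\<not> f \<subseteq> U" using f by (simp_all add: boundary_def)
    show "f \<in> ?B \<union> ?N \<union> T \<union> ?G"
    proof (cases "f \<subseteq> insert z U \<or> f = {x, z}")
      case True
      then have "f \<subseteq> insert z U" using U(4) by auto
      then have "\<exists>u\<in>U. f = {u, z}" using uv fA U(1) by auto
      then show ?thesis by auto
    next
      case False
      then show ?thesis using fA \<open>f \<in> F\<close> by (auto simp: boundary_def)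
    qed
  next
    fix f assume "f \<in> ?Y"
    then obtain y where y: "f = {z, y}" "y < n" "y \<noteq> z" "y \<notin> U" by auto
    have "f \<in> complete_edges n" using y U(6) by simp
    moreover have "f \<noteq> {x, z}" using y U(4) by (auto simp: doubleton_eq_iff)
    ultimately show "f \<in> ?B \<union> ?N \<union> T \<union> ?G" using y by (auto simp: boundary_def)
  qed
  have disj: "boundary F U A \<inter> ?Y = {}" using U(1,5) by (auto simp: boundary_def)
  have "card ?Y = card ({..<n} - insert z U)"
    by (rule card_image) (auto simp: inj_on_def doubleton_eq_iff)
  also have "\<dots> = n - card (insert z U)" using U(2,6) finU by (subst card_Diff_subset) auto
  finally have cY: "n \<le> card ?Y + c + 1" using U(3,5) finU by simp
  have "card (boundary F U A) + card ?Y = card (boundary F U A \<union> ?Y)"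
    using disj finF by (intro card_Un_disjoint[symmetric]) (auto simp: boundary_def)
  also have "\<dots> \<le> card (?B \<union> ?N \<union> T \<union> ?G)" using fin finU sub by (intro card_mono) auto
  also have "\<dots> \<le> card (?B \<union> ?N \<union> T) + card ?G" by (rule card_Un_le)
  also have "card (?B \<union> ?N \<union> T) \<le> card (?B \<union> ?N) + card T" by (rule card_Un_le)
  also have "card (?B \<union> ?N) \<le> card ?B + card ?N" by (rule card_Un_le)
  also have "card ?N \<le> c" using card_image_le[OF finU, of "\<lambda>u. {u, z}"] U(3) by linarith
  finally show ?thesis using cY T(2) good by linarith
qed

text \<open>The new vertex \<open>z\<close> can either enlarge the branch set \<open>a\<close> or
  found branch set \<open>i\<close> as a child of \<open>a\<close>. The move is the same, so both
  uses are stated at once and the caller chooses.\<close>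

lemma tree_step:
  assumes st: "tree_state n b p i S M F r" and r: "r < R" and a: "a < i"
    and pj: "\<And>j. 0 < j \<Longrightarrow> j < i \<Longrightarrow> p j < i"
    and par: "b + g + h + 2 * R + 4 \<le> n" "2 * (R + 1) * (R * (b + 1)) < g * h"
    and w: "g \<le> card (boundary F (\<Union>j<i. S j) (S a))"
  shows "\<exists>e\<in>F. \<forall>T. T \<subseteq> F - {e} \<longrightarrow> card T \<le> b \<longrightarrow> (\<exists>z. z \<notin> (\<Union>j<i. S j) \<and>
       tree_state n b p i (S(a := insert z (S a))) (insert e M) (F - {e} - T) (Suc r) \<and>
       (a = p i \<longrightarrow> tree_state n b p (Suc i) (S(i := {z})) (insert e M) (F - {e} - T) (Suc r)) \<and>
       card (boundary F (\<Union>j<i. S j) (S a)) + g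
         \<le> card (boundary (F - {e} - T) (insert z (\<Union>j<i. S j)) (insert z (S a))) \<and>
       g \<le> card (boundary (F - {e} - T) (insert z (\<Union>j<i. S j)) {z}) \<and>
       (\<forall>A. A \<subseteq> (\<Union>j<i. S j) \<longrightarrow> card (boundary F (\<Union>j<i. S j) A)
         \<le> card (boundary (F - {e} - T) (insert z (\<Union>j<i. S j)) A) + n))"
proof -
  let ?U = "\<Union>j<i. S j"
  have F: "F \<subseteq> complete_edges n" and cl: "card (complete_edges n - F) \<le> r * (b + 1)"
    and S: "\<And>j. j < i \<Longrightarrow> S j \<noteq> {} \<and> S j \<subseteq> {..<n} \<and> connected_in M (S j)"
    and disj: "\<And>j j'. j < i \<Longrightarrow> j' < i \<Longrightarrow> j \<noteq> j' \<Longrightarrow> S j \<inter> S j' = {}"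
    and par_edge: "\<And>j. 0 < j \<Longrightarrow> j < i \<Longrightarrow> \<exists>x\<in>S j. \<exists>y\<in>S (p j). {x, y} \<in> M"
    and cU: "card ?U \<le> r + 1"
    using st by (simp_all add: tree_state_def)
  have U: "?U \<subseteq> {..<n}" using S by auto
  then have finU: "finite ?U" by (rule finite_subset) simp
  have aU: "S a \<subseteq> ?U" using a by auto
  then have finA: "finite (S a)" using finU by (rule finite_subset)
  have cA: "card (S a) \<le> r + 1" using card_mono[OF finU aU] cU by linarith
  have "2 * (r + 1) * (r * (b + 1)) \<le> 2 * (R + 1) * (R * (b + 1))"
    using r by (intro mult_mono) auto
  also have "\<dots> < g * h" by (rule par(2))
  also have "\<dots> \<le> card (boundary F ?U (S a)) * h" using w by (rule mult_right_mono) simp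
  finally have big: "2 * (r + 1) * (r * (b + 1)) < card (boundary F ?U (S a)) * h" .
  obtain x z where xz: "x \<in> S a" "z \<notin> ?U" "z < n" "{x, z} \<in> F" "card {f \<in> complete_edges n - F. z \<in> f} < h"
    using good_extension[OF F aU cA finA cl big] by (elim exE conjE)
  have xU: "x \<in> ?U" using xz(1) aU by auto
  show ?thesis
  proof (rule bexI[OF _ xz(4)], intro allI impI)
    fix T assume T: "T \<subseteq> F - {{x, z}}" "card T \<le> b"
    let ?F = "F - {{x, z}} - T" and ?M = "insert {x, z} M"
    have finF: "finite F" using F finite_imp_finite_nsets[of "{..<n}" 2] by (auto intro: finite_subset)
    have finT: "finite T" using T(1) finF by (auto intro: finite_subset)
    have "complete_edges n - ?F = (complete_edges n - F) \<union> insert {x, z} T" using T(1) F xz(4) by auto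
    then have "card (complete_edges n - ?F) \<le> card (complete_edges n - F) + card (insert {x, z} T)"
      using card_Un_le[of "complete_edges n - F" "insert {x, z} T"] by simp
    also have "card (insert {x, z} T) \<le> b + 1" using T(2) finT by (simp add: card_insert_if)
    finally have cl': "card (complete_edges n - ?F) \<le> Suc r * (b + 1)" using cl by simp
    have F': "?F \<subseteq> complete_edges n" using F by auto
    have cU': "card (insert z ?U) \<le> Suc r + 1" using cU finU xz(2) by simp
    have conn: "connected_in ?M (S j)" if "j < i" for j
      using S[OF that] connected_in_mono[of M ?M] by auto
    have zS: "z \<notin> S j" if "j < i" for j using xz(2) that by auto
    have grow: "tree_state n b p i (S(a := insert z (S a))) ?M ?F (Suc r)"
      unfolding tree_state_def
    proof (intro conjI allI impI)
      fix j assume j: "j < i"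
      show "(S(a := insert z (S a))) j \<noteq> {}" "(S(a := insert z (S a))) j \<subseteq> {..<n}" using S[OF j] S[OF a] xz(3) by auto
      show "connected_in ?M ((S(a := insert z (S a))) j)"
        using conn[OF j] connected_in_insert[OF conn[OF a] xz(1), of z] by simp
    next
      fix j j' assume j: "j < i" "j' < i" "j \<noteq> j'"
      show "(S(a := insert z (S a))) j \<inter> (S(a := insert z (S a))) j' = {}"
        using disj[OF j] zS[OF j(1)] zS[OF j(2)] j(3) by (cases "j = a"; cases "j' = a") auto
    next
      fix j assume j: "0 < j" "j < i"
      obtain u v where uv: "u \<in> S j" "v \<in> S (p j)" "{u, v} \<in> M" using par_edge[OF j] by (elim bexE)
      have "u \<in> (S(a := insert z (S a))) j" "v \<in> (S(a := insert z (S a))) (p j)" using uv by auto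
      then show "\<exists>x\<in>(S(a := insert z (S a))) j. \<exists>y\<in>(S(a := insert z (S a))) (p j). {x, y} \<in> ?M"
        using uv(3) by (meson insertI2)
    next
      have "(\<Union>j<i. (S(a := insert z (S a))) j) \<subseteq> insert z ?U" by (auto split: if_splits)
      then have "card (\<Union>j<i. (S(a := insert z (S a))) j) \<le> card (insert z ?U)" using finU by (intro card_mono) auto
      then show "card (\<Union>j<i. (S(a := insert z (S a))) j) \<le> Suc r + 1" using cU' by linarith
    qed (use F' cl' in auto)
    have new: "tree_state n b p (Suc i) (S(i := {z})) ?M ?F (Suc r)" if pa: "a = p i"
      unfolding tree_state_def
    proof (intro conjI allI impI)
      fix j assume j: "j < Suc i"
      show "(S(i := {z})) j \<noteq> {}" "(S(i := {z})) j \<subseteq> {..<n}" using S[of j] j xz(3) by auto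
      show "connected_in ?M ((S(i := {z})) j)"
      proof (cases "j = i")
        case True
        then show ?thesis by (simp add: connected_in_def reachable_in_def)
      next
        case False
        then show ?thesis using conn[of j] j by simp
      qed
    next
      fix j j' assume j: "j < Suc i" "j' < Suc i" "j \<noteq> j'"
      show "(S(i := {z})) j \<inter> (S(i := {z})) j' = {}"
        using disj[of j j'] zS[of j] zS[of j'] j by (cases "j = i"; cases "j' = i") auto
    next
      fix j assume j: "0 < j" "j < Suc i"
      show "\<exists>x\<in>(S(i := {z})) j. \<exists>y\<in>(S(i := {z})) (p j). {x, y} \<in> ?M"
      proof (cases "j = i")
        case True
        have "x \<in> (S(i := {z})) (p j)" using xz(1) pa a True by simp
        moreover have "z \<in> (S(i := {z})) j" using True by simp
        moreover have "{z, x} \<in> ?M" by (simp add: insert_commute)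
        ultimately show ?thesis by (intro bexI)
      next
        case False
        then have ji: "j < i" using j by simp
        obtain u v where uv: "u \<in> S j" "v \<in> S (p j)" "{u, v} \<in> M" using par_edge[OF j(1) ji] by (elim bexE)
        have "p j \<noteq> i" using pj[OF j(1) ji] by simp
        then have "u \<in> (S(i := {z})) j" "v \<in> (S(i := {z})) (p j)" using uv False by auto
        then show ?thesis using uv(3) by (meson insertI2)
      qed
    next
      have "(\<Union>j<Suc i. (S(i := {z})) j) \<subseteq> insert z ?U" by (auto simp: less_Suc_eq split: if_splits)
      then have "card (\<Union>j<Suc i. (S(i := {z})) j) \<le> card (insert z ?U)" using finU by (intro card_mono) auto
      then show "card (\<Union>j<Suc i. (S(i := {z})) j) \<le> Suc r + 1" using cU' by linarith
    qed (use F' cl' in auto)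
    have rR: "2 * (r + 1) \<le> 2 * R" "r + 1 \<le> R" using r by simp_all
    have b1: "card (boundary F ?U (S a)) + g \<le> card (boundary ?F (insert z ?U) (insert z (S a)))"
      using boundary_new_vertex[OF F T aU U cU xU xz(2,3,5)] par(1) rR by linarith
    \<comment> \<open>The case \<open>A = {}\<close>: the boundary of \<open>z\<close> as a branch
      set of its own.\<close>
    have b2: "g \<le> card (boundary ?F (insert z ?U) {z})"
      using boundary_new_vertex[OF F T empty_subsetI U cU xU xz(2,3,5)] par(1) rR by linarith
    have b3: "\<forall>A. A \<subseteq> ?U \<longrightarrow> card (boundary F ?U A) \<le> card (boundary ?F (insert z ?U) A) + n"
    proof (intro allI impI)
      fix A assume "A \<subseteq> ?U"
      then show "card (boundary F ?U A) \<le> card (boundary ?F (insert z ?U) A) + n"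
        using boundary_after_move[OF F T _ U cU xU xz(2), of A] par(1) rR by linarith
    qed
    show "\<exists>z'. z' \<notin> ?U \<and> tree_state n b p i (S(a := insert z' (S a))) ?M ?F (Suc r) \<and>
       (a = p i \<longrightarrow> tree_state n b p (Suc i) (S(i := {z'})) ?M ?F (Suc r)) \<and>
       card (boundary F ?U (S a)) + g \<le> card (boundary ?F (insert z' ?U) (insert z' (S a))) \<and>
       g \<le> card (boundary ?F (insert z' ?U) {z'}) \<and>
       (\<forall>A. A \<subseteq> ?U \<longrightarrow> card (boundary F ?U A) \<le> card (boundary ?F (insert z' ?U) A) + n)"
      using xz(2) grow new b1 b2 b3 by (intro exI[of _ z] conjI impI)
  qed
qed

text \<open>
  \<open>blob_rounds K q\<close> rounds suffice to grow the last \<open>q\<close> branch sets: a branch set that still has to serve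
  \<open>R\<close> later rounds is first grown for \<open>K * (R + 1)\<close> rounds, each of which raises its boundary by at least \<open>n / K\<close>,
  while a round elsewhere lowers it by at most \<open>n\<close>.
\<close>

fun blob_rounds :: "nat \<Rightarrow> nat \<Rightarrow> nat" where
  "blob_rounds K 0 = 0"
| "blob_rounds K (Suc q) = blob_rounds K q + K * (blob_rounds K q + 1)"

text \<open>An older branch set must keep \<open>n\<close> boundary edges for every round still to
  come, as each may cost it up to \<open>n\<close>, and \<open>n\<close> more so that it still has
  at least \<open>g\<close> when it gets a child. The hypothesis \<open>n \<le> K * g\<close>
  converts the gain of \<open>g\<close> per growth round into these multiples of
  \<open>n\<close>.\<close>

lemma maker_wins_tree:
  assumes par: "b + g + h + 2 * R + 4 \<le> n" "2 * (R + 1) * (R * (b + 1)) < g * h" "n \<le> K * g"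
    and p: "\<And>j. 0 < j \<Longrightarrow> j < k \<Longrightarrow> p j < j" and k: "0 < k" and R: "R = blob_rounds K k"
    and win: "\<And>S M F r. tree_state n b p k S M F r \<Longrightarrow> P M"
  shows "maker_wins b P {} (complete_edges n)"
proof -
  let ?w = "\<lambda>i S F A. card (boundary F (\<Union>j<i. S j) (A :: nat set))"
  have Kg: "0 < K" "0 < g" using par(1,3) by (auto intro: Nat.gr0I)
  \<comment> \<open>Branch set \<open>i\<close> is grown to level \<open>l\<close> out of
    \<open>L\<close>; level 1 is a single fresh vertex. The continuation is abstracted into
    \<open>finish\<close>, so that the first branch set can be grown in the same way as the later
    ones.\<close>
  have grow: "maker_wins b P M F" if "tree_state n b p (Suc i) S M F r" and ik: "i + Suc q = k" and "1 \<le> l" "l \<le> L"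
      "l * g \<le> ?w (Suc i) S F (S i)"
      "\<And>j. j < i \<Longrightarrow> (blob_rounds K q + (L - l) + 1) * n \<le> ?w (Suc i) S F (S j)"
      "r + blob_rounds K q + (L - l) \<le> R" "L = K * (blob_rounds K q + 1)"
      and finish: "\<And>S M F r. tree_state n b p (Suc i) S M F r \<Longrightarrow>
         (\<And>j. j < Suc i \<Longrightarrow> (blob_rounds K q + 1) * n \<le> ?w (Suc i) S F (S j)) \<Longrightarrow>
         r + blob_rounds K q \<le> R \<Longrightarrow> maker_wins b P M F"
    for i q l L S M F r
    using that(1,3-7)
  proof (induction "L - l" arbitrary: l S M F r)
    case 0
    then have l: "l = L" by simp
    show ?case
    proof (rule finish[OF 0(2)])
      fix j assume j: "j < Suc i"
      show "(blob_rounds K q + 1) * n \<le> ?w (Suc i) S F (S j)"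
      proof (cases "j = i")
        case True
        \<comment> \<open>The choice of \<open>L\<close>: a boundary of \<open>L * g\<close> covers
          \<open>n\<close> for each of the remaining rounds and one \<open>n\<close> more.\<close>
        have "(blob_rounds K q + 1) * n \<le> (blob_rounds K q + 1) * (K * g)" using par(3) by (rule mult_left_mono) simp
        also have "\<dots> = L * g" unfolding that(8) by (simp only: mult.assoc mult.left_commute mult.commute)
        also have "\<dots> \<le> ?w (Suc i) S F (S i)" using 0(5) l by simp
        finally show ?thesis using True by simp
      next
        case False
        then show ?thesis using 0(6)[of j] j l by simp
      qed
    qed (use 0(7) l in simp)
  next
    case (Suc d)
    have l: "l < L" "d = L - Suc l" "L - l = Suc (L - Suc l)" using Suc(2) by simp_all
    have wi: "g \<le> ?w (Suc i) S F (S i)" 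
    proof -
      have "1 * g \<le> l * g" using Suc(4) by (rule mult_right_mono) simp
      then show ?thesis using Suc(6) by linarith
    qed
    have rR: "r < R" using Suc(8) l by linarith
    have step: "\<exists>e\<in>F. \<forall>T. T \<subseteq> F - {e} \<longrightarrow> card T \<le> b \<longrightarrow> (\<exists>z. z \<notin> (\<Union>j<Suc i. S j) \<and>
       tree_state n b p (Suc i) (S(i := insert z (S i))) (insert e M) (F - {e} - T) (Suc r) \<and>
       (i = p (Suc i) \<longrightarrow> tree_state n b p (Suc (Suc i)) (S(Suc i := {z})) (insert e M) (F - {e} - T) (Suc r)) \<and>
       ?w (Suc i) S F (S i) + g
         \<le> card (boundary (F - {e} - T) (insert z (\<Union>j<Suc i. S j)) (insert z (S i))) \<and>
       g \<le> card (boundary (F - {e} - T) (insert z (\<Union>j<Suc i. S j)) {z}) \<and>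
       (\<forall>A. A \<subseteq> (\<Union>j<Suc i. S j) \<longrightarrow> ?w (Suc i) S F A
         \<le> card (boundary (F - {e} - T) (insert z (\<Union>j<Suc i. S j)) A) + n))"
      (is "Bex F ?Q")
    proof (rule tree_step[OF Suc(3) rR lessI _ par(1,2) wi])
      fix j assume "0 < j" "j < Suc i"
      then show "p j < Suc i" using p[of j] ik by simp
    qed
    from step obtain e where e: "e \<in> F" and next_state: "?Q e" by (rule bexE)
    show ?case
    proof (rule maker_wins.move[OF e])
      fix T assume T: "T \<subseteq> F - {e}" "card T = min b (card (F - {e}))"
      then have "card T \<le> b" by simp
      from next_state[rule_format, OF T(1) this] obtain z where
        st: "tree_state n b p (Suc i) (S(i := insert z (S i))) (insert e M) (F - {e} - T) (Suc r)"
        and up: "?w (Suc i) S F (S i) + g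
           \<le> card (boundary (F - {e} - T) (insert z (\<Union>j<Suc i. S j)) (insert z (S i)))"
        and others: "\<forall>A. A \<subseteq> (\<Union>j<Suc i. S j) \<longrightarrow> ?w (Suc i) S F A
           \<le> card (boundary (F - {e} - T) (insert z (\<Union>j<Suc i. S j)) A) + n"
        by (elim exE conjE)
      have U: "(\<Union>j<Suc i. (S(i := insert z (S i))) j) = insert z (\<Union>j<Suc i. S j)"
        by (auto simp: less_Suc_eq split: if_splits)
      show "maker_wins b P (insert e M) (F - {e} - T)"
      proof (rule Suc(1)[OF l(2) st])
        show "1 \<le> Suc l" "Suc l \<le> L" using l by simp_all
        show "Suc l * g \<le> ?w (Suc i) (S(i := insert z (S i))) (F - {e} - T) ((S(i := insert z (S i))) i)"
          unfolding U using up Suc(6) by simp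
        show "Suc r + blob_rounds K q + (L - Suc l) \<le> R" using Suc(8) l by simp
        fix j assume j: "j < i"
        have "S j \<subseteq> (\<Union>j<Suc i. S j)" using j by (intro UN_upper) simp
        then have "?w (Suc i) S F (S j) \<le> card (boundary (F - {e} - T) (insert z (\<Union>j<Suc i. S j)) (S j)) + n"
          using others by simp
        moreover have "(blob_rounds K q + (L - Suc l) + 1) * n + n \<le> ?w (Suc i) S F (S j)"
          using Suc(7)[OF j] unfolding l(3) by simp
        ultimately show "(blob_rounds K q + (L - Suc l) + 1) * n
            \<le> ?w (Suc i) (S(i := insert z (S i))) (F - {e} - T) ((S(i := insert z (S i))) j)"
          unfolding U using j by simp
      qed
    qed
  qed
  have rounds: "maker_wins b P M F" if "tree_state n b p i S M F r" "i + q = k" "0 < i"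
      "\<And>j. j < i \<Longrightarrow> (blob_rounds K q + 1) * n \<le> ?w i S F (S j)" "r + blob_rounds K q \<le> R"
    for i q S M F r
    using that
  proof (induction q arbitrary: i S M F r)
    case 0
    then have "P M" using win by simp
    then show ?case by (rule maker_wins.won)
  next
    case (Suc q)
    define L where "L = K * (blob_rounds K q + 1)"
    have L: "0 < L" "blob_rounds K (Suc q) = blob_rounds K q + L" using Kg by (simp_all add: L_def)
    have pi: "p i < i" using p[of i] Suc.prems(2,3) by simp
    have "1 * n \<le> (blob_rounds K (Suc q) + 1) * n" by (rule mult_right_mono) simp_all
    then have wi: "g \<le> ?w i S F (S (p i))" using Suc.prems(4)[OF pi] par(1) by linarith
    have rR: "r < R" using Suc.prems(5) L by linarith
    have step: "\<exists>e\<in>F. \<forall>T. T \<subseteq> F - {e} \<longrightarrow> card T \<le> b \<longrightarrow> (\<exists>z. z \<notin> (\<Union>j<i. S j) \<and>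
       tree_state n b p i (S(p i := insert z (S (p i)))) (insert e M) (F - {e} - T) (Suc r) \<and>
       (p i = p i \<longrightarrow> tree_state n b p (Suc i) (S(i := {z})) (insert e M) (F - {e} - T) (Suc r)) \<and>
       ?w i S F (S (p i)) + g
         \<le> card (boundary (F - {e} - T) (insert z (\<Union>j<i. S j)) (insert z (S (p i)))) \<and>
       g \<le> card (boundary (F - {e} - T) (insert z (\<Union>j<i. S j)) {z}) \<and>
       (\<forall>A. A \<subseteq> (\<Union>j<i. S j) \<longrightarrow> ?w i S F A
         \<le> card (boundary (F - {e} - T) (insert z (\<Union>j<i. S j)) A) + n))"
      (is "Bex F ?Q")
    proof (rule tree_step[OF Suc.prems(1) rR pi _ par(1,2) wi])
      fix j assume "0 < j" "j < i"
      then show "p j < i" using p[of j] Suc.prems(2) by simp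
    qed
    from step obtain e where e: "e \<in> F" and next_state: "?Q e" by (rule bexE)
    show ?case
    proof (rule maker_wins.move[OF e])
      fix T assume T: "T \<subseteq> F - {e}" "card T = min b (card (F - {e}))"
      then have "card T \<le> b" by simp
      from next_state[rule_format, OF T(1) this] obtain z where
        "p i = p i \<longrightarrow> tree_state n b p (Suc i) (S(i := {z})) (insert e M) (F - {e} - T) (Suc r)"
        and up: "g \<le> card (boundary (F - {e} - T) (insert z (\<Union>j<i. S j)) {z})"
        and others: "\<forall>A. A \<subseteq> (\<Union>j<i. S j) \<longrightarrow> ?w i S F A
           \<le> card (boundary (F - {e} - T) (insert z (\<Union>j<i. S j)) A) + n"
        by (elim exE conjE)
      then have st: "tree_state n b p (Suc i) (S(i := {z})) (insert e M) (F - {e} - T) (Suc r)" by simp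
      have U: "(\<Union>j<Suc i. (S(i := {z})) j) = insert z (\<Union>j<i. S j)"
        by (auto simp: less_Suc_eq split: if_splits)
      show "maker_wins b P (insert e M) (F - {e} - T)"
      proof (rule grow[OF st _ order_refl, of q L])
        show "i + Suc q = k" by (rule Suc.prems(2))
        show "1 \<le> L" using L(1) by simp
        show "L = K * (blob_rounds K q + 1)" by (rule L_def)
        show "1 * g \<le> ?w (Suc i) (S(i := {z})) (F - {e} - T) ((S(i := {z})) i)" unfolding U using up by simp
        show "Suc r + blob_rounds K q + (L - 1) \<le> R" using Suc.prems(5) L by simp
      next
        fix j assume j: "j < i"
        have "S j \<subseteq> (\<Union>j<i. S j)" using j by (intro UN_upper) simp
        then have "?w i S F (S j) \<le> card (boundary (F - {e} - T) (insert z (\<Union>j<i. S j)) (S j)) + n"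
          using others by simp
        moreover have "(blob_rounds K q + (L - 1) + 1) * n + n \<le> ?w i S F (S j)"
          using Suc.prems(4)[OF j] L by (cases L) simp_all
        ultimately show "(blob_rounds K q + (L - 1) + 1) * n
            \<le> ?w (Suc i) (S(i := {z})) (F - {e} - T) ((S(i := {z})) j)"
          unfolding U using j by simp
      next
        fix S M F r
        assume "tree_state n b p (Suc i) S M F r"
          "\<And>j. j < Suc i \<Longrightarrow> (blob_rounds K q + 1) * n \<le> ?w (Suc i) S F (S j)" "r + blob_rounds K q \<le> R"
        then show "maker_wins b P M F" using Suc.prems(2) by (intro Suc.IH[of "Suc i" S M F r]) simp_all
      qed
    qed
  qed
  define q where "q = k - 1"
  define L where "L = K * (blob_rounds K q + 1)"
  have q: "k = Suc q" using k by (simp add: q_def)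
  have RL: "R = blob_rounds K q + L" unfolding R q by (simp add: L_def)
  have L0: "1 \<le> L" using Kg by (simp add: L_def)
  have n0: "0 < n" using par(1) by simp
  \<comment> \<open>Branch set 0 starts as the vertex 0 before any round is played, with
    \<open>n - 1\<close> boundary edges.\<close>
  have st: "tree_state n b p (Suc 0) (\<lambda>_. {0}) {} (complete_edges n) 0"
    using n0 by (simp add: tree_state_def connected_in_def reachable_in_def)
  show ?thesis
  proof (rule grow[OF st _ order_refl L0 _ _ _ L_def])
    show "0 + Suc q = k" using q by simp
    have "(\<lambda>y. {0, y}) ` ({..<n} - {0}) \<subseteq> boundary (complete_edges n) {0} {0}"
      using n0 by (auto simp: boundary_def)
    moreover have "finite (boundary (complete_edges n) {0} {0})"
      by (simp add: boundary_def finite_imp_finite_nsets)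
    ultimately have "card ((\<lambda>y. {0, y}) ` ({..<n} - {0})) \<le> card (boundary (complete_edges n) {0} {0})"
      by (intro card_mono)
    moreover have "card ((\<lambda>y. {0::nat, y}) ` ({..<n} - {0})) = n - 1"
      using n0 by (subst card_image) (auto simp: inj_on_def doubleton_eq_iff)
    moreover have U0: "(\<Union>j<Suc 0. (\<lambda>_. {0::nat}) j) = {0}" by auto
    ultimately show "1 * g \<le> ?w (Suc 0) (\<lambda>_. {0}) (complete_edges n) {0}" unfolding U0 using par(1) by linarith
    show "0 + blob_rounds K q + (L - 1) \<le> R" using RL by simp
  next
    fix S M F r
    assume "tree_state n b p (Suc 0) S M F r"
      "\<And>j. j < Suc 0 \<Longrightarrow> (blob_rounds K q + 1) * n \<le> ?w (Suc 0) S F (S j)" "r + blob_rounds K q \<le> R"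
    then show "maker_wins b P M F" using q by (intro rounds[of "Suc 0" S M F r q]) simp_all
  qed simp_all
qed

text \<open>Branch set \<open>i\<close> belongs to the vertex \<open>f i\<close>. The state realises
  the whole parent tree, which contains every edge of \<open>E\<close>.\<close>

lemma tree_state_minor:
  assumes H: "simple_graph V E" and f: "bij_betw f {..<card V} V"
    and edges: "\<And>e. e \<in> E \<Longrightarrow> \<exists>i. 0 < i \<and> i < card V \<and> e = {f i, f (p i)}" and p: "\<And>i. 0 < i \<Longrightarrow> i < card V \<Longrightarrow> p i < i"
    and st: "tree_state n b p (card V) S M F r"
  shows "has_minor {..<n} M V E"
proof -
  have S: "\<And>j. j < card V \<Longrightarrow> S j \<noteq> {} \<and> S j \<subseteq> {..<n} \<and> connected_in M (S j)"
    and disj: "\<And>j j'. j < card V \<Longrightarrow> j' < card V \<Longrightarrow> j \<noteq> j' \<Longrightarrow> S j \<inter> S j' = {}"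
    and par_edge: "\<And>j. 0 < j \<Longrightarrow> j < card V \<Longrightarrow> \<exists>x\<in>S j. \<exists>y\<in>S (p j). {x, y} \<in> M"
    using st by (simp_all add: tree_state_def)
  define g where "g = the_inv_into {..<card V} f"
  have inj: "inj_on f {..<card V}" using f by (rule bij_betw_imp_inj_on)
  have gf: "g (f i) = i" if "i < card V" for i unfolding g_def using inj that by (intro the_inv_into_f_f) auto
  have g: "bij_betw g V {..<card V}" unfolding g_def by (rule bij_betw_the_inv_into[OF f])
  have gV: "g v < card V" if "v \<in> V" for v using bij_betw_apply[OF g that] by simp
  show ?thesis unfolding has_minor_def
  proof (intro exI[of _ "\<lambda>v. S (g v)"] conjI ballI allI impI)
    show "disjoint_family_on (\<lambda>v. S (g v)) V" unfolding disjoint_family_on_def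
    proof (intro ballI impI)
      fix u v assume "u \<in> V" "v \<in> V" "u \<noteq> v"
      moreover have "g u \<noteq> g v" using calculation inj_onD[OF bij_betw_imp_inj_on[OF g]] by auto
      ultimately show "S (g u) \<inter> S (g v) = {}" using gV by (intro disj) auto
    qed
  next
    fix v assume "v \<in> V"
    then show "S (g v) \<noteq> {}" "S (g v) \<subseteq> {..<n}" "connected_in M (S (g v))" using S[OF gV] by simp_all
  next
    fix v w assume "{v, w} \<in> E"
    from edges[OF this] obtain i where i: "0 < i" "i < card V" "{v, w} = {f i, f (p i)}" by (elim exE conjE)
    obtain x y where xy: "x \<in> S i" "y \<in> S (p i)" "{x, y} \<in> M" using par_edge[OF i(1,2)] by (elim bexE)
    have pi: "p i < card V" using p[OF i(1,2)] i(2) by simp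
    consider "v = f i" "w = f (p i)" | "v = f (p i)" "w = f i" using i(3) by (auto simp: doubleton_eq_iff)
    then show "\<exists>x\<in>S (g v). \<exists>y\<in>S (g w). {x, y} \<in> M"
    proof cases
      case 1
      then show ?thesis using xy gf[OF i(2)] gf[OF pi] by auto
    next
      case 2
      have "{y, x} \<in> M" using xy(3) by (simp add: insert_commute)
      then show ?thesis using xy(1,2) gf[OF i(2)] gf[OF pi] 2
        by (intro bexI[where x = y and A = "S (g v)"] bexI[where x = x and A = "S (g w)"]) simp_all
    qed
  qed
qed

lemma maker_wins_forest_minor:
  assumes H: "simple_graph V E" and "forest E" "V \<noteq> {}"
    and par: "b + g + h + 2 * R + 4 \<le> n" "2 * (R + 1) * (R * (b + 1)) < g * h" "n \<le> K * g"
    and R: "R = blob_rounds K (card V)"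
  shows "maker_wins b (\<lambda>M. has_minor {..<n} M V E) {} (complete_edges n)"
proof -
  have V: "finite V" "E \<subseteq> nsets V 2" using H by (simp_all add: simple_graph_def)
  obtain f p where f: "bij_betw f {..<card V} V" and p: "\<forall>i. 0 < i \<longrightarrow> i < card V \<longrightarrow> p i < i"
    and E: "\<forall>e\<in>E. \<exists>i. 0 < i \<and> i < card V \<and> e = {f i, f (p i)}"
    using forest_order[OF V assms(2)] by (elim exE conjE)
  have k: "0 < card V" using V assms(3) by (simp add: card_gt_0_iff)
  show ?thesis
  proof (rule maker_wins_tree[OF par _ k R])
    show "p j < j" if "0 < j" "j < card V" for j using p that by simp
    fix S M F r assume "tree_state n b p (card V) S M F r"
    then show "has_minor {..<n} M V E"
      by (rule tree_state_minor[OF H f, rotated 2]) (use E p in simp_all)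
  qed
qed

section \<open>Clique minors from large girth\<close>

text \<open>A graph is represented by its edge set alone, with vertex set \<open>\<Union>E\<close>;
  vertices isolated by a deletion or a contraction disappear without bookkeeping.\<close>

definition clique_minor :: "nat \<Rightarrow> 'a set set \<Rightarrow> bool" where
  "clique_minor k E \<longleftrightarrow> (\<exists>S :: nat \<Rightarrow> 'a set.
     (\<forall>i<k. S i \<noteq> {} \<and> S i \<subseteq> \<Union>E \<and> connected_in E (S i)) \<and>
     (\<forall>i<k. \<forall>j<k. i \<noteq> j \<longrightarrow> S i \<inter> S j = {}) \<and>
     (\<forall>i<k. \<forall>j<k. i \<noteq> j \<longrightarrow> (\<exists>x\<in>S i. \<exists>y\<in>S j. {x, y} \<in> E)))"

lemma reachable_in_trans: "reachable_in E A u v \<Longrightarrow> reachable_in E A v w \<Longrightarrow> reachable_in E A u w"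
  unfolding reachable_in_def by (rule rtranclp_trans)

lemma reachable_in_edge: "{u, v} \<in> E \<Longrightarrow> u \<in> A \<Longrightarrow> v \<in> A \<Longrightarrow> reachable_in E A u v"
  unfolding reachable_in_def by (rule r_into_rtranclp) simp

lemma clique_minor_mono:
  assumes "E \<subseteq> E'" "clique_minor k E"
  shows "clique_minor k E'"
proof -
  obtain S where S: "\<forall>i<k. S i \<noteq> {} \<and> S i \<subseteq> \<Union>E \<and> connected_in E (S i)"
    "\<forall>i<k. \<forall>j<k. i \<noteq> j \<longrightarrow> S i \<inter> S j = {}"
    "\<forall>i<k. \<forall>j<k. i \<noteq> j \<longrightarrow> (\<exists>x\<in>S i. \<exists>y\<in>S j. {x, y} \<in> E)"
    using assms(2) unfolding clique_minor_def by (elim exE conjE)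
  have "\<forall>i<k. S i \<noteq> {} \<and> S i \<subseteq> \<Union>E' \<and> connected_in E' (S i)"
    using S(1) connected_in_mono[OF assms(1)] Union_mono[OF assms(1)] by (meson subset_trans)
  moreover have "\<forall>i<k. \<forall>j<k. i \<noteq> j \<longrightarrow> (\<exists>x\<in>S i. \<exists>y\<in>S j. {x, y} \<in> E')"
    using S(3) assms(1) by (meson subsetD)
  ultimately show ?thesis unfolding clique_minor_def using S(2) by (intro exI[of _ S] conjI)
qed

text \<open>Edges inside a fibre collapse and are removed by the cardinality condition; parallel
  edges merge because the result is a set.\<close>

definition contract :: "('a \<Rightarrow> 'a) \<Rightarrow> 'a set set \<Rightarrow> 'a set set" where
  "contract c E = {c ` e |e. e \<in> E \<and> card (c ` e) = 2}"

lemma card_2_doubleton: "card e = 2 \<Longrightarrow> \<exists>x y. e = {x, y} \<and> x \<noteq> y"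
  by (auto simp: card_2_iff)

lemma contractE:
  assumes "{p, q} \<in> contract c E" "\<forall>e\<in>E. card e = 2"
  obtains u v where "{u, v} \<in> E" "c u = p" "c v = q" "p \<noteq> q"
proof -
  obtain e where e: "e \<in> E" "c ` e = {p, q}" "card (c ` e) = 2"
    using assms(1) unfolding contract_def by auto
  obtain a b where ab: "e = {a, b}" using card_2_doubleton[of e] assms(2) e(1) by auto
  have "{c a, c b} = {p, q}" using e(2) ab by simp
  then consider "c a = p" "c b = q" | "c a = q" "c b = p" by (auto simp: doubleton_eq_iff)
  moreover have "p \<noteq> q" using e(2,3) by auto
  ultimately show thesis
  proof cases
    case 1
    then show thesis using that[of a b] e(1) ab \<open>p \<noteq> q\<close> by simp
  next
    case 2
    then show thesis using that[of b a] e(1) ab \<open>p \<noteq> q\<close> by (simp add: insert_commute)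
  qed
qed

lemma Union_contract_subset: "\<Union>(contract c E) \<subseteq> c ` \<Union>E"
  unfolding contract_def by auto

lemma card_contract: "\<forall>e\<in>contract c E. card e = 2"
  unfolding contract_def by auto

lemma finite_contract: "finite E \<Longrightarrow> finite (contract c E)"
  by (rule finite_subset[of _ "(\<lambda>e. c ` e) ` E"]) (auto simp: contract_def)

text \<open>Branch sets are pulled back along \<open>c\<close>. They stay connected because a walk
  in the quotient lifts edge by edge, and consecutive lifts are joined within a connected
  fibre.\<close>

lemma contract_clique_minor:
  assumes E2: "\<forall>e\<in>E. card e = 2" and fibre: "\<And>p. connected_in E {v \<in> \<Union>E. c v = p}"
    and "clique_minor k (contract c E)"
  shows "clique_minor k E"
proof -
  let ?E = "contract c E"
  obtain S where S: "\<forall>i<k. S i \<noteq> {} \<and> S i \<subseteq> \<Union>?E \<and> connected_in ?E (S i)"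
    "\<forall>i<k. \<forall>j<k. i \<noteq> j \<longrightarrow> S i \<inter> S j = {}"
    "\<forall>i<k. \<forall>j<k. i \<noteq> j \<longrightarrow> (\<exists>x\<in>S i. \<exists>y\<in>S j. {x, y} \<in> ?E)"
    using assms(3) unfolding clique_minor_def by (elim exE conjE)
  define T where "T i = {v \<in> \<Union>E. c v \<in> S i}" for i
  have lift: "a \<in> \<Union>E" if "{a, b} \<in> E" for a b using that by auto
  have in_fibre: "reachable_in E (T i) u v" if "u \<in> T i" "v \<in> T i" "c u = c v" for i u v
  proof -
    have "reachable_in E {w \<in> \<Union>E. c w = c u} u v"
      using fibre[of "c u"] that unfolding connected_in_def T_def by simp
    then show ?thesis by (rule reachable_in_mono[OF order_refl, rotated]) (use that in \<open>auto simp: T_def\<close>)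
  qed
  have conn: "connected_in E (T i)" if i: "i < k" for i
    unfolding connected_in_def
  proof (intro ballI)
    fix u v assume uv: "u \<in> T i" "v \<in> T i"
    have "(\<lambda>x y. x \<in> S i \<and> y \<in> S i \<and> {x, y} \<in> ?E)\<^sup>*\<^sup>* (c u) (c v)"
      using S(1) i uv unfolding connected_in_def reachable_in_def T_def by simp
    then have "\<forall>w\<in>T i. c w = c v \<longrightarrow> reachable_in E (T i) u w"
    proof (induction rule: rtranclp_induct)
      case base
      then show ?case using in_fibre[OF uv(1)] by simp
    next
      case (step p q)
      then have "{p, q} \<in> ?E" by simp
      then obtain a b where ab: "{a, b} \<in> E" "c a = p" "c b = q" using contractE[OF _ E2] by metis
      have abT: "a \<in> T i" "b \<in> T i" using ab step.hyps(2) lift[OF ab(1)] lift[of b a] unfolding T_def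
        by (auto simp: insert_commute)
      have "reachable_in E (T i) u b"
        using step.IH abT ab by (intro reachable_in_trans[OF _ reachable_in_edge[OF ab(1)]]) simp_all
      then show ?case using in_fibre[OF abT(2)] ab(3) by (auto intro: reachable_in_trans)
    qed
    then show "reachable_in E (T i) u v" using uv(2) by simp
  qed
  have ne: "T i \<noteq> {}" if i: "i < k" for i
  proof -
    have "S i \<noteq> {}" "S i \<subseteq> \<Union>?E" using S(1) i by simp_all
    then obtain p where p: "p \<in> S i" "p \<in> \<Union>?E" by (metis ex_in_conv subsetD)
    then obtain v where "v \<in> \<Union>E" "p = c v" using subsetD[OF Union_contract_subset p(2)] by (auto elim: imageE)
    then show ?thesis using p(1) unfolding T_def by auto
  qed
  show ?thesis unfolding clique_minor_def
  proof (intro exI[of _ T] conjI allI impI)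
    fix i assume i: "i < k"
    show "T i \<noteq> {}" "connected_in E (T i)" using ne[OF i] conn[OF i] by simp_all
    show "T i \<subseteq> \<Union>E" unfolding T_def by auto
    fix j assume j: "j < k" "i \<noteq> j"
    have "S i \<inter> S j = {}" using S(2) i j by simp
    then show "T i \<inter> T j = {}" unfolding T_def by auto
    obtain p q where "p \<in> S i" "q \<in> S j" "{p, q} \<in> ?E" using S(3) i j by blast
    moreover from this obtain a b where ab: "{a, b} \<in> E" "c a = p" "c b = q" using contractE[OF _ E2] by metis
    ultimately have "a \<in> T i" "b \<in> T j" using lift[OF ab(1)] lift[of b a] unfolding T_def by (auto simp: insert_commute)
    then show "\<exists>x\<in>T i. \<exists>y\<in>T j. {x, y} \<in> E" using ab(1) by (intro bexI)
  qed
qed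

lemma finite_Union_pairs: "finite E \<Longrightarrow> \<forall>e\<in>E. card e = 2 \<Longrightarrow> finite (\<Union>E)"
  by (rule finite_Union) (auto intro: card_ge_0_finite)

text \<open>Contracting \<open>{x, y}\<close> loses this edge and, for every common neighbour, one
  of two edges that merge. \<open>D\<close> collects them, and contraction is injective on the
  rest.\<close>

lemma contract_edge_card:
  assumes fin: "finite E" and E2: "\<forall>e\<in>E. card e = 2" and xy: "{x, y} \<in> E"
    and c: "c = id(y := x)"
  shows "card E \<le> card (contract c E) + card {z. {x, z} \<in> E \<and> {y, z} \<in> E} + 1"
proof -
  let ?Z = "{z. {x, z} \<in> E \<and> {y, z} \<in> E}"
  define D where "D = insert {x, y} ((\<lambda>z. {y, z}) ` ?Z)"
  have ne: "x \<noteq> y" using E2 xy by auto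
  have finZ: "finite ?Z"
    by (rule finite_subset[OF _ finite_Union_pairs[OF fin E2]]) auto
  have "card D \<le> Suc (card ((\<lambda>z. {y, z}) ` ?Z))" unfolding D_def using finZ by (simp add: card_insert_if)
  also have "\<dots> \<le> Suc (card ?Z)" using card_image_le[OF finZ] by simp
  finally have cD: "card D \<le> card ?Z + 1" by simp
  have form: "\<exists>z. e = {y, z} \<and> z \<noteq> x \<and> z \<noteq> y \<and> {x, z} \<notin> E \<and> c ` e = {x, z}" if e: "e \<in> E - D" "y \<in> e" for e
  proof -
    obtain a b where ab: "e = {a, b}" "a \<noteq> b" using card_2_doubleton[of e] E2 e(1) by auto
    then obtain z where z: "e = {y, z}" "z \<noteq> y" using e(2) by (auto simp: insert_commute)
    have "z \<noteq> x" using e(1) z unfolding D_def by (auto simp: insert_commute)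
    moreover have "{x, z} \<notin> E" using e(1) z unfolding D_def by auto
    ultimately show ?thesis using z by (intro exI[of _ z]) (simp add: c insert_commute)
  qed
  have same: "c ` e = e" if "y \<notin> e" for e
  proof -
    have "c ` e = id ` e" using that by (intro image_cong) (auto simp: c)
    then show ?thesis by simp
  qed
  have "inj_on (\<lambda>e. c ` e) (E - D)"
  proof (rule inj_onI)
    fix e e' assume e: "e \<in> E - D" "e' \<in> E - D" "c ` e = c ` e'"
    show "e = e'"
    proof (cases "y \<in> e"; cases "y \<in> e'")
      assume "y \<in> e" "y \<in> e'"
      obtain z where z: "e = {y, z}" "c ` e = {x, z}" using form[OF e(1) \<open>y \<in> e\<close>] by auto
      obtain z' where z': "e' = {y, z'}" "c ` e' = {x, z'}" using form[OF e(2) \<open>y \<in> e'\<close>] by auto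
      have "z = z'" using e(3) z z' by (auto simp: doubleton_eq_iff)
      then show ?thesis using z z' by simp
    next
      assume "y \<in> e" "y \<notin> e'"
      then show ?thesis using form[OF e(1) \<open>y \<in> e\<close>] same[of e'] e by auto
    next
      assume "y \<notin> e" "y \<in> e'"
      then show ?thesis using form[OF e(2) \<open>y \<in> e'\<close>] same[of e] e by auto
    next
      assume "y \<notin> e" "y \<notin> e'"
      have "c ` e = e" "c ` e' = e'" by (rule same, fact)+
      then show ?thesis using e(3) by metis
    qed
  qed
  moreover have "(\<lambda>e. c ` e) ` (E - D) \<subseteq> contract c E"
  proof (rule image_subsetI)
    fix e assume e: "e \<in> E - D"
    have "card (c ` e) = 2"
    proof (cases "y \<in> e")
      case True
      then show ?thesis using form[OF e] by auto
    next
      case False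
      then show ?thesis using same[of e] E2 e by simp
    qed
    then show "c ` e \<in> contract c E" using e unfolding contract_def by auto
  qed
  ultimately have "card (E - D) \<le> card (contract c E)"
    by (rule card_inj_on_le) (rule finite_contract[OF fin])
  moreover have "card E \<le> card (E - D) + card D"
  proof -
    have "finite D" unfolding D_def using finZ by simp
    then have "card E \<le> card ((E - D) \<union> D)" using fin by (intro card_mono) auto
    also have "\<dots> \<le> card (E - D) + card D" by (rule card_Un_le)
    finally show ?thesis .
  qed
  ultimately show ?thesis using cD by linarith
qed

text \<open>An edge whose ends have fewer than \<open>2 ^ Suc k\<close> common neighbours is
  contracted: one vertex disappears together with at most \<open>2 ^ Suc k\<close> edges, which
  preserves the ratio. If no such edge exists, the neighbourhood of any vertex \<open>x\<close>
  spans a graph of minimum degree \<open>2 ^ Suc k\<close>, so of ratio \<open>2 ^ k\<close>; the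
  clique minor found there is completed by \<open>x\<close>.\<close>

lemma clique_minor_dense:
  assumes "finite E" "\<forall>e\<in>E. card e = 2" "E \<noteq> {}" "2 ^ k * card (\<Union>E) \<le> card E"
  shows "clique_minor (Suc k) (E :: 'a set set)"
  using assms
proof (induction k arbitrary: E)
  case 0
  then obtain x where x: "x \<in> \<Union>E" by (metis Union_upper card.empty ex_in_conv numeral_2_eq_2 subset_empty zero_neq_numeral)
  then show ?case unfolding clique_minor_def
    by (intro exI[of _ "\<lambda>_. {x}"]) (auto simp: connected_in_def reachable_in_def)
next
  case (Suc k)
  note outer = Suc.IH
  show ?case using Suc.prems
  proof (induction "card E" arbitrary: E rule: less_induct)
    case less
    note fin = less.prems(1) and E2 = less.prems(2) and dense = less.prems(4)
    have finV: "finite (\<Union>E)" by (rule finite_Union_pairs[OF fin E2])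
    let ?d = "(2::nat) ^ Suc k"
    show ?case
    proof (cases "\<exists>x y. {x, y} \<in> E \<and> card {z. {x, z} \<in> E \<and> {y, z} \<in> E} < ?d")
      case True
      then obtain x y where xy: "{x, y} \<in> E" "card {z. {x, z} \<in> E \<and> {y, z} \<in> E} < ?d" by (elim exE conjE)
      have ne: "x \<noteq> y" using E2 xy(1) by auto
      have xyV: "x \<in> \<Union>E" "y \<in> \<Union>E" using xy(1) by auto
      define c where "c = id(y := x)"
      let ?E = "contract c E"
      have "card E \<le> card ?E + ?d"
        using contract_edge_card[OF fin E2 xy(1) c_def] xy(2) by linarith
      moreover have "c ` \<Union>E \<subseteq> \<Union>E - {y}" using xyV ne by (auto simp: c_def)
      then have "\<Union>?E \<subseteq> \<Union>E - {y}" using Union_contract_subset[of c E] by (rule subset_trans[rotated])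
      then have "card (\<Union>?E) \<le> card (\<Union>E - {y})" using finV by (intro card_mono) simp_all
      then have v: "card (\<Union>?E) + 1 \<le> card (\<Union>E)"
      proof -
        have "card (\<Union>E) > 0" using finV xyV(1) card_gt_0_iff by blast
        then show ?thesis using \<open>card (\<Union>?E) \<le> card (\<Union>E - {y})\<close> xyV(2) finV by simp
      qed
      have "?d * (card (\<Union>?E) + 1) \<le> ?d * card (\<Union>E)" using v by (rule mult_left_mono) simp
      ultimately have d': "?d * card (\<Union>?E) \<le> card ?E" using dense by (simp add: algebra_simps)
      \<comment> \<open>The quotient has edges left: two vertices force at least
        \<open>2 * ?d\<close> edges, and at most \<open>?d\<close> are lost.\<close>
      have "{x, y} \<subseteq> \<Union>E" using xyV by simp
      then have "card {x, y} \<le> card (\<Union>E)" using finV by (intro card_mono)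
      then have "?d * 2 \<le> ?d * card (\<Union>E)" using ne by (intro mult_left_mono) simp_all
      then have "?d * 2 \<le> card E" using dense by linarith
      moreover have "0 < ?d" by simp
      ultimately have "card ?E > 0" using \<open>card E \<le> card ?E + ?d\<close> by linarith
      then have ne': "?E \<noteq> {}" by auto
      have "contract c E \<subseteq> (\<lambda>e. c ` e) ` (E - {{x, y}})"
      proof
        fix f assume "f \<in> contract c E"
        then obtain e where e: "e \<in> E" "f = c ` e" "card (c ` e) = 2" unfolding contract_def by auto
        have "c ` {x, y} = {x}" by (auto simp: c_def)
        then have "e \<noteq> {x, y}" using e(3) by auto
        then show "f \<in> (\<lambda>e. c ` e) ` (E - {{x, y}})" using e(1,2) by simp
      qed
      then have "card ?E \<le> card (E - {{x, y}})" using fin by (intro surj_card_le) simp_all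
      also have "\<dots> < card E" using fin xy(1) by (rule card_Diff1_less)
      finally have smaller: "card ?E < card E" .
      have "clique_minor (Suc (Suc k)) ?E"
        by (rule less.hyps[OF smaller finite_contract[OF fin] card_contract ne' d'])
      then show ?thesis
      proof (rule contract_clique_minor[OF E2, rotated])
        fix p
        show "connected_in E {v \<in> \<Union>E. c v = p}"
        proof (cases "p = x")
          case True
          have eq: "{v \<in> \<Union>E. c v = p} = {x, y}" using xyV True by (auto simp: c_def split: if_splits)
          have "reachable_in E {x, y} x y" "reachable_in E {x, y} y x"
            using xy(1) by (auto intro: reachable_in_edge simp: insert_commute)
          then show ?thesis unfolding eq connected_in_def by (auto simp: reachable_in_def)
        next
          case False
          then have eq: "{v \<in> \<Union>E. c v = p} \<subseteq> {p}" by (auto simp: c_def split: if_splits)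
          then show ?thesis unfolding connected_in_def reachable_in_def by (metis (no_types, lifting) rtranclp.rtrancl_refl singletonD subsetD)
        qed
      qed
    next
      case False
      then have many: "?d \<le> card {z. {x, z} \<in> E \<and> {y, z} \<in> E}" if "{x, y} \<in> E" for x y using that by (meson not_less)
      obtain e where e: "e \<in> E" using less.prems(3) by auto
      then obtain x y0 where xy0: "{x, y0} \<in> E" using card_2_doubleton[of e] E2 by auto
      define N where "N = {y. {x, y} \<in> E}"
      define G where "G = {f \<in> E. f \<subseteq> N}"
      have NV: "N \<subseteq> \<Union>E" unfolding N_def by auto
      then have finN: "finite N" using finV by (rule finite_subset)
      have finG: "finite G" using fin by (simp add: G_def)
      have G2: "\<forall>f\<in>G. card f = 2" using E2 by (simp add: G_def)
      have deg: "?d \<le> card {f \<in> G. y \<in> f}" if y: "y \<in> N" for y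
      proof -
        let ?Z = "{z. {x, z} \<in> E \<and> {y, z} \<in> E}"
        have "(\<lambda>z. {y, z}) ` ?Z \<subseteq> {f \<in> G. y \<in> f}" using y unfolding G_def N_def by auto
        then have "card ((\<lambda>z. {y, z}) ` ?Z) \<le> card {f \<in> G. y \<in> f}" using finG by (intro card_mono) simp_all
        moreover have "card ((\<lambda>z. {y, z}) ` ?Z) = card ?Z"
          by (rule card_image) (auto simp: inj_on_def doubleton_eq_iff)
        moreover have "?d \<le> card ?Z" using many[of x y] y by (simp add: N_def)
        ultimately show ?thesis by simp
      qed
      have "N \<subseteq> \<Union>G"
      proof
        fix y assume "y \<in> N"
        have "0 < ?d" by simp
        then have "card {f \<in> G. y \<in> f} > 0" using deg[OF \<open>y \<in> N\<close>] by (rule less_le_trans)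
        then have "{f \<in> G. y \<in> f} \<noteq> {}" by (metis card.empty less_irrefl)
        then show "y \<in> \<Union>G" by auto
      qed
      then have UG: "\<Union>G = N" unfolding G_def by auto
      have "?d * card N = (\<Sum>y\<in>N. ?d)" by simp
      also have "\<dots> \<le> (\<Sum>y\<in>N. card {f \<in> G. y \<in> f})" using deg by (intro sum_mono)
      also have "\<dots> = 2 * card G" using G2 finN finG by (intro sum_degrees) (auto simp: G_def)
      finally have dG: "2 ^ k * card (\<Union>G) \<le> card G" by (simp add: UG)
      have "y0 \<in> \<Union>G" unfolding UG N_def using xy0 by simp
      then have "G \<noteq> {}" by auto
      have "clique_minor (Suc k) G" by (rule outer[OF finG G2 \<open>G \<noteq> {}\<close> dG])
      then obtain S where S: "\<forall>i<Suc k. S i \<noteq> {} \<and> S i \<subseteq> \<Union>G \<and> connected_in G (S i)"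
        "\<forall>i<Suc k. \<forall>j<Suc k. i \<noteq> j \<longrightarrow> S i \<inter> S j = {}"
        "\<forall>i<Suc k. \<forall>j<Suc k. i \<noteq> j \<longrightarrow> (\<exists>x\<in>S i. \<exists>y\<in>S j. {x, y} \<in> G)"
        unfolding clique_minor_def by (elim exE conjE)
      have GE: "G \<subseteq> E" by (auto simp: G_def)
      define T where "T = S(Suc k := {x})"
      have xN: "x \<notin> N" unfolding N_def using E2 by auto
      have xE: "x \<in> \<Union>E" using xy0 by auto
      have SN: "S i \<subseteq> N" "S i \<noteq> {}" if "i < Suc k" for i using S(1) that UG by simp_all
      have to_x: "\<exists>y\<in>S i. {y, x} \<in> E \<and> {x, y} \<in> E" if i: "i < Suc k" for i
      proof -
        obtain y where y: "y \<in> S i" using SN(2)[OF i] by auto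
        then have "{x, y} \<in> E" using SN(1)[OF i] unfolding N_def by auto
        then show ?thesis using y by (intro bexI[OF _ y]) (simp add: insert_commute)
      qed
      show ?thesis unfolding clique_minor_def
      proof (intro exI[of _ T] conjI allI impI)
        fix i assume i: "i < Suc (Suc k)"
        show "T i \<noteq> {}" using SN i by (auto simp: T_def less_Suc_eq)
        show "T i \<subseteq> \<Union>E" using SN(1)[of i] NV xE i by (auto simp: T_def less_Suc_eq)
        show "connected_in E (T i)"
        proof (cases "i = Suc k")
          case True
          then show ?thesis by (simp add: T_def connected_in_def reachable_in_def)
        next
          case False
          then have "connected_in G (S i)" using S(1) i by simp
          then show ?thesis using False connected_in_mono[OF GE] by (simp add: T_def)
        qed
        fix j assume j: "j < Suc (Suc k)" "i \<noteq> j"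
        consider "i = Suc k" "j < Suc k" | "j = Suc k" "i < Suc k" | "i < Suc k" "j < Suc k" using i j by linarith
        then show "T i \<inter> T j = {}"
        proof cases
          case 1
          then show ?thesis using SN(1)[of j] xN by (auto simp: T_def)
        next
          case 2
          then show ?thesis using SN(1)[of i] xN by (auto simp: T_def)
        next
          case 3
          then show ?thesis using S(2) j(2) by (simp add: T_def)
        qed
        consider "i = Suc k" "j < Suc k" | "j = Suc k" "i < Suc k" | "i < Suc k" "j < Suc k" using i j by linarith
        then show "\<exists>x\<in>T i. \<exists>y\<in>T j. {x, y} \<in> E"
        proof cases
          case 1
          then show ?thesis using to_x[of j] by (auto simp: T_def)
        next
          case 2
          then show ?thesis using to_x[of i] by (auto simp: T_def)
        next
          case 3
          then have "\<exists>x\<in>S i. \<exists>y\<in>S j. {x, y} \<in> G" using S(3) j(2) by simp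
          then show ?thesis using 3 GE by (auto simp: T_def)
        qed
      qed
    qed
  qed
qed


section \<open>Walks of bounded length, girth, and contraction of stars\<close>

primrec walk :: "'a set set \<Rightarrow> nat \<Rightarrow> 'a \<Rightarrow> 'a \<Rightarrow> bool" where
  "walk E 0 x y \<longleftrightarrow> x = y"
| "walk E (Suc d) x y \<longleftrightarrow> x = y \<or> (\<exists>z. {x, z} \<in> E \<and> walk E d z y)"

lemma walk_refl [simp]: "walk E d x x"
  by (cases d) auto

lemma walk_edge: "{x, y} \<in> E \<Longrightarrow> walk E (Suc 0) x y"
  by auto

lemma walk_Suc: "walk E d x y \<Longrightarrow> walk E (Suc d) x y"
  by (induction d arbitrary: x) auto

lemma walk_mono:
  assumes "walk E d x y" "d \<le> d'"
  shows "walk E d' x y"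
  using assms(2)
proof (induction rule: dec_induct)
  case (step n)
  then show ?case by (intro walk_Suc)
qed (rule assms(1))

lemma walk_trans: "walk E d x y \<Longrightarrow> walk E d' y z \<Longrightarrow> walk E (d + d') x z"
proof (induction d arbitrary: x)
  case (Suc d)
  show ?case
  proof (cases "x = y")
    case True
    then show ?thesis using Suc.prems(2) by (auto intro: walk_mono simp del: walk.simps)
  next
    case False
    then obtain w where "{x, w} \<in> E" "walk E d w y" using Suc.prems(1) by auto
    then show ?thesis using Suc.IH[OF _ Suc.prems(2)] by auto
  qed
qed simp

text \<open>No edge lies on a cycle of length at most \<open>g + 1\<close>; in terms of walks, so that cycles need not be simple.\<close>

definition no_short_cycle :: "nat \<Rightarrow> 'a set set \<Rightarrow> bool" where
  "no_short_cycle g E \<longleftrightarrow> (\<forall>x y. {x, y} \<in> E \<longrightarrow> \<not> walk (E - {{x, y}}) g x y)"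

text \<open>There are no isolated vertices because \<open>V = \<Union>E\<close>. The complement of a
  minimum dominating set \<open>D\<close> then dominates as well, since a vertex of \<open>D\<close>
  with all its neighbours in \<open>D\<close> could be left out. The smaller of the two sets will
  do.\<close>

lemma small_dominating_set:
  assumes finV: "finite V" and E2: "\<forall>e\<in>E. card e = 2" and V: "V = \<Union>E"
  shows "\<exists>C\<subseteq>V. 2 * card C \<le> card V \<and> (\<forall>v\<in>V - C. \<exists>u\<in>C. {v, u} \<in> E)"
proof -
  define dom where "dom D \<longleftrightarrow> D \<subseteq> V \<and> (\<forall>v\<in>V - D. \<exists>u\<in>D. {v, u} \<in> E)" for D
  have "dom V" by (simp add: dom_def)
  then have "\<exists>D. dom D \<and> (\<forall>D'. dom D' \<longrightarrow> card D \<le> card D')" by (rule ex_has_least_nat)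
  then obtain D where D: "dom D" and min: "\<forall>D'. dom D' \<longrightarrow> card D \<le> card D'" by (elim exE conjE)
  have DV: "D \<subseteq> V" using D by (simp add: dom_def)
  then have finD: "finite D" using finV by (rule finite_subset)
  have nbr: "\<exists>u\<in>V. u \<noteq> v \<and> {v, u} \<in> E" if v: "v \<in> V" for v
  proof -
    obtain e where e: "e \<in> E" "v \<in> e" using v V by auto
    then obtain a b where ab: "e = {a, b}" "a \<noteq> b" using card_2_doubleton[of e] E2 by auto
    then obtain u where u: "e = {v, u}" "u \<noteq> v" using e(2) by (auto simp: insert_commute)
    then have "u \<in> V" using e(1) V by auto
    then show ?thesis using u e(1) by auto
  qed
  have "dom (V - D)"
    unfolding dom_def
  proof (intro conjI ballI)
    fix v assume "v \<in> V - (V - D)"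
    then have v: "v \<in> D" "v \<in> V" by auto
    show "\<exists>u\<in>V - D. {v, u} \<in> E"
    proof (rule ccontr)
      assume no: "\<not> ?thesis"
      obtain u where u: "u \<in> V" "u \<noteq> v" "{v, u} \<in> E" using nbr[OF v(2)] by auto
      then have uD: "u \<in> D" using no by auto
      have "dom (D - {v})"
        unfolding dom_def
      proof (intro conjI ballI)
        show "D - {v} \<subseteq> V" using DV by auto
        fix w assume w: "w \<in> V - (D - {v})"
        show "\<exists>u\<in>D - {v}. {w, u} \<in> E"
        proof (cases "w = v")
          case True
          then show ?thesis using u uD by auto
        next
          case False
          then have wD: "w \<in> V - D" using w by auto
          then obtain z where z: "z \<in> D" "{w, z} \<in> E" using D unfolding dom_def by auto
          have "z \<noteq> v"
          proof
            assume "z = v"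
            then have "{v, w} \<in> E" using z(2) by (simp add: insert_commute)
            then show False using no wD by auto
          qed
          then show ?thesis using z by auto
        qed
      qed
      then have "card D \<le> card (D - {v})" using min by simp
      then show False using card_Diff1_less[OF finD v(1)] by simp
    qed
  qed simp
  moreover have "card D + card (V - D) = card V"
    using card_Diff_subset[OF finD DV] card_mono[OF finV DV] by simp
  ultimately show ?thesis
  proof (cases "2 * card D \<le> card V")
    case True
    then show ?thesis using D unfolding dom_def by (intro exI[of _ D]) simp
  next
    case False
    then have "2 * card (V - D) \<le> card V" using \<open>card D + card (V - D) = card V\<close> by simp
    then show ?thesis using \<open>dom (V - D)\<close> unfolding dom_def by (intro exI[of _ "V - D"]) simp
  qed
qed

text \<open>Every vertex is mapped to a dominating neighbour or to itself, so fibres are stars of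
  diameter at most 2. Loops and parallel edges of the quotient would come from cycles of length at
  most 6, so only the \<open>card V - card C\<close> star edges are lost. The number
  \<open>q = card C\<close> is stated besides \<open>card (\<Union>E')\<close> because the latter
  may be smaller when centres become isolated.\<close>

lemma halve_vertices:
  fixes E :: "'a set set"
  assumes fin: "finite E" and E2: "\<forall>e\<in>E. card e = 2" and girth: "no_short_cycle (3 * d + 5) E"
  shows "\<exists>(E' :: 'a set set) q. finite E' \<and> (\<forall>e\<in>E'. card e = 2) \<and> card E + q \<le> card E' + card (\<Union>E) \<and>
     card (\<Union>E') \<le> q \<and> 2 * q \<le> card (\<Union>E) \<and> no_short_cycle d E' \<and>
     (\<forall>k. clique_minor k E' \<longrightarrow> clique_minor k E)"
proof -
  define V where "V = \<Union>E"
  have finV: "finite V" unfolding V_def by (rule finite_Union_pairs[OF fin E2])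
  obtain C where C: "C \<subseteq> V" "2 * card C \<le> card V" "\<forall>v\<in>V - C. \<exists>u\<in>C. {v, u} \<in> E"
    using small_dominating_set[OF finV E2 V_def] by (elim exE conjE)
  have finC: "finite C" using C(1) finV by (rule finite_subset)
  define c where "c v = (if v \<in> C then v else SOME u. u \<in> C \<and> {v, u} \<in> E)" for v
  have cC: "c v = v" if "v \<in> C" for v using that by (simp add: c_def)
  have c: "c v \<in> C" "{v, c v} \<in> E" if v: "v \<in> V" "v \<notin> C" for v
  proof -
    have "\<exists>u. u \<in> C \<and> {v, u} \<in> E" using C(3) v by auto
    from someI_ex[OF this] show "c v \<in> C" "{v, c v} \<in> E" using v(2) by (simp_all add: c_def)
  qed
  have cV: "c v \<in> C" if "v \<in> V" for v using that c cC by (cases "v \<in> C") auto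
  have cc: "c (c v) = c v" if "v \<in> V" for v using cC[OF cV[OF that]] .
  define St where "St = (\<lambda>v. {v, c v}) ` (V - C)"
  have StE: "St \<subseteq> E" using c unfolding St_def by auto
  have "inj_on (\<lambda>v. {v, c v}) (V - C)"
  proof (rule inj_onI)
    fix u v assume uv: "u \<in> V - C" "v \<in> V - C" "{u, c u} = {v, c v}"
    have "u \<noteq> c v" using uv(1,2) cV[of v] by auto
    then show "u = v" using uv(3) by (auto simp: doubleton_eq_iff)
  qed
  then have cSt: "card St + card C = card V"
    using card_Diff_subset[OF finC C(1)] card_mono[OF finV C(1)] unfolding St_def by (simp add: card_image)
  have to_c: "walk A 1 w (c w)" "walk A 1 (c w) w" if "w \<in> V" "St \<subseteq> A" for A w
  proof -
    have "{w, c w} \<in> A \<or> w = c w"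
    proof (cases "w \<in> C")
      case False
      then have "{w, c w} \<in> St" using that(1) unfolding St_def by (intro imageI) simp
      then show ?thesis using that(2) by auto
    qed (simp add: cC)
    then show "walk A 1 w (c w)" "walk A 1 (c w) w" by (auto simp: insert_commute)
  qed
  have within: "walk A 2 u v" if "u \<in> V" "v \<in> V" "c u = c v" "St \<subseteq> A" for A u v
    using walk_trans[OF to_c(1)[OF that(1,4)], of 1 v] to_c(2)[OF that(2,4)] that(3) by (simp add: numeral_2_eq_2 del: walk.simps)
  have St_c: "c u = c v" if uv: "{u, v} \<in> St" for u v
  proof -
    obtain w where w: "w \<in> V" "{u, v} = {w, c w}" using uv unfolding St_def by auto
    then show ?thesis using cc[OF w(1)] by (auto simp: doubleton_eq_iff)
  qed
  have inV: "u \<in> V" "v \<in> V" if "{u, v} \<in> E" for u v using that unfolding V_def by auto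
  have short: "\<not> walk (E - {{u, v}}) l u v" if "{u, v} \<in> E" "l \<le> 3 * d + 5" for u v l
    using girth that walk_mono unfolding no_short_cycle_def by metis
  have cross: "c u \<noteq> c v" if "{u, v} \<in> E - St" for u v
  proof
    assume eq: "c u = c v"
    have "St \<subseteq> E - {{u, v}}" using StE that by auto
    moreover have uv: "{u, v} \<in> E" using that by simp
    ultimately have "walk (E - {{u, v}}) 2 u v" using within[OF inV[OF uv] eq] by simp
    then show False using short[OF uv, of 2] by simp
  qed
  let ?E = "contract c E"
  have "inj_on (\<lambda>e. c ` e) (E - St)"
  proof (rule inj_onI)
    fix e e' assume e: "e \<in> E - St" "e' \<in> E - St" "c ` e = c ` e'"
    obtain u v where uv: "e = {u, v}" using card_2_doubleton[of e] E2 e(1) by auto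
    obtain u0 v0 where uv0: "e' = {u0, v0}" using card_2_doubleton[of e'] E2 e(2) by auto
    have "{c u, c v} = {c u0, c v0}" using e(3) uv uv0 by simp
    then obtain u' v' where uv': "e' = {u', v'}" "c u = c u'" "c v = c v'"
      using uv0 by (auto simp: doubleton_eq_iff insert_commute)
    show "e = e'"
    proof (rule ccontr)
      assume ne: "e \<noteq> e'"
      let ?A = "E - {{u, v}}"
      have St: "St \<subseteq> ?A" using StE e(1) uv by auto
      have "{u, v} \<in> E" "{u', v'} \<in> E" using e uv uv' by auto
      note V' = inV[OF this(1)] inV[OF this(2)]
      have "walk ?A (Suc 0) u' v'" using e(2) ne uv uv' by (intro walk_edge) auto
      moreover have "walk ?A 2 u u'" "walk ?A 2 v' v" using V' uv' by (auto intro!: within[OF _ _ _ St])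
      \<comment> \<open>A second edge between the same two stars gives a detour of length 5; hence
        the summand in \<open>3 * d + 5\<close>.\<close>
      ultimately have "walk ?A (2 + Suc 0 + 2) u v" using walk_trans by metis
      then show False using short[OF \<open>{u, v} \<in> E\<close>, of "2 + Suc 0 + 2"] by (simp del: walk.simps)
    qed
  qed
  moreover have "(\<lambda>e. c ` e) ` (E - St) \<subseteq> ?E"
  proof (rule image_subsetI)
    fix e assume e: "e \<in> E - St"
    then obtain u v where uv: "e = {u, v}" using card_2_doubleton[of e] E2 by auto
    then have "card (c ` e) = 2" using cross[of u v] e by simp
    then show "c ` e \<in> ?E" using e unfolding contract_def by auto
  qed
  ultimately have "card (E - St) \<le> card ?E"
    by (rule card_inj_on_le) (rule finite_contract[OF fin])
  moreover have "card (E - St) = card E - card St" "card St \<le> card E"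
    using StE fin finite_subset[OF StE fin] by (simp_all add: card_Diff_subset card_mono)
  ultimately have edges: "card E + card C \<le> card ?E + card V" using cSt by linarith
  have UE: "\<Union>?E \<subseteq> C"
  proof -
    have "c ` \<Union>E \<subseteq> C" using cV unfolding V_def by auto
    then show ?thesis using Union_contract_subset by (rule subset_trans[rotated])
  qed
  \<comment> \<open>Each quotient edge lifts to one edge, preceded by at most two steps inside a
    star; the final \<open>+ 2\<close> is the way through the last star.\<close>
  have lift_walk: "\<forall>w w'. w \<in> V \<longrightarrow> w' \<in> V \<longrightarrow> c w = a \<longrightarrow> c w' = b \<longrightarrow> walk (E - {{u, v}}) (3 * l + 2) w w'"
    if "walk (?E - {{c u, c v}}) l a b" "{u, v} \<in> E" "c u \<noteq> c v" for a b u v l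
    using that(1)
  proof (induction l arbitrary: a)
    case 0
    have St: "St \<subseteq> E - {{u, v}}" using StE St_c that(3) by auto
    have ab: "a = b" using 0 by simp
    show ?case
    proof (intro allI impI)
      fix w w' assume "w \<in> V" "w' \<in> V" "c w = a" "c w' = b"
      then have "walk (E - {{u, v}}) 2 w w'" using ab by (intro within[OF _ _ _ St]) simp_all
      then show "walk (E - {{u, v}}) (3 * 0 + 2) w w'" by (rule walk_mono) simp
    qed
  next
    case (Suc l)
    have St: "St \<subseteq> E - {{u, v}}" using StE St_c that(3) by auto
    show ?case
    proof (cases "a = b")
      case True
      show ?thesis
      proof (intro allI impI)
        fix w w' assume "w \<in> V" "w' \<in> V" "c w = a" "c w' = b"
        then have "walk (E - {{u, v}}) 2 w w'" using True by (intro within[OF _ _ _ St]) simp_all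
        then show "walk (E - {{u, v}}) (3 * Suc l + 2) w w'" by (rule walk_mono) simp
      qed
    next
      case False
      then obtain z where z: "{a, z} \<in> ?E" "{a, z} \<noteq> {c u, c v}" "walk (?E - {{c u, c v}}) l z b"
        using Suc.prems by auto
      obtain s t where st: "{s, t} \<in> E" "c s = a" "c t = z" using contractE[OF z(1) E2] by metis
      have "{s, t} \<noteq> {u, v}" using z(2) st by (auto simp: doubleton_eq_iff)
      then have e1: "walk (E - {{u, v}}) (Suc 0) s t" using st(1) by (intro walk_edge) simp
      show ?thesis
      proof (intro allI impI)
        fix w w' assume w: "w \<in> V" "w' \<in> V" "c w = a" "c w' = b"
        have "walk (E - {{u, v}}) 2 w s" using within[OF w(1) inV(1)[OF st(1)] _ St] w st by simp
        from walk_trans[OF this e1] have "walk (E - {{u, v}}) (2 + Suc 0) w t" .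
        moreover have "walk (E - {{u, v}}) (3 * l + 2) t w'"
          using Suc.IH[OF z(3)] w inV(2)[OF st(1)] st by simp
        ultimately have "walk (E - {{u, v}}) (2 + Suc 0 + (3 * l + 2)) w w'" by (rule walk_trans)
        then show "walk (E - {{u, v}}) (3 * Suc l + 2) w w'" by (rule walk_mono) simp
      qed
    qed
  qed
  have girth': "no_short_cycle d ?E"
    unfolding no_short_cycle_def
  proof (intro allI impI notI)
    fix p q assume pq: "{p, q} \<in> ?E" "walk (?E - {{p, q}}) d p q"
    obtain u v where uv: "{u, v} \<in> E" "c u = p" "c v = q" "p \<noteq> q" using contractE[OF pq(1) E2] .
    have "walk (E - {{u, v}}) (3 * d + 2) u v"
      using lift_walk[of u v d p q] pq(2) uv inV[OF uv(1)] by simp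
    then show False using short[OF uv(1), of "3 * d + 2"] by simp
  qed
  have minor: "clique_minor k E" if "clique_minor k ?E" for k
  proof (rule contract_clique_minor[OF E2 _ that])
    fix p
    show "connected_in E {v \<in> \<Union>E. c v = p}"
      unfolding connected_in_def
    proof (intro ballI)
      let ?A = "{v \<in> \<Union>E. c v = p}"
      have hub: "reachable_in E ?A w p" "reachable_in E ?A p w" if w: "w \<in> ?A" for w
      proof -
        have wV: "w \<in> V" "c w = p" using w by (auto simp: V_def)
        show "reachable_in E ?A w p" "reachable_in E ?A p w"
        proof (atomize (full), cases "w \<in> C")
          case True
          then have "w = p" using cC wV by simp
          then show "reachable_in E ?A w p \<and> reachable_in E ?A p w" by (simp add: reachable_in_def)
        next
          case False
          have e: "{w, p} \<in> E" using c(2)[OF wV(1) False] wV(2) by simp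
          have "p \<in> ?A" using cc[OF wV(1)] wV(2) inV(2)[OF e] by (simp add: V_def)
          then show "reachable_in E ?A w p \<and> reachable_in E ?A p w"
            using e w by (auto intro: reachable_in_edge simp: insert_commute)
        qed
      qed
      fix u v assume uv: "u \<in> ?A" "v \<in> ?A"
      show "reachable_in E ?A u v" by (rule reachable_in_trans[OF hub(1)[OF uv(1)] hub(2)[OF uv(2)]])
    qed
  qed
  have "card (\<Union>?E) \<le> card C" by (rule card_mono[OF finC UE])
  show ?thesis
  proof (intro exI[of _ ?E] exI[of _ "card C"] conjI allI impI)
    show "finite ?E" by (rule finite_contract[OF fin])
    show "\<forall>e\<in>?E. card e = 2" by (rule card_contract)
    show "card E + card C \<le> card ?E + card (\<Union>E)" using edges unfolding V_def .
    show "card (\<Union>?E) \<le> card C" by fact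
    show "2 * card C \<le> card (\<Union>E)" using C(2) unfolding V_def .
    show "no_short_cycle d ?E" by (rule girth')
    fix k assume "clique_minor k ?E"
    then show "clique_minor k E" by (rule minor)
  qed
qed


text \<open>The girth parameter needed for \<open>s\<close> rounds of \<open>halve_vertices\<close>,
  each of which turns \<open>3 * d + 5\<close> into \<open>d\<close>.\<close>

primrec girth_bound :: "nat \<Rightarrow> nat" where
  "girth_bound 0 = 0"
| "girth_bound (Suc s) = 3 * girth_bound s + 5"

text \<open>Each halving keeps the excess of edges over vertices and halves the vertices, so the
  relative excess \<delta> doubles. After \<open>s\<close> halvings the ratio is at least
  \<open>1 + 2 ^ s * \<delta>\<close>, enough for \<open>clique_minor_dense\<close>.\<close>

lemma clique_minor_girth:
  assumes "finite E" "\<forall>e\<in>E. card e = 2" "E \<noteq> {}" "no_short_cycle (girth_bound s) E"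
    and "\<delta> > 0" "(1 + \<delta>) * real (card (\<Union>E)) \<le> real (card E)" "2 ^ k \<le> 1 + 2 ^ s * \<delta>"
  shows "clique_minor (Suc k) (E :: 'a set set)"
  using assms
proof (induction s arbitrary: E \<delta>)
  case 0
  have "2 ^ k * real (card (\<Union>E)) \<le> (1 + \<delta>) * real (card (\<Union>E))"
    using 0 by (intro mult_right_mono) simp_all
  also have "\<dots> \<le> real (card E)" by (rule 0)
  finally have "real (2 ^ k * card (\<Union>E)) \<le> real (card E)" by simp
  then have "2 ^ k * card (\<Union>E) \<le> card E" by (simp only: of_nat_le_iff)
  then show ?case by (rule clique_minor_dense[OF 0(1-3)])
next
  case (Suc s)
  note fin = Suc.prems(1) and E2 = Suc.prems(2)
  have "no_short_cycle (3 * girth_bound s + 5) E" using Suc.prems(4) by simp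
  from halve_vertices[OF fin E2 this]
  obtain E' :: "'a set set" and q where E': "finite E'" "\<forall>e\<in>E'. card e = 2" "card E + q \<le> card E' + card (\<Union>E)"
     "card (\<Union>E') \<le> q" "2 * q \<le> card (\<Union>E)" "no_short_cycle (girth_bound s) E'"
     "\<forall>k. clique_minor k E' \<longrightarrow> clique_minor k E"
    by (elim exE conjE)
  have "\<delta> * (2 * real q) \<le> \<delta> * real (card (\<Union>E))" using E'(5) Suc.prems(5) by (intro mult_left_mono) linarith+
  moreover have "real (card E) + real q \<le> real (card E') + real (card (\<Union>E))" using E'(3) by linarith
  moreover have "real (card (\<Union>E)) + \<delta> * real (card (\<Union>E)) \<le> real (card E)"
    using Suc.prems(6) by (simp add: algebra_simps)
  ultimately have dense: "real q + 2 * \<delta> * real q \<le> real (card E')"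
    and pos: "real q + \<delta> * real (card (\<Union>E)) \<le> real (card E')" by linarith+
  have "(1 + 2 * \<delta>) * real (card (\<Union>E')) \<le> (1 + 2 * \<delta>) * real q"
    using E'(4) Suc.prems(5) by (intro mult_left_mono) simp_all
  then have "(1 + 2 * \<delta>) * real (card (\<Union>E')) \<le> real (card E')" using dense by (simp add: algebra_simps)
  moreover have "E' \<noteq> {}"
  proof
    assume "E' = {}"
    then have "\<delta> * real (card (\<Union>E)) \<le> 0" using pos by simp
    then have "card (\<Union>E) = 0" using Suc.prems(5) by (simp add: mult_le_0_iff)
    then have "\<Union>E = {}" using finite_Union_pairs[OF fin E2] by simp
    then show False using Suc.prems(2,3) by (metis Union_upper card.empty ex_in_conv subset_empty zero_neq_numeral)
  qed
  ultimately have "clique_minor (Suc k) E'"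
    using E' Suc.prems(5,7) by (intro Suc.IH[of E' "2 * \<delta>"]) (simp_all add: algebra_simps)
  then show ?case using E'(7) by simp
qed

section \<open>Short cycles as vertex lists\<close>

fun path_edges :: "'a list \<Rightarrow> 'a set set" where
  "path_edges (x # y # xs) = insert {x, y} (path_edges (y # xs))"
| "path_edges xs = {}"

definition cycle_edges :: "'a list \<Rightarrow> 'a set set" where
  "cycle_edges xs = insert {last xs, hd xs} (path_edges xs)"

lemma path_edges_subset: "\<Union>(path_edges xs) \<subseteq> set xs"
  by (induction xs rule: path_edges.induct) auto

lemma finite_path_edges: "finite (path_edges xs)"
  by (induction xs rule: path_edges.induct) auto

lemma card_path_edges: "distinct xs \<Longrightarrow> card (path_edges xs) = length xs - 1"
proof (induction xs rule: path_edges.induct)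
  case (1 x y xs)
  have "{x, y} \<notin> path_edges (y # xs)"
  proof
    assume "{x, y} \<in> path_edges (y # xs)"
    then have "x \<in> \<Union>(path_edges (y # xs))" by auto
    then have "x \<in> set (y # xs)" using path_edges_subset[of "y # xs"] by (rule subsetD[rotated])
    with 1(2) show False by simp
  qed
  then show ?case using 1 finite_path_edges[of "y # xs"] by simp
qed auto

lemma card_cycle_edges:
  assumes "distinct xs" "3 \<le> length xs"
  shows "card (cycle_edges xs) = length xs"
proof -
  obtain x y z zs where xs: "xs = x # y # z # zs"
    using assms(2) by (metis One_nat_def Suc_1 Suc_le_length_iff numeral_3_eq_3)
  have "{last xs, x} \<notin> path_edges xs"
  proof
    assume "{last xs, x} \<in> path_edges xs"
    moreover have "last xs \<in> set (z # zs)" unfolding xs by simp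
    then have "last xs \<noteq> y" using assms(1) xs by auto
    ultimately have "{last xs, x} \<in> path_edges (y # z # zs)" using xs assms(1) by (auto simp: doubleton_eq_iff)
    then have "x \<in> \<Union>(path_edges (y # z # zs))" by auto
    then have "x \<in> set (y # z # zs)" using path_edges_subset[of "y # z # zs"] by (rule subsetD[rotated])
    with assms(1) xs show False by simp
  qed
  then show ?thesis using card_path_edges[OF assms(1)] finite_path_edges[of xs] assms(2)
    by (simp add: cycle_edges_def xs)
qed

lemma path_edges_suffix: "path_edges ys \<subseteq> path_edges (xs @ ys)"
proof (induction xs)
  case (Cons x xs)
  have "path_edges (xs @ ys) \<subseteq> path_edges (x # xs @ ys)" by (cases "xs @ ys") auto
  with Cons show ?case by simp
qed simp

lemma walk_path:
  assumes "walk A d x y"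
  shows "\<exists>xs. xs \<noteq> [] \<and> hd xs = x \<and> last xs = y \<and> distinct xs \<and> length xs \<le> Suc d \<and> path_edges xs \<subseteq> A"
  using assms
proof (induction d arbitrary: x)
  case 0
  then show ?case by (intro exI[of _ "[x]"]) simp
next
  case (Suc d)
  show ?case
  proof (cases "x = y")
    case True
    then show ?thesis by (intro exI[of _ "[x]"]) simp
  next
    case False
    then obtain z where z: "{x, z} \<in> A" "walk A d z y" using Suc.prems by auto
    obtain xs where xs: "xs \<noteq> []" "hd xs = z" "last xs = y" "distinct xs" "length xs \<le> Suc d" "path_edges xs \<subseteq> A"
      using Suc.IH[OF z(2)] by (elim exE conjE)
    show ?thesis
    proof (cases "x \<in> set xs")
      case True
      \<comment> \<open>If the walk returns to \<open>x\<close>, the detour is cut off by keeping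
        only the suffix from that occurrence on.\<close>
      then obtain as bs where split: "xs = as @ x # bs" by (meson split_list)
      have "path_edges (x # bs) \<subseteq> A" using path_edges_suffix[of "x # bs" as] xs(6) split by simp
      then show ?thesis using xs split by (intro exI[of _ "x # bs"]) simp
    next
      case False
      have "path_edges (x # xs) \<subseteq> A" using xs(1,2,6) z(1) by (cases xs) auto
      then show ?thesis using xs False by (intro exI[of _ "x # xs"]) simp
    qed
  qed
qed

text \<open>A path of length at most \<open>g\<close> and its closing edge form a cycle with at most
  \<open>Suc g\<close> vertices. A cycle is listed once for each starting point and direction; this
  overcount only affects constants.\<close>

definition short_cycles :: "nat \<Rightarrow> nat \<Rightarrow> nat list set" where
  "short_cycles n g = {xs. set xs \<subseteq> {..<n} \<and> distinct xs \<and> 3 \<le> length xs \<and> length xs \<le> Suc g}"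

lemma finite_short_cycles: "finite (short_cycles n g)"
  by (rule finite_subset[OF _ finite_lists_length_le[of "{..<n}" "Suc g"]]) (auto simp: short_cycles_def)

lemma no_short_cycleI:
  assumes E: "E \<subseteq> complete_edges n" and none: "\<And>xs. xs \<in> short_cycles n g \<Longrightarrow> \<not> cycle_edges xs \<subseteq> E"
  shows "no_short_cycle g E"
  unfolding no_short_cycle_def
proof (intro allI impI notI)
  fix x y assume xy: "{x, y} \<in> E" and "walk (E - {{x, y}}) g x y"
  from walk_path[OF this(2)] obtain xs where xs: "xs \<noteq> []" "hd xs = x" "last xs = y" "distinct xs" "length xs \<le> Suc g"
    "path_edges xs \<subseteq> E - {{x, y}}" by (elim exE conjE)
  have xyn: "x \<noteq> y" "x < n" "y < n" using subsetD[OF E xy] by auto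
  have "length xs \<noteq> 1" using xs xyn by (auto simp: length_Suc_conv)
  moreover have "length xs \<noteq> 2"
  proof
    assume "length xs = 2"
    then obtain a b where "xs = [a, b]" by (auto simp: numeral_2_eq_2 length_Suc_conv)
    then show False using xs by auto
  qed
  moreover have "length xs \<noteq> 0" using xs(1) by simp
  ultimately have len: "3 \<le> length xs" by linarith
  have pE: "path_edges xs \<subseteq> complete_edges n" using xs(6) E by auto
  have "set xs \<subseteq> {..<n}"
  proof -
    have "set zs \<subseteq> insert (hd zs) (\<Union>(path_edges zs))" if "zs \<noteq> []" for zs :: "nat list"
      using that by (induction zs rule: path_edges.induct) auto
    then have "set xs \<subseteq> insert x (\<Union>(path_edges xs))" using xs(1,2) by auto
    also have "\<dots> \<subseteq> {..<n}" using xyn Union_nsets_subset[OF pE] by simp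
    finally show ?thesis .
  qed
  then have "xs \<in> short_cycles n g" using xs(4,5) len by (simp add: short_cycles_def)
  moreover have "cycle_edges xs \<subseteq> E" using xs(2,3,6) xy by (auto simp: cycle_edges_def insert_commute)
  ultimately show False using none by simp
qed

text \<open>The closing edge of every short cycle is deleted. The hypothesis \<open>big\<close> pays
  for these deletions in advance, so \<open>(1 + \<delta>) * n\<close> edges remain.\<close>

lemma few_short_cycles_clique_minor:
  assumes M: "M \<subseteq> complete_edges n" and n: "n > 0" and \<delta>: "\<delta> > 0" "2 ^ k \<le> 1 + 2 ^ s * \<delta>"
    and big: "(1 + \<delta>) * real n + real (card {xs \<in> short_cycles n (girth_bound s). cycle_edges xs \<subseteq> M}) \<le> real (card M)"
  shows "clique_minor (Suc k) M"
proof -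
  let ?R = "{xs \<in> short_cycles n (girth_bound s). cycle_edges xs \<subseteq> M}"
  let ?D = "(\<lambda>xs. {last xs, hd xs}) ` ?R"
  define E where "E = M - ?D"
  have finM: "finite M" using M finite_imp_finite_nsets[of "{..<n}" 2] by (auto intro: finite_subset)
  have finR: "finite ?R" using finite_short_cycles by simp
  have EM: "E \<subseteq> M" by (auto simp: E_def)
  have fin: "finite E" using EM finM by (rule finite_subset)
  have En: "E \<subseteq> complete_edges n" using EM M by (rule subset_trans)
  then have E2: "\<forall>e\<in>E. card e = 2" by (auto simp: nsets_def)
  have "card M \<le> card (E \<union> ?D)" using fin finR by (intro card_mono) (auto simp: E_def)
  also have "\<dots> \<le> card E + card ?D" by (rule card_Un_le)
  also have "card ?D \<le> card ?R" by (rule card_image_le[OF finR])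
  finally have "real (card M) \<le> real (card E) + real (card ?R)" by linarith
  then have dense: "(1 + \<delta>) * real n \<le> real (card E)" using big by linarith
  have "card (\<Union>E) \<le> n" using card_mono[OF _ Union_nsets_subset[OF En]] by simp
  then have "(1 + \<delta>) * real (card (\<Union>E)) \<le> (1 + \<delta>) * real n" using \<delta>(1) by (intro mult_left_mono) simp_all
  then have dense': "(1 + \<delta>) * real (card (\<Union>E)) \<le> real (card E)" using dense by linarith
  have "0 < (1 + \<delta>) * real n" using n \<delta>(1) by simp
  then have ne: "E \<noteq> {}" using dense by auto
  have "no_short_cycle (girth_bound s) E"
  proof (rule no_short_cycleI[OF En])
    fix xs assume xs: "xs \<in> short_cycles n (girth_bound s)"
    show "\<not> cycle_edges xs \<subseteq> E"
    proof
      assume sub: "cycle_edges xs \<subseteq> E"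
      then have "xs \<in> ?R" using xs EM by auto
      then have "{last xs, hd xs} \<in> ?D" by (rule imageI)
      moreover have "{last xs, hd xs} \<in> cycle_edges xs" by (simp add: cycle_edges_def)
      ultimately show False using sub unfolding E_def by auto
    qed
  qed
  then have "clique_minor (Suc k) E" by (rule clique_minor_girth[OF fin E2 ne _ \<delta>(1) dense' \<delta>(2)])
  then show ?thesis by (rule clique_minor_mono[OF EM])
qed

lemma clique_minor_has_minor:
  assumes H: "simple_graph V E" and M: "M \<subseteq> complete_edges n" and "clique_minor k M" "card V \<le> k"
  shows "has_minor {..<n} M V E"
proof -
  obtain S where S: "\<forall>i<k. S i \<noteq> {} \<and> S i \<subseteq> \<Union>M \<and> connected_in M (S i)"
    "\<forall>i<k. \<forall>j<k. i \<noteq> j \<longrightarrow> S i \<inter> S j = {}"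
    "\<forall>i<k. \<forall>j<k. i \<noteq> j \<longrightarrow> (\<exists>x\<in>S i. \<exists>y\<in>S j. {x, y} \<in> M)"
    using assms(3) unfolding clique_minor_def by (elim exE conjE)
  have V: "finite V" "E \<subseteq> nsets V 2" using H by (simp_all add: simple_graph_def)
  have "\<exists>f. inj_on f V \<and> f ` V \<subseteq> {..<k}" using V(1) assms(4) by (subst inj_on_iff_card_le) simp_all
  then obtain f where f: "inj_on f V" "f ` V \<subseteq> {..<k}" by (elim exE conjE)
  have fk: "f v < k" if "v \<in> V" for v using f(2) that by auto
  have ne: "f u \<noteq> f v" if "u \<in> V" "v \<in> V" "u \<noteq> v" for u v using inj_onD[OF f(1)] that by metis
  have Mn: "\<Union>M \<subseteq> {..<n}" by (rule Union_nsets_subset[OF M])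
  show ?thesis unfolding has_minor_def
  proof (intro exI[of _ "\<lambda>v. S (f v)"] conjI ballI allI impI)
    show "disjoint_family_on (\<lambda>v. S (f v)) V" unfolding disjoint_family_on_def
    proof (intro ballI impI)
      fix u v assume "u \<in> V" "v \<in> V" "u \<noteq> v"
      then show "S (f u) \<inter> S (f v) = {}" using S(2) fk ne by simp
    qed
  next
    fix v assume v: "v \<in> V"
    show "S (f v) \<noteq> {}" "connected_in M (S (f v))" using S(1) fk[OF v] by simp_all
    have "S (f v) \<subseteq> \<Union>M" using S(1) fk[OF v] by simp
    then show "S (f v) \<subseteq> {..<n}" using Mn by (rule subset_trans)
  next
    fix v w assume "{v, w} \<in> E"
    then have "{v, w} \<in> nsets V 2" by (rule subsetD[OF V(2)])
    then have "v \<in> V" "w \<in> V" "v \<noteq> w" by auto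
    then show "\<exists>x\<in>S (f v). \<exists>y\<in>S (f w). {x, y} \<in> M" using S(3) fk ne by simp
  qed
qed

section \<open>RandomMaker builds a minor\<close>

lemma finite_complete_edges: "finite (complete_edges n)"
  by (simp add: finite_imp_finite_nsets)

lemma card_complete_edges: "real (card (complete_edges n)) = real n * (real n - 1) / 2"
proof -
  have "card (complete_edges n) = n choose 2"
    using n_subsets[of "{..<n}" 2] by (simp add: nsets_def finite_subset cong: conj_cong)
  moreover have "real (n choose 2) = real n * (real n - 1) / 2"
    by (cases n) (simp_all add: choose_two field_simps of_nat_diff real_of_nat_div)
  ultimately show ?thesis by simp
qed

text \<open>Splits a random play into its two tasks: a graph that is not \<open>bad\<close> after
  \<open>k\<close> rounds must already win, and \<open>bad\<close> must be unlikely uniformly over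
  all Breaker strategies.\<close>

lemma random_clever_prob_ge_prefix:
  assumes X: "finite X" and mono: "\<And>A B. A \<subseteq> B \<Longrightarrow> P A \<Longrightarrow> P B" and k: "k \<le> card X"
    and win: "\<And>t h. t \<in> breaker_strategies X b \<Longrightarrow> h \<in> set_pmf (play X (random_maker X) t k) \<Longrightarrow>
       \<not> bad (maker_set h) \<Longrightarrow> P (maker_set h)"
    and bad: "\<And>t. t \<in> breaker_strategies X b \<Longrightarrow>
       measure_pmf.prob (play X (random_maker X) t k) {h. bad (maker_set h)} \<le> c"
  shows "1 - c \<le> random_clever_prob X b P"
proof (rule random_clever_prob_ge)
  fix t assume t: "t \<in> breaker_strategies X b"
  let ?p = "play X (random_maker X) t k"
  have "1 - measure_pmf.prob ?p {h. bad (maker_set h)} = measure_pmf.prob ?p (- {h. bad (maker_set h)})"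
    using measure_pmf.prob_compl[of "{h. bad (maker_set h)}" ?p] by (simp add: Compl_eq_Diff_UNIV)
  also have "\<dots> \<le> measure_pmf.prob ?p {h. P (maker_set h)}"
    using win[OF t] by (intro measure_pmf.finite_measure_mono_AE) (auto simp: AE_measure_pmf_iff)
  also have "\<dots> \<le> win_prob X P (random_maker X) t" by (rule win_prob_ge_prefix[OF X mono k])
  finally show "1 - c \<le> win_prob X P (random_maker X) t" using bad[OF t] by linarith
qed

lemma rounds_le_board:
  assumes "real ((k - 1) * (b + 1)) + D \<le> real (card X)" "D > 0"
  shows "k \<le> card X" "(k - 1) * (b + 1) < card X"
proof -
  have "real ((k - 1) * (b + 1)) < real (card X)" using assms by linarith
  then show less: "(k - 1) * (b + 1) < card X" by (simp only: of_nat_less_iff)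
  have "(k - 1) * 1 \<le> (k - 1) * (b + 1)" by (rule mult_left_mono) simp_all
  then show "k \<le> card X" using less by linarith
qed

lemma sum_short_cycles_le:
  assumes "x \<ge> (0::real)"
  shows "(\<Sum>xs\<in>short_cycles n g. x ^ length xs) \<le> (\<Sum>l\<le>Suc g. (real n * x) ^ l)"
proof -
  have "(\<Sum>xs\<in>short_cycles n g. x ^ length xs) =
      (\<Sum>l\<le>Suc g. \<Sum>xs\<in>{xs \<in> short_cycles n g. length xs = l}. x ^ length xs)"
    by (rule sum.group[symmetric]) (auto simp: finite_short_cycles, simp add: short_cycles_def)
  also have "\<dots> \<le> (\<Sum>l\<le>Suc g. (real n * x) ^ l)"
  proof (rule sum_mono)
    fix l
    let ?L = "{xs :: nat list. set xs \<subseteq> {..<n} \<and> length xs = l}"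
    have "(\<Sum>xs\<in>{xs \<in> short_cycles n g. length xs = l}. x ^ length xs) \<le> (\<Sum>xs\<in>?L. x ^ length xs)"
      using assms finite_lists_length_eq[of "{..<n}" l]
      by (intro sum_mono2) (auto simp: short_cycles_def)
    also have "\<dots> = real (card ?L) * x ^ l" by simp
    also have "card ?L = n ^ l" using card_lists_length_eq[of "{..<n}" l] by simp
    finally show "(\<Sum>xs\<in>{xs \<in> short_cycles n g. length xs = l}. x ^ length xs) \<le> (real n * x) ^ l"
      by (simp add: power_mult_distrib)
  qed
  finally show ?thesis .
qed

text \<open>\<open>(1 + \<epsilon> / 2) * (1 - \<epsilon>) < 1\<close> leaves a constant fraction of
  the board free during \<open>(1 + \<epsilon> / 2) * n\<close> rounds. The first moment then gives
  fewer than \<open>\<epsilon> / 4 * n\<close> short cycles except with probability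
  \<open>C / n\<close>, and the other half of the excess remains as \<delta>.\<close>

lemma random_maker_minor:
  fixes V :: "'a set"
  assumes H: "simple_graph V E" and \<epsilon>: "0 < \<epsilon>" "\<epsilon> < 1"
  shows "\<exists>C. \<forall>\<^sub>F n in sequentially. \<forall>b. real b \<le> (1 - \<epsilon>) * (real n / 2) + 1 \<longrightarrow>
    1 - C / real n \<le> minor_game_random_clever V E n b"
proof -
  define \<delta> where "\<delta> = \<epsilon> / 4"
  have \<delta>: "\<delta> > 0" using \<epsilon> by (simp add: \<delta>_def)
  define k where "k = card V"
  obtain s where "2 ^ k / \<delta> < (2::real) ^ s" using real_arch_pow[of 2 "2 ^ k / \<delta>"] by auto
  then have s: "2 ^ k \<le> 1 + 2 ^ s * \<delta>" using \<delta> by (simp add: field_simps)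
  define g where "g = girth_bound s"
  \<comment> \<open>With \<open>m \<le> 2 * n\<close> and \<open>D = \<epsilon> / 8 * n^2\<close>
    one gets \<open>n * m / D \<le> 16 / \<epsilon>\<close>, whose power \<open>l\<close> bounds the
    expected number of cycles of length \<open>l\<close>.\<close>
  define C0 where "C0 = (\<Sum>l\<le>Suc g. (16 / \<epsilon>) ^ l)"
  define C where "C = C0 / (\<epsilon> / 4)"
  have "\<forall>\<^sub>F n in sequentially. ((1 + \<epsilon> / 2) * real n) * ((1 - \<epsilon>) * (real n / 2) + 2) + \<epsilon> / 8 * (real n)\<^sup>2
      \<le> real n * (real n - 1) / 2"
  proof -
    have pos: "\<epsilon> * \<epsilon> / 4 + \<epsilon> / 8 > 0" using \<epsilon> by (simp add: add_pos_pos)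
    have "\<forall>\<^sub>F n in sequentially. 0 \<le> (\<epsilon> * \<epsilon> / 4 + \<epsilon> / 8) * (real n)\<^sup>2 - (5 / 2 + \<epsilon>) * real n"
      using pos by real_asymp
    then show ?thesis by eventually_elim (simp add: field_simps power2_eq_square)
  qed
  moreover have "\<forall>\<^sub>F n in sequentially. n \<ge> 4" by (rule eventually_ge_at_top)
  ultimately have "\<forall>\<^sub>F n in sequentially. \<forall>b. real b \<le> (1 - \<epsilon>) * (real n / 2) + 1 \<longrightarrow>
    1 - C / real n \<le> minor_game_random_clever V E n b"
  proof eventually_elim
    case (elim n)
    let ?X = "complete_edges n"
    define m where "m = nat \<lceil>(1 + \<epsilon> / 2) * real n\<rceil>"
    define D where "D = \<epsilon> / 8 * (real n)\<^sup>2"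
    have n: "n > 0" "real n \<ge> 4" using elim(2) by simp_all
    have D: "D > 0" using n \<epsilon> by (simp add: D_def)
    have "0 \<le> (1 + \<epsilon> / 2) * real n" using \<epsilon> by simp
    then have m: "(1 + \<epsilon> / 2) * real n \<le> real m" "real m < (1 + \<epsilon> / 2) * real n + 1"
      unfolding m_def by linarith+
    have "1 * 1 \<le> (1 + \<epsilon> / 2) * real n" using \<epsilon> n by (intro mult_mono) simp_all
    then have m1: "m \<ge> 1" using m(1) by linarith
    have "\<epsilon> / 2 * real n \<le> 1 / 2 * real n" using \<epsilon> by (intro mult_right_mono) simp_all
    moreover have "(1 + \<epsilon> / 2) * real n = real n + \<epsilon> / 2 * real n" by (simp add: algebra_simps)
    ultimately have m2: "real m \<le> 2 * real n" using m(2) n by linarith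
    show ?case
    proof (intro allI impI)
      fix b assume b: "real b \<le> (1 - \<epsilon>) * (real n / 2) + 1"
      have "real ((m - 1) * (b + 1)) = (real m - 1) * (real b + 1)"
        using m1 by (simp only: of_nat_mult of_nat_add of_nat_1 of_nat_diff)
      also have "\<dots> \<le> ((1 + \<epsilon> / 2) * real n) * ((1 - \<epsilon>) * (real n / 2) + 2)"
        using m b m1 \<epsilon> by (intro mult_mono) auto
      finally have rounds: "real ((m - 1) * (b + 1)) + D \<le> real (card ?X)"
        using elim(1) unfolding card_complete_edges D_def by linarith
      let ?bad = "\<lambda>M. \<epsilon> / 4 * real n \<le> real (card {xs \<in> short_cycles n g. cycle_edges xs \<subseteq> M})"
      have "1 - C / real n \<le> random_clever_prob ?X b (\<lambda>M. has_minor {..<n} M V E)"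
      proof (rule random_clever_prob_ge_prefix[where k = m and bad = ?bad])
        show "finite ?X" by (rule finite_complete_edges)
        show "m \<le> card ?X" by (rule rounds_le_board(1)[OF rounds D])
        fix t h assume t: "t \<in> breaker_strategies ?X b" and h: "h \<in> set_pmf (play ?X (random_maker ?X) t m)"
          and good: "\<not> ?bad (maker_set h)"
        have legal: "legal_maker ?X (random_maker ?X)" by (rule legal_random_maker[OF finite_complete_edges])
        have M: "maker_set h \<subseteq> ?X" by (rule play_maker_set_subset[OF legal h])
        have "card (maker_set h) = m"
          by (rule card_maker_set_play[OF finite_complete_edges legal t h rounds_le_board(2)[OF rounds D]])
        then have "(1 + \<delta>) * real n + real (card {xs \<in> short_cycles n g. cycle_edges xs \<subseteq> maker_set h})
            \<le> real (card (maker_set h))" using m(1) good by (simp add: \<delta>_def algebra_simps)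
        then have "clique_minor (Suc k) (maker_set h)"
          unfolding g_def by (rule few_short_cycles_clique_minor[OF M n(1) \<delta> s])
        then show "has_minor {..<n} (maker_set h) V E"
          by (rule clique_minor_has_minor[OF H M]) (simp add: k_def)
      next
        fix t assume t: "t \<in> breaker_strategies ?X b"
        let ?p = "play ?X (random_maker ?X) t m"
        have "measure_pmf.prob ?p {h. ?bad (maker_set h)} \<le> (\<Sum>xs\<in>short_cycles n g. (real m / D) ^ length xs) / (\<epsilon> / 4 * real n)"
        proof (rule markov_count[OF finite_short_cycles])
          show "0 < \<epsilon> / 4 * real n" using \<epsilon> n by simp
          fix xs assume xs: "xs \<in> short_cycles n g"
          then have c: "card (cycle_edges xs) = length xs" by (intro card_cycle_edges) (auto simp: short_cycles_def)
          have "finite (cycle_edges xs)" by (simp add: cycle_edges_def finite_path_edges)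
          from prob_maker_set_superset[OF finite_complete_edges t D rounds this]
          show "measure_pmf.prob ?p {h. cycle_edges xs \<subseteq> maker_set h} \<le> (real m / D) ^ length xs"
            by (simp only: c)
        qed
        also have "\<dots> \<le> C0 / (\<epsilon> / 4 * real n)"
        proof (rule divide_right_mono)
          have "(\<Sum>xs\<in>short_cycles n g. (real m / D) ^ length xs) \<le> (\<Sum>l\<le>Suc g. (real n * (real m / D)) ^ l)"
            by (rule sum_short_cycles_le) (use D in simp)
          also have "\<dots> \<le> C0"
            unfolding C0_def
          proof (intro sum_mono power_mono)
            have "real n * real m \<le> real n * (2 * real n)" using m2 by (intro mult_left_mono) simp_all
            also have "\<dots> = 16 / \<epsilon> * D" using \<epsilon> by (simp add: D_def power2_eq_square)
            finally show "real n * (real m / D) \<le> 16 / \<epsilon>" using D by (simp add: field_simps)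
          qed (use D in simp)
          finally show "(\<Sum>xs\<in>short_cycles n g. (real m / D) ^ length xs) \<le> C0" .
        qed (use \<epsilon> in simp)
        also have "\<dots> = C / real n" by (simp add: C_def)
        finally show "measure_pmf.prob ?p {h. ?bad (maker_set h)} \<le> C / real n" .
      qed (rule has_minor_mono)
      then show "1 - C / real n \<le> minor_game_random_clever V E n b" by (simp add: minor_game_random_clever_def)
    qed
  qed
  then show ?thesis by (rule exI)
qed

section \<open>Counting paths with two edges; RandomMaker builds a matching\<close>

definition cherries_in :: "nat \<Rightarrow> nat set set \<Rightarrow> (nat \<times> nat \<times> nat) set" where
  "cherries_in n M = {p \<in> {..<n} \<times> {..<n} \<times> {..<n}. is_cherry M p}"

lemma cherries_in_eq:
  "cherries_in n M = {p \<in> {(x, c, y) \<in> {..<n} \<times> {..<n} \<times> {..<n}. x \<noteq> c \<and> c \<noteq> y \<and> x \<noteq> y}.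
     {{fst p, fst (snd p)}, {fst (snd p), snd (snd p)}} \<subseteq> M}"
  by (auto simp: cherries_in_def)

text \<open>First moment: at most \<open>n ^ 3\<close> ordered triples, each requiring two given
  edges.\<close>

lemma prob_many_cherries:
  assumes t: "t \<in> breaker_strategies (complete_edges n) b" and D: "D > 0" and s: "s > 0"
    and rounds: "real ((k - 1) * (b + 1)) + D \<le> real (card (complete_edges n))"
  shows "measure_pmf.prob (play (complete_edges n) (random_maker (complete_edges n)) t k)
     {h. s \<le> real (card (cherries_in n (maker_set h)))} \<le> real n ^ 3 * (real k / D)\<^sup>2 / s"
proof -
  let ?I = "{(x, c, y) \<in> {..<n} \<times> {..<n} \<times> {..<n}. x \<noteq> c \<and> c \<noteq> y \<and> x \<noteq> y}"
  let ?A = "\<lambda>p :: nat \<times> nat \<times> nat. {{fst p, fst (snd p)}, {fst (snd p), snd (snd p)}}"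
  let ?p = "play (complete_edges n) (random_maker (complete_edges n)) t k"
  have finI: "finite ?I" by (rule finite_subset[of _ "{..<n} \<times> {..<n} \<times> {..<n}"]) auto
  have "card ?I \<le> card ({..<n} \<times> {..<n} \<times> {..<n})" by (intro card_mono) auto
  then have cI: "real (card ?I) \<le> real n ^ 3"
    by (simp add: card_cartesian_product power3_eq_cube flip: of_nat_mult of_nat_power)
  have "measure_pmf.prob ?p {h. s \<le> real (card {p \<in> ?I. ?A p \<subseteq> maker_set h})} \<le> (\<Sum>p\<in>?I. (real k / D)\<^sup>2) / s"
  proof (rule markov_count[OF finI s])
    fix p assume "p \<in> ?I"
    then have "card (?A p) = 2" by (auto simp: doubleton_eq_iff card_insert_if)
    then show "measure_pmf.prob ?p {h. ?A p \<subseteq> maker_set h} \<le> (real k / D)\<^sup>2"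
      using prob_maker_set_superset[OF finite_complete_edges t D rounds, of "?A p"] by simp
  qed
  also have "\<dots> = real (card ?I) * (real k / D)\<^sup>2 / s" by simp
  also have "\<dots> \<le> real n ^ 3 * (real k / D)\<^sup>2 / s"
    using cI s by (intro divide_right_mono mult_right_mono) simp_all
  finally show ?thesis by (simp only: cherries_in_eq)
qed

lemma finite_cherries_in: "finite (cherries_in n M)"
  by (rule finite_subset[of _ "{..<n} \<times> {..<n} \<times> {..<n}"]) (auto simp: cherries_in_def)

lemma meeting_edges_cherry:
  assumes M: "M \<subseteq> complete_edges n" and ef: "e \<in> M" "f \<in> M" "e \<noteq> f" "e \<inter> f \<noteq> {}"
  obtains x c y where "(x, c, y) \<in> cherries_in n M" "e = {x, c}"
proof -
  obtain c where c: "c \<in> e" "c \<in> f" using ef(4) by auto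
  obtain a b where ab: "e = {a, b}" "a \<noteq> b" "a < n" "b < n" using subsetD[OF M ef(1)] by (auto elim: nsets_2D)
  obtain a' b' where ab': "f = {a', b'}" "a' \<noteq> b'" "a' < n" "b' < n"
    using subsetD[OF M ef(2)] by (auto elim: nsets_2D)
  obtain x where x: "e = {x, c}" "x \<noteq> c" "x < n" using ab c(1) by (auto simp: insert_commute)
  obtain y where y: "f = {c, y}" "y \<noteq> c" "y < n" using ab' c(2) by (auto simp: insert_commute)
  have "c < n" using ab c(1) by auto
  moreover have "x \<noteq> y" using ef(3) x y by (auto simp: insert_commute)
  ultimately have "(x, c, y) \<in> cherries_in n M" using x y ef by (auto simp: cherries_in_def)
  then show thesis using x(1) by (rule that)
qed

lemma no_cherries_disjoint:
  assumes "M \<subseteq> complete_edges n" and "cherries_in n M = {}"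
  shows "disjoint M"
proof (rule pairwiseI)
  fix e f assume ef: "e \<in> M" "f \<in> M" "e \<noteq> f"
  show "disjnt e f"
  proof (rule ccontr)
    assume "\<not> disjnt e f"
    then have "e \<inter> f \<noteq> {}" by (simp add: disjnt_def)
    from meeting_edges_cherry[OF assms(1) ef this] show False using assms(2) by auto
  qed
qed

lemma matching_has_minor:
  assumes H: "simple_graph V E" and "disjoint E" and M: "M \<subseteq> complete_edges n" "disjoint M" "card E \<le> card M"
    and n: "card V \<le> n"
  shows "has_minor {..<n} M V E"
proof -
  have E: "E \<subseteq> nsets V 2" using H by (simp add: simple_graph_def)
  have finM: "finite M" using M(1) finite_complete_edges by (rule finite_subset)
  obtain \<phi> where \<phi>: "inj_on \<phi> (\<Union>E)" "\<phi> ` \<Union>E \<subseteq> \<Union>M" "\<forall>e\<in>E. \<phi> ` e \<in> M"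
    using embed_matching[OF finite_simple_graph[OF H] E assms(2) finM M(1,2,3)] by (elim exE conjE)
  have "\<phi> ` \<Union>E \<subseteq> {..<n}" using \<phi>(2) Union_nsets_subset[OF M(1)] by (rule subset_trans)
  then show ?thesis using \<phi>(3) by (intro has_minor_embedding[OF H \<phi>(1) _ _ n]) simp_all
qed

text \<open>At such a bias only \<open>k\<close> rounds are needed, a constant number, with order
  \<open>n^2\<close> edges free throughout. Two of Maker's edges meet with probability of order
  \<open>n ^ 3 * (k / n^2)^2 = k^2 / n\<close>, so they almost surely form the required
  matching.\<close>

lemma random_maker_matching:
  assumes H: "simple_graph V E" and disj: "disjoint E" and k: "k = card E" "k \<ge> 2" and \<epsilon>: "0 < \<epsilon>" "\<epsilon> < 1"
  shows "\<exists>C. \<forall>\<^sub>F n in sequentially. \<forall>b. real b \<le> (1 - \<epsilon>) * ((real n)\<^sup>2 / (2 * real k - 2)) + 1 \<longrightarrow>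
    1 - C / real n \<le> minor_game_random_clever V E n b"
proof -
  have k1: "1 \<le> k" using k(2) by simp
  define C where "C = 16 * (real k)\<^sup>2 / \<epsilon>\<^sup>2"
  have "\<forall>\<^sub>F n in sequentially. 0 \<le> \<epsilon> / 4 * (real n)\<^sup>2 - real n / 2 - 2 * (real k - 1)"
    using \<epsilon> by real_asymp
  moreover have "\<forall>\<^sub>F n in sequentially. n \<ge> max 1 (card V)" by (rule eventually_ge_at_top)
  ultimately have "\<forall>\<^sub>F n in sequentially. \<forall>b. real b \<le> (1 - \<epsilon>) * ((real n)\<^sup>2 / (2 * real k - 2)) + 1 \<longrightarrow>
    1 - C / real n \<le> minor_game_random_clever V E n b"
  proof eventually_elim
    case (elim n)
    let ?X = "complete_edges n"
    define D where "D = \<epsilon> / 4 * (real n)\<^sup>2"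
    have n: "n > 0" "card V \<le> n" using elim(2) by simp_all
    have D: "D > 0" using n \<epsilon> by (simp add: D_def)
    show ?case
    proof (intro allI impI)
      fix b assume b: "real b \<le> (1 - \<epsilon>) * ((real n)\<^sup>2 / (2 * real k - 2)) + 1"
      have "real ((k - 1) * (b + 1)) = (real k - 1) * (real b + 1)"
        using k1 by (simp only: of_nat_mult of_nat_add of_nat_1 of_nat_diff)
      also have "\<dots> \<le> (real k - 1) * ((1 - \<epsilon>) * ((real n)\<^sup>2 / (2 * real k - 2)) + 2)"
        using b k(2) by (intro mult_left_mono) auto
      also have "\<dots> = (1 - \<epsilon>) * (real n)\<^sup>2 / 2 + 2 * (real k - 1)" using k(2) by (simp add: field_simps)
      finally have rounds: "real ((k - 1) * (b + 1)) + D \<le> real (card ?X)"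
        using elim(1) unfolding card_complete_edges D_def by (simp add: field_simps power2_eq_square)
      let ?bad = "\<lambda>M. 1 \<le> real (card (cherries_in n M))"
      have "1 - C / real n \<le> random_clever_prob ?X b (\<lambda>M. has_minor {..<n} M V E)"
      proof (rule random_clever_prob_ge_prefix[where k = k and bad = ?bad])
        show "finite ?X" by (rule finite_complete_edges)
        show "k \<le> card ?X" by (rule rounds_le_board(1)[OF rounds D])
        fix t h assume t: "t \<in> breaker_strategies ?X b" and h: "h \<in> set_pmf (play ?X (random_maker ?X) t k)"
          and good: "\<not> ?bad (maker_set h)"
        have legal: "legal_maker ?X (random_maker ?X)" by (rule legal_random_maker[OF finite_complete_edges])
        have M: "maker_set h \<subseteq> ?X" by (rule play_maker_set_subset[OF legal h])
        have "card (maker_set h) = k"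
          by (rule card_maker_set_play[OF finite_complete_edges legal t h rounds_le_board(2)[OF rounds D]])
        moreover have "cherries_in n (maker_set h) = {}" using good finite_cherries_in[of n "maker_set h"]
          by (simp add: card_gt_0_iff Suc_le_eq)
        ultimately show "has_minor {..<n} (maker_set h) V E"
          using k(1) n(2) by (intro matching_has_minor[OF H disj M no_cherries_disjoint[OF M]]) simp_all
      next
        fix t assume t: "t \<in> breaker_strategies ?X b"
        have "measure_pmf.prob (play ?X (random_maker ?X) t k) {h. ?bad (maker_set h)} \<le> real n ^ 3 * (real k / D)\<^sup>2 / 1"
          by (rule prob_many_cherries[OF t D _ rounds]) simp
        also have "\<dots> = C / real n" using n \<epsilon> by (simp add: C_def D_def field_simps power2_eq_square power3_eq_cube)
        finally show "measure_pmf.prob (play ?X (random_maker ?X) t k) {h. ?bad (maker_set h)} \<le> C / real n" .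
      qed (rule has_minor_mono)
      then show "1 - C / real n \<le> minor_game_random_clever V E n b" by (simp add: minor_game_random_clever_def)
    qed
  qed
  then show ?thesis by (rule exI)
qed

text \<open>Maker moves first, and any first edge wins regardless of the bias.\<close>

lemma random_maker_single_edge:
  assumes H: "simple_graph V E" and E: "card E = 1" and n: "card V \<le> n" "2 \<le> n"
  shows "minor_game_random_clever V E n b = 1"
proof -
  let ?X = "complete_edges n"
  have "{0, 1} \<in> ?X" using n by simp
  then have pos: "card ?X > 0" using finite_complete_edges card_gt_0_iff by blast
  have "1 - 0 \<le> random_clever_prob ?X b (\<lambda>M. has_minor {..<n} M V E)"
  proof (rule random_clever_prob_ge_prefix[where k = 1 and bad = "\<lambda>_. False"])
    show "finite ?X" by (rule finite_complete_edges)
    show "1 \<le> card ?X" using pos by linarith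
    fix t h assume t: "t \<in> breaker_strategies ?X b" and h: "h \<in> set_pmf (play ?X (random_maker ?X) t 1)"
    have legal: "legal_maker ?X (random_maker ?X)" by (rule legal_random_maker[OF finite_complete_edges])
    have M: "maker_set h \<subseteq> ?X" by (rule play_maker_set_subset[OF legal h])
    have cM: "card (maker_set h) = 1"
      by (rule card_maker_set_play[OF finite_complete_edges legal t h]) (use pos in simp)
    obtain e f where "E = {e}" "maker_set h = {f}" using E cM by (auto simp: card_1_singleton_iff)
    then show "has_minor {..<n} (maker_set h) V E" using M n(1) E cM
      by (intro matching_has_minor[OF H]) (simp_all add: pairwise_singleton)
  qed (use has_minor_mono in simp_all)
  then show ?thesis using random_clever_prob_le_1[of ?X b] unfolding minor_game_random_clever_def
    by (metis diff_zero order_antisym)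
qed

section \<open>RandomMaker builds disjoint paths with two edges\<close>

definition disjoint_cherries :: "nat \<Rightarrow> nat set set \<Rightarrow> bool" where
  "disjoint_cherries j M \<longleftrightarrow> (\<exists>P. finite P \<and> card P = j \<and> (\<forall>p\<in>P. is_cherry M p) \<and> disjoint_family_on cherry_verts P)"

text \<open>Capped at \<open>t\<close>, so that the potential
  \<open>(1 / 2) ^ cherry_level t M\<close> never falls below \<open>(1 / 2) ^ t\<close>.\<close>

definition cherry_level :: "nat \<Rightarrow> nat set set \<Rightarrow> nat" where
  "cherry_level t M = Max {j. j \<le> t \<and> disjoint_cherries j M}"

lemma is_cherry_mono: "M \<subseteq> M' \<Longrightarrow> is_cherry M p \<Longrightarrow> is_cherry M' p"
  by (cases p) auto

lemma disjoint_cherries_mono: "M \<subseteq> M' \<Longrightarrow> disjoint_cherries j M \<Longrightarrow> disjoint_cherries j M'"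
  unfolding disjoint_cherries_def using is_cherry_mono by metis

lemma disjoint_cherries_0: "disjoint_cherries 0 M"
  unfolding disjoint_cherries_def by (intro exI[of _ "{}"]) (simp add: disjoint_family_on_def)

lemma cherry_level:
  shows "cherry_level t M \<le> t" "disjoint_cherries (cherry_level t M) M"
proof -
  let ?S = "{j. j \<le> t \<and> disjoint_cherries j M}"
  have "finite ?S" by (rule finite_subset[of _ "{..t}"]) auto
  moreover have "?S \<noteq> {}" using disjoint_cherries_0 by (metis (mono_tags, lifting) empty_iff mem_Collect_eq zero_le)
  ultimately have "Max ?S \<in> ?S" by (rule Max_in)
  then show "cherry_level t M \<le> t" "disjoint_cherries (cherry_level t M) M" by (simp_all add: cherry_level_def)
qed

lemma cherry_level_ge: "j \<le> t \<Longrightarrow> disjoint_cherries j M \<Longrightarrow> j \<le> cherry_level t M"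
  unfolding cherry_level_def by (rule Max_ge) (auto intro: finite_subset[of _ "{..t}"])

lemma cherry_level_mono: "M \<subseteq> M' \<Longrightarrow> cherry_level t M \<le> cherry_level t M'"
  using cherry_level disjoint_cherries_mono by (intro cherry_level_ge) blast+

lemma card_cherries_in_mono: "M \<subseteq> M' \<Longrightarrow> card (cherries_in n M) \<le> card (cherries_in n M')"
  using is_cherry_mono[of M M'] by (intro card_mono finite_cherries_in) (auto simp: cherries_in_def simp del: is_cherry.simps)

text \<open>
  Joining an isolated Maker edge to a vertex outside a given family of disjoint cherries
  enlarges the family.
\<close>

lemma many_extending_edges:
  assumes M: "M \<subseteq> complete_edges n" and F: "F \<subseteq> complete_edges n" "M \<inter> F = {}"
    and P: "disjoint_cherries j M" "j \<le> t"
    and k: "card M = k" and s: "real (card (cherries_in n M)) \<le> s" "s \<le> real k" "2 * k + 3 * t \<le> n"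
  shows "2 * (real k - s) * (real n - 2 * real k - 3 * real t) - real (card (complete_edges n - F))
    \<le> real (card {g \<in> F. disjoint_cherries (Suc j) (insert g M)})"
proof -
  let ?X = "complete_edges n"
  obtain P where P: "finite P" "card P = j" "\<forall>p\<in>P. is_cherry M p" "disjoint_family_on cherry_verts P"
    using assms(4) unfolding disjoint_cherries_def by (elim exE conjE)
  have finM: "finite M" using M finite_complete_edges by (rule finite_subset)
  define W where "W = \<Union>(cherry_verts ` P)"
  have cv: "finite (cherry_verts p)" "card (cherry_verts p) \<le> 3" for p :: "nat \<times> nat \<times> nat"
    by (cases p, simp add: card_insert_if)+
  have finW: "finite W" unfolding W_def using P(1) cv by auto
  have "card W \<le> (\<Sum>p\<in>P. card (cherry_verts p))" unfolding W_def by (rule card_UN_le[OF P(1)])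
  also have "\<dots> \<le> (\<Sum>p\<in>P. 3)" using cv(2) by (intro sum_mono)
  finally have cW: "card W \<le> 3 * t" using P(2) assms(5) by simp
  \<comment> \<open>The isolated edges of Maker. Each other edge begins a cherry, so at most
    \<open>s\<close> edges are not isolated.\<close>
  define I where "I = {e \<in> M. \<forall>f\<in>M. f \<noteq> e \<longrightarrow> f \<inter> e = {}}"
  have IM: "I \<subseteq> M" by (auto simp: I_def)
  have finI: "finite I" using IM finM by (rule finite_subset)
  have "card (M - I) \<le> card (cherries_in n M)"
  proof -
    have "M - I \<subseteq> (\<lambda>p. {fst p, fst (snd p)}) ` cherries_in n M"
    proof
      fix e assume e: "e \<in> M - I"
      then obtain f where f: "f \<in> M" "f \<noteq> e" "f \<inter> e \<noteq> {}" by (auto simp: I_def)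
      have "e \<in> M" "e \<noteq> f" "e \<inter> f \<noteq> {}" using e f by (simp_all add: Int_commute)
      from meeting_edges_cherry[OF M this(1) f(1) this(2,3)]
      obtain x c y where "(x, c, y) \<in> cherries_in n M" "e = {x, c}" .
      then show "e \<in> (\<lambda>p. {fst p, fst (snd p)}) ` cherries_in n M" by (intro image_eqI[of _ _ "(x, c, y)"]) simp_all
    qed
    then show ?thesis by (rule surj_card_le[OF finite_cherries_in])
  qed
  moreover have "card (M - I) = k - card I" "card I \<le> k"
    using card_mono[OF finM IM] k IM finM finI by (simp_all add: card_Diff_subset)
  ultimately have cI: "real k - s \<le> real (card I)" using s(1) by linarith
  define U where "U = \<Union>I"
  have e2: "card e = 2" "finite e" if "e \<in> I" for e using IM M that by (auto simp: nsets_def)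
  have "card U = (\<Sum>e\<in>I. card e)"
    unfolding U_def
  proof (rule card_Union_disjoint)
    show "pairwise disjnt I" unfolding pairwise_def disjnt_def I_def by auto
  qed (rule e2(2))
  also have "\<dots> = 2 * card I" using e2(1) by simp
  finally have cU: "card U = 2 * card I" .
  have Un: "U \<subseteq> {..<n}" unfolding U_def using IM M by (intro Union_nsets_subset) (rule subset_trans)
  then have finU: "finite U" by (rule finite_subset) simp
  \<comment> \<open>An isolated edge is part of no cherry, so its ends are disjoint from the chosen
    family.\<close>
  have UW: "u \<notin> W" if u: "u \<in> U" for u
  proof
    assume "u \<in> W"
    then obtain p where p: "p \<in> P" "u \<in> cherry_verts p" unfolding W_def by auto
    obtain x c y where xcy: "p = (x, c, y)" by (cases p)
    have ch: "x \<noteq> c" "c \<noteq> y" "x \<noteq> y" "{x, c} \<in> M" "{c, y} \<in> M" using P(3) p(1) xcy by auto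
    obtain e where e: "e \<in> I" "u \<in> e" using u unfolding U_def by auto
    have iso: "f = e" if "f \<in> M" "f \<inter> e \<noteq> {}" for f using e(1) that unfolding I_def by auto
    have "u \<in> {x, c} \<or> u \<in> {c, y}" using p(2) xcy by auto
    then have "{x, c} = e \<or> {c, y} = e" using iso[OF ch(4)] iso[OF ch(5)] e(2) by auto
    then have "{x, c} = e \<and> {c, y} = e" using iso[OF ch(4)] iso[OF ch(5)] by auto
    then show False using ch by (auto simp: doubleton_eq_iff)
  qed
  \<comment> \<open>A vertex of \<open>?Y\<close> joined to either end of an isolated edge gives a
    new disjoint cherry. The two ends produce the factor 2 that competes with a bias of nearly
    \<open>2 * n\<close>.\<close>
  let ?Y = "{..<n} - (U \<union> W)"
  define Q where "Q = (\<lambda>(u, y). {u, y}) ` (U \<times> ?Y)"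
  have "inj_on (\<lambda>(u, y). {u, y}) (U \<times> ?Y)" by (auto simp: inj_on_def doubleton_eq_iff)
  then have cQ: "card Q = card U * card ?Y" unfolding Q_def by (simp add: card_image card_cartesian_product)
  have QX: "Q \<subseteq> ?X" unfolding Q_def using Un by auto
  have "card (U \<union> W) \<le> 2 * k + 3 * t" using card_Un_le[of U W] cW cU \<open>card I \<le> k\<close> by linarith
  then have cY: "real n - 2 * real k - 3 * real t \<le> real (card ?Y)"
    using diff_card_le_card_Diff[of "U \<union> W" "{..<n}"] finU finW by simp
  have "2 * (real k - s) * (real n - 2 * real k - 3 * real t) \<le> real (card U) * real (card ?Y)"
  proof (rule mult_mono)
    show "0 \<le> real n - 2 * real k - 3 * real t" using s(3) by linarith
  qed (use cI cU cY in auto)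
  also have "\<dots> = real (card Q)" by (simp add: cQ)
  also have "\<dots> \<le> real (card (Q \<inter> F)) + real (card (?X - F))"
  proof -
    have "card Q \<le> card ((Q \<inter> F) \<union> (?X - F))" using QX finite_complete_edges F(1)
      by (intro card_mono) (auto intro: finite_subset)
    also have "\<dots> \<le> card (Q \<inter> F) + card (?X - F)" by (rule card_Un_le)
    finally show ?thesis by linarith
  qed
  also have "card (Q \<inter> F) \<le> card {g \<in> F. disjoint_cherries (Suc j) (insert g M)}"
  proof (rule card_mono)
    show "finite {g \<in> F. disjoint_cherries (Suc j) (insert g M)}"
      using F(1) finite_complete_edges by (auto intro: finite_subset)
    show "Q \<inter> F \<subseteq> {g \<in> F. disjoint_cherries (Suc j) (insert g M)}"
    proof
      fix g assume g: "g \<in> Q \<inter> F"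
      then obtain u y where uy: "g = {u, y}" "u \<in> U" "y \<in> ?Y" unfolding Q_def by auto
      obtain e where e: "e \<in> I" "u \<in> e" using uy(2) unfolding U_def by auto
      obtain v where v: "e = {v, u}" "v \<noteq> u"
      proof -
        obtain a b where "e = {a, b}" "a \<noteq> b" using card_2_doubleton[OF e2(1)[OF e(1)]] by auto
        then show thesis using that e(2) by (auto simp: insert_commute)
      qed
      have vU: "v \<in> U" using e(1) v(1) unfolding U_def by auto
      have eM: "{v, u} \<in> M" using e(1) v(1) IM by auto
      let ?p = "(v, u, y)"
      have ch: "is_cherry (insert g M) ?p" using v(2) vU uy eM by auto
      have disj: "cherry_verts ?p \<inter> W = {}" using UW[OF vU] UW[OF uy(2)] uy(3) by auto
      have notin: "?p \<notin> P"
      proof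
        assume "?p \<in> P"
        then have "v \<in> W" unfolding W_def by (intro UN_I[of ?p]) simp_all
        then show False using UW[OF vU] by simp
      qed
      have "disjoint_family_on cherry_verts (insert ?p P)"
        using P(4) disj notin unfolding W_def by (subst disjoint_family_on_insert) auto
      moreover have "\<forall>p\<in>insert ?p P. is_cherry (insert g M) p"
        using P(3) ch is_cherry_mono[of M "insert g M"] by (auto simp del: is_cherry.simps)
      moreover have "card (insert ?p P) = Suc j" using notin P(1,2) by simp
      ultimately have "disjoint_cherries (Suc j) (insert g M)"
        unfolding disjoint_cherries_def using P(1) by (intro exI[of _ "insert ?p P"]) simp
      then show "g \<in> {g \<in> F. disjoint_cherries (Suc j) (insert g M)}" using g by simp
    qed
  qed
  finally show ?thesis by linarith
qed

lemma cherries_has_minor: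
  assumes H: "simple_graph V E" and "\<not> path3 E" and M: "M \<subseteq> complete_edges n" and "disjoint_cherries t M"
    and t: "card E \<le> t" and n: "card V \<le> n"
  shows "has_minor {..<n} M V E"
proof -
  have E: "E \<subseteq> nsets V 2" using H by (simp add: simple_graph_def)
  obtain P where P: "finite P" "card P = t" "\<forall>p\<in>P. is_cherry M p" "disjoint_family_on cherry_verts P"
    using assms(4) unfolding disjoint_cherries_def by (elim exE conjE)
  have ch: "is_cherry M p" if "p \<in> P" for p using P(3) that by simp
  have "\<exists>\<phi>. inj_on \<phi> (\<Union>E) \<and> \<phi> ` \<Union>E \<subseteq> \<Union>(cherry_verts ` P) \<and> (\<forall>e\<in>E. \<phi> ` e \<in> M)"
    by (rule embed_cherries[OF finite_simple_graph[OF H] E assms(2) P(1,4)]) (use ch t P(2) in simp_all)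
  then  obtain \<phi> where \<phi>: "inj_on \<phi> (\<Union>E)" "\<phi> ` \<Union>E \<subseteq> \<Union>(cherry_verts ` P)" "\<forall>e\<in>E. \<phi> ` e \<in> M"
    by (elim exE conjE)
  have "cherry_verts p \<subseteq> \<Union>M" if "p \<in> P" for p using ch[OF that] by (cases p) auto
  then have "\<Union>(cherry_verts ` P) \<subseteq> \<Union>M" by (intro UN_least)
  also have "\<dots> \<subseteq> {..<n}" by (rule Union_nsets_subset[OF M])
  finally have "\<phi> ` \<Union>E \<subseteq> {..<n}" using \<phi>(2) by (rule subset_trans[rotated])
  then show ?thesis using \<phi>(3) by (intro has_minor_embedding[OF H \<phi>(1) _ _ n]) simp_all
qed

text \<open>
  In rounds \<open>m\<close> to \<open>2 m\<close> RandomMaker raises the number of disjoint cherries with probability at least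
  \<open>2 \<epsilon> m / n\<close>, unless there are \<open>s\<close> cherries; hence \<open>(1/2)\<close> to the power of that number
  decays geometrically in expectation.
\<close>

lemma prob_few_disjoint_cherries:
  assumes t: "\<sigma> \<in> breaker_strategies (complete_edges n) b" and D: "D > 0"
    and rounds: "real ((2 * m - 1) * (b + 1)) + D \<le> real (card (complete_edges n))"
    and \<epsilon>: "0 < \<epsilon>" "\<epsilon> < 1" and b: "real b \<le> (1 - \<epsilon>) * (2 * real n) + 1" and s: "0 < s" "s \<le> real m"
    and m: "0 < m" "4 * m + 3 * t \<le> n" "2 * s * real n / real m + 8 * real m + 6 * real t + 2 \<le> \<epsilon> * real n"
  shows "measure_pmf.prob (play (complete_edges n) (random_maker (complete_edges n)) \<sigma> (2 * m))
     {h. real (card (cherries_in n (maker_set h))) < s \<and> cherry_level t (maker_set h) < t}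
     \<le> 2 ^ t * exp (- \<epsilon> * (real m)\<^sup>2 / real n)"
proof -
  let ?X = "complete_edges n"
  let ?play = "\<lambda>k. play ?X (random_maker ?X) \<sigma> k"
  \<comment> \<open>\<open>Q\<close> is the event to be bounded. Cherries and level only grow, so
    once \<open>Q\<close> fails it fails for good, and the potential \<open>f\<close> can be set to
    0.\<close>
  define Q where "Q M \<longleftrightarrow> real (card (cherries_in n M)) < s \<and> cherry_level t M < t" for M
  define f where "f h = (if Q (maker_set h) then (1 / 2) ^ cherry_level t (maker_set h) else (0 :: real))" for h :: "nat set history"
  \<comment> \<open>At least \<open>\<epsilon> * m * n\<close> of the at most \<open>n^2 / 2\<close>
    free edges raise the level, a fraction of \<open>2 * \<epsilon> * m / n\<close>; each of them at
    least halves \<open>f\<close>.\<close>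
  define a where "a = 1 - \<epsilon> * real m / real n"
  have n0: "n > 0" using m(1,2) by simp
  have mn: "real m \<le> real n" using m(2) by linarith
  have "\<epsilon> * real m \<le> 1 * real n" using mn \<epsilon> by (intro mult_mono) simp_all
  then have a0: "a \<ge> 0" using n0 by (simp add: a_def divide_le_eq)
  have legal: "legal_maker ?X (random_maker ?X)" by (rule legal_random_maker[OF finite_complete_edges])
  note fX = finite_complete_edges
  have facts: "maker_set h \<subseteq> ?X" "card (maker_set h) = k" "real (card (?X - free ?X h)) \<le> real k * (real b + 1)"
      "free ?X h \<noteq> {}" if h: "h \<in> set_pmf (?play k)" and k: "k < 2 * m" for h k
  proof -
    show "maker_set h \<subseteq> ?X" by (rule play_maker_set_subset[OF legal h])
    have "k * (b + 1) \<le> (2 * m - 1) * (b + 1)" using k by (intro mult_right_mono) auto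
    moreover have "(2 * m - 1) * (b + 1) < card ?X" by (rule rounds_le_board(2)[OF rounds D])
    ultimately have kb: "k * (b + 1) < card ?X" by linarith
    moreover have "(k - 1) * (b + 1) \<le> k * (b + 1)" by (intro mult_right_mono) auto
    ultimately have "(k - 1) * (b + 1) < card ?X" by linarith
    then show "card (maker_set h) = k" by (rule card_maker_set_play[OF fX legal t h])
    have "real (card (?X - free ?X h)) \<le> real (k * (b + 1))"
      using card_claimed_play[OF fX legal t h] by (rule of_nat_mono)
    then show "real (card (?X - free ?X h)) \<le> real k * (real b + 1)" by (simp add: algebra_simps)
    show "free ?X h \<noteq> {}" using card_free_play_ge[OF fX legal t h] kb by auto
  qed
  have step: "(\<Sum>e\<in>free ?X h. f (h @ [(e, \<sigma> h e)])) \<le> a * f h * real (card (free ?X h))"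
    if k: "m \<le> k" "k < 2 * m" and h: "h \<in> set_pmf (?play k)" for h k
  proof -
    let ?F = "free ?X h" and ?M = "maker_set h"
    have finF: "finite ?F" by (rule finite_free[OF fX])
    have FX: "?F \<subseteq> ?X" by (auto simp: free_def)
    show ?thesis
    proof (cases "Q ?M")
      case False
      have "\<not> Q (insert e ?M)" for e
      proof -
        have "?M \<subseteq> insert e ?M" by auto
        from card_cherries_in_mono[OF this, of n] cherry_level_mono[OF this, of t] False
        show ?thesis unfolding Q_def by linarith
      qed
      then have "(\<Sum>e\<in>?F. f (h @ [(e, \<sigma> h e)])) = 0" by (simp add: f_def)
      then show ?thesis using False by (simp add: f_def)
    next
      case True
      define j where "j = cherry_level t ?M"
      have j: "j < t" "disjoint_cherries j ?M" and sc: "real (card (cherries_in n ?M)) < s"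
        using True cherry_level[of t ?M] by (simp_all add: Q_def j_def)
      define G where "G = {g \<in> ?F. disjoint_cherries (Suc j) (insert g ?M)}"
      have fh: "f h = (1 / 2) ^ j" using True by (simp add: f_def j_def)
      have f1: "f (h @ [(e, \<sigma> h e)]) \<le> f h" for e
      proof (cases "Q (insert e ?M)")
        case True
        have "j \<le> cherry_level t (insert e ?M)" unfolding j_def by (rule cherry_level_mono) auto
        then show ?thesis using True fh by (simp add: f_def power_decreasing)
      qed (simp add: f_def fh)
      have f2: "f (h @ [(e, \<sigma> h e)]) \<le> f h / 2" if "e \<in> G" for e
      proof (cases "Q (insert e ?M)")
        case True
        have "Suc j \<le> cherry_level t (insert e ?M)" using that j(1) by (intro cherry_level_ge) (simp_all add: G_def)
        then have "(1 / 2 :: real) ^ cherry_level t (insert e ?M) \<le> (1 / 2) ^ Suc j" by (intro power_decreasing) simp_all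
        then show ?thesis using True fh by (simp add: f_def)
      qed (simp add: f_def fh)
      have GF: "G \<subseteq> ?F" by (auto simp: G_def)
      then have finG: "finite G" using finF by (rule finite_subset)
      have "(\<Sum>e\<in>?F. f (h @ [(e, \<sigma> h e)])) = (\<Sum>e\<in>?F - G. f (h @ [(e, \<sigma> h e)])) + (\<Sum>e\<in>G. f (h @ [(e, \<sigma> h e)]))"
        by (rule sum.subset_diff[OF GF finF])
      also have "\<dots> \<le> (\<Sum>e\<in>?F - G. f h) + (\<Sum>e\<in>G. f h / 2)" using f1 f2 by (intro add_mono sum_mono) simp_all
      also have "\<dots> = f h * (real (card ?F) - real (card G) / 2)"
        using GF finF finG card_mono[OF finF GF] by (simp add: card_Diff_subset of_nat_diff algebra_simps)
      also have "\<dots> \<le> f h * (a * real (card ?F))"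
      proof (rule mult_left_mono)
        note fk = facts[OF h k(2)]
        have MF: "?M \<inter> ?F = {}" by (auto simp: free_def)
        have sk: "s \<le> real k" using s(2) k(1) by linarith
        have kn: "2 * k + 3 * t \<le> n" using m(2) k(2) by linarith
        have "2 * (real k - s) * (real n - 2 * real k - 3 * real t) - real (card (?X - ?F)) \<le> real (card G)"
          unfolding G_def using sc j(1)
          by (intro many_extending_edges[OF fk(1) FX MF j(2) _ fk(2) _ sk kn]) simp_all
        moreover have "real k * (real b + 1) \<le> real k * ((1 - \<epsilon>) * (2 * real n) + 2)" using b by (intro mult_left_mono) simp_all
        \<comment> \<open>The leading terms differ by \<open>2 * \<epsilon> * k * n\<close>. The
          last condition in \<open>m\<close> bounds the remaining terms by half of this.\<close>
        ultimately have G1: "2 * (real k - s) * (real n - 2 * real k - 3 * real t) - real k * ((1 - \<epsilon>) * (2 * real n) + 2)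
            \<le> real (card G)" using fk(3) by linarith
        have "real k * (2 * s * real n / real m + 8 * real m + 6 * real t + 2) \<le> real k * (\<epsilon> * real n)"
          using m(3) by (intro mult_left_mono) simp_all
        moreover have "2 * s * real n \<le> real k * (2 * s * real n / real m)"
        proof -
          have "real m * (2 * s * real n / real m) \<le> real k * (2 * s * real n / real m)"
            using k(1) s by (intro mult_right_mono) simp_all
          then show ?thesis using m(1) by simp
        qed
        moreover have "real k * (4 * real k) \<le> real k * (8 * real m)" using k(2) by (intro mult_left_mono) simp_all
        ultimately have "2 * s * real n + real k * (4 * real k) + 6 * real t * real k + 2 * real k \<le> real k * (\<epsilon> * real n)"
          by (simp add: algebra_simps)
        moreover have "0 \<le> 4 * real k * s + 6 * real t * s" using s by simp
        ultimately have "\<epsilon> * real k * real n \<le>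
            2 * (real k - s) * (real n - 2 * real k - 3 * real t) - real k * ((1 - \<epsilon>) * (2 * real n) + 2)"
          by (simp add: algebra_simps)
        then have "\<epsilon> * real k * real n \<le> real (card G)" using G1 by linarith
        moreover have "\<epsilon> * real m * real n \<le> \<epsilon> * real k * real n"
          using k(1) \<epsilon> by (intro mult_right_mono mult_left_mono) simp_all
        ultimately have G2: "\<epsilon> * real m * real n \<le> real (card G)" by linarith
        have "real (card ?F) \<le> real (card ?X)" using card_mono[OF fX FX] by simp
        also have "\<dots> \<le> (real n)\<^sup>2 / 2" unfolding card_complete_edges by (simp add: power2_eq_square field_simps)
        finally have "\<epsilon> * real m / real n * real (card ?F) \<le> \<epsilon> * real m / real n * ((real n)\<^sup>2 / 2)"
          using \<epsilon> by (intro mult_left_mono) simp_all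
        also have "\<dots> = \<epsilon> * real m * real n / 2" using n0 by (simp add: power2_eq_square)
        finally show "real (card ?F) - real (card G) / 2 \<le> a * real (card ?F)"
          using G2 unfolding a_def by (simp add: algebra_simps)
      qed (simp add: f_def)
      finally show ?thesis by (simp add: mult.assoc mult.commute mult.left_commute)
    qed
  qed
  have "measure_pmf.expectation (?play (2 * m)) f \<le> a ^ (2 * m - m) * measure_pmf.expectation (?play m) f"
    by (rule expectation_play_decay[OF fX _ a0 facts(4) step]) (use m(1) in auto)
  also have "\<dots> \<le> a ^ (2 * m - m) * 1"
  proof (rule mult_left_mono)
    have "f h \<le> 1" for h by (simp add: f_def power_le_one)
    then have "measure_pmf.expectation (?play m) f \<le> measure_pmf.expectation (?play m) (\<lambda>_. 1)"
      by (intro expectation_mono_pmf finite_set_pmf_play[OF fX])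
    then show "measure_pmf.expectation (?play m) f \<le> 1" by simp
  qed (use a0 in simp)
  also have "\<dots> = a ^ m" by simp
  also have "a ^ m \<le> exp (- \<epsilon> * real m / real n) ^ m"
  proof (rule power_mono[OF _ a0])
    show "a \<le> exp (- \<epsilon> * real m / real n)" using exp_ge_add_one_self[of "- \<epsilon> * real m / real n"] by (simp add: a_def)
  qed
  also have "\<dots> = exp (- \<epsilon> * (real m)\<^sup>2 / real n)" by (simp add: power2_eq_square flip: exp_of_nat_mult)
  finally have decay: "measure_pmf.expectation (?play (2 * m)) f \<le> exp (- \<epsilon> * (real m)\<^sup>2 / real n)" .
  have "measure_pmf.prob (?play (2 * m)) {h. Q (maker_set h)} = measure_pmf.expectation (?play (2 * m)) (\<lambda>h. of_bool (Q (maker_set h)))"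
    by (rule prob_eq_expectation)
  also have "\<dots> \<le> measure_pmf.expectation (?play (2 * m)) (\<lambda>h. 2 ^ t * f h)"
  proof (rule expectation_mono_pmf[OF finite_set_pmf_play[OF fX]])
    fix h
    have "1 \<le> (2::real) ^ t * (1 / 2) ^ cherry_level t (maker_set h)"
    proof -
      have "1 = (2::real) ^ t * (1 / 2) ^ t" by (simp add: power_divide)
      also have "\<dots> \<le> 2 ^ t * (1 / 2) ^ cherry_level t (maker_set h)"
        using cherry_level(1) by (intro mult_left_mono power_decreasing) simp_all
      finally show ?thesis .
    qed
    then show "of_bool (Q (maker_set h)) \<le> 2 ^ t * f h" by (simp add: f_def)
  qed
  also have "\<dots> = 2 ^ t * measure_pmf.expectation (?play (2 * m)) f" by simp
  also have "\<dots> \<le> 2 ^ t * exp (- \<epsilon> * (real m)\<^sup>2 / real n)" using decay by (intro mult_left_mono) simp_all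
  finally show ?thesis unfolding Q_def .
qed

text \<open>The exponent \<open>2 / 3\<close> balances two demands. With \<open>m\<close> about
  \<open>n powr (2 / 3)\<close> the expected number of cherries has order
  \<open>n powr (1 / 3)\<close>, well below \<open>s = sqrt n\<close>, which is itself small against
  \<open>m\<close>; and \<open>m^2 / n\<close> tends to infinity, as the exponential decay
  requires.\<close>

lemma random_maker_cherries:
  assumes H: "simple_graph V E" and E: "\<not> path3 E" and \<epsilon>: "0 < \<epsilon>" "\<epsilon> < 1"
  shows "\<exists>a. a \<longlonglongrightarrow> 0 \<and> (\<forall>\<^sub>F n in sequentially. \<forall>b. real b \<le> (1 - \<epsilon>) * (2 * real n) + 1 \<longrightarrow>
    1 - a n \<le> minor_game_random_clever V E n b)"
proof -
  define t where "t = card E"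
  let ?u = "\<lambda>n. real n powr (2 / 3)"
  define a where "a n = 64 * (?u n + 1)\<^sup>2 / (real n * sqrt (real n)) + 2 ^ t * exp (- \<epsilon> * (?u n)\<^sup>2 / real n)" for n :: nat
  have "a \<longlonglongrightarrow> 0" unfolding a_def using \<epsilon> by real_asymp
  moreover have "\<forall>\<^sub>F n in sequentially. \<forall>b. real b \<le> (1 - \<epsilon>) * (2 * real n) + 1 \<longrightarrow>
    1 - a n \<le> minor_game_random_clever V E n b"
  proof -
    have "\<forall>\<^sub>F n in sequentially. 2 * (?u n + 1) * (2 * real n + 2) + (real n)\<^sup>2 / 4 \<le> real n * (real n - 1) / 2"
      by real_asymp
    moreover have "\<forall>\<^sub>F n in sequentially. 4 * (?u n + 1) + 3 * real t \<le> real n" by real_asymp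
    moreover have "\<forall>\<^sub>F n in sequentially. 2 * sqrt (real n) * real n / ?u n + 8 * (?u n + 1) + 6 * real t + 2 \<le> \<epsilon> * real n"
      using \<epsilon> by real_asymp
    moreover have "\<forall>\<^sub>F n in sequentially. sqrt (real n) \<le> ?u n" by real_asymp
    moreover have "\<forall>\<^sub>F n in sequentially. n \<ge> max 1 (card V)" by (rule eventually_ge_at_top)
    ultimately show ?thesis
    proof eventually_elim
      case (elim n)
      let ?X = "complete_edges n"
      define m where "m = nat \<lceil>?u n\<rceil>"
      define D where "D = (real n)\<^sup>2 / 4"
      let ?s = "sqrt (real n)"
      have n: "n > 0" "card V \<le> n" using elim(5) by simp_all
      have D: "D > 0" using n by (simp add: D_def)
      have u: "?u n > 0" using n by simp
      then have m: "?u n \<le> real m" "real m \<le> ?u n + 1" unfolding m_def by linarith+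
      have m0: "m > 0" using m(1) u by linarith
      then have m02: "1 \<le> 2 * m" by simp
      show ?case
      proof (intro allI impI)
        fix b assume b: "real b \<le> (1 - \<epsilon>) * (2 * real n) + 1"
        have "(1 - \<epsilon>) * (2 * real n) \<le> 1 * (2 * real n)" using \<epsilon> by (intro mult_right_mono) simp_all
        then have b2: "real b + 1 \<le> 2 * real n + 2" using b by linarith
        have "real ((2 * m - 1) * (b + 1)) = (2 * real m - 1) * (real b + 1)"
          using m02 by (simp only: of_nat_mult of_nat_add of_nat_1 of_nat_diff of_nat_numeral)
        also have "\<dots> \<le> 2 * (?u n + 1) * (2 * real n + 2)" using m m0 b2 by (intro mult_mono) simp_all
        finally have rounds: "real ((2 * m - 1) * (b + 1)) + D \<le> real (card ?X)"
          using elim(1) unfolding card_complete_edges D_def by linarith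
        let ?bad = "\<lambda>M. ?s \<le> real (card (cherries_in n M)) \<or>
            (real (card (cherries_in n M)) < ?s \<and> cherry_level t M < t)"
        have "1 - a n \<le> random_clever_prob ?X b (\<lambda>M. has_minor {..<n} M V E)"
        proof (rule random_clever_prob_ge_prefix[where k = "2 * m" and bad = ?bad])
          show "finite ?X" by (rule finite_complete_edges)
          show "2 * m \<le> card ?X" by (rule rounds_le_board(1)[OF rounds D])
          fix \<sigma> h assume "\<sigma> \<in> breaker_strategies ?X b" and h: "h \<in> set_pmf (play ?X (random_maker ?X) \<sigma> (2 * m))"
            and good: "\<not> ?bad (maker_set h)"
          have M: "maker_set h \<subseteq> ?X" by (rule play_maker_set_subset[OF legal_random_maker[OF finite_complete_edges] h])
          have "cherry_level t (maker_set h) = t" using good cherry_level(1)[of t "maker_set h"] by linarith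
          then have "disjoint_cherries t (maker_set h)" using cherry_level(2)[of t "maker_set h"] by simp
          then show "has_minor {..<n} (maker_set h) V E"
            by (rule cherries_has_minor[OF H E M _ _ n(2)]) (simp add: t_def)
        next
          fix \<sigma> assume \<sigma>: "\<sigma> \<in> breaker_strategies ?X b"
          let ?p = "play ?X (random_maker ?X) \<sigma> (2 * m)"
          have s0: "?s > 0" using n by simp
          have "measure_pmf.prob ?p {h. ?s \<le> real (card (cherries_in n (maker_set h)))}
              \<le> real n ^ 3 * (real (2 * m) / D)\<^sup>2 / ?s"
            by (rule prob_many_cherries[OF \<sigma> D s0 rounds])
          also have "real n ^ 3 * (real (2 * m) / D)\<^sup>2 = 64 * (real m)\<^sup>2 / real n"
            using n by (simp add: D_def field_simps power2_eq_square power3_eq_cube)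
          also have "64 * (real m)\<^sup>2 / real n / ?s \<le> 64 * (?u n + 1)\<^sup>2 / real n / ?s"
            using m s0 by (intro divide_right_mono mult_left_mono power_mono) simp_all
          finally have p1: "measure_pmf.prob ?p {h. ?s \<le> real (card (cherries_in n (maker_set h)))}
              \<le> 64 * (?u n + 1)\<^sup>2 / (real n * ?s)" by simp
          have "measure_pmf.prob ?p {h. real (card (cherries_in n (maker_set h))) < ?s \<and> cherry_level t (maker_set h) < t}
              \<le> 2 ^ t * exp (- \<epsilon> * (real m)\<^sup>2 / real n)"
          proof (rule prob_few_disjoint_cherries[OF \<sigma> D rounds \<epsilon> b s0 _ m0])
            show "?s \<le> real m" using elim(4) m(1) by linarith
            have "4 * real m \<le> 4 * (?u n + 1)" using m(2) by (rule mult_left_mono) simp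
            then have "4 * real m + 3 * real t \<le> real n" by (rule order_trans[OF add_right_mono elim(2)])
            then show "4 * m + 3 * t \<le> n" by linarith
            have "2 * ?s * real n / real m \<le> 2 * ?s * real n / ?u n"
              using m u s0 m0 by (intro divide_left_mono) simp_all
            moreover have "8 * real m \<le> 8 * (?u n + 1)" using m(2) by (rule mult_left_mono) simp
            ultimately have "2 * ?s * real n / real m + 8 * real m + 6 * real t + 2
                \<le> 2 * ?s * real n / ?u n + 8 * (?u n + 1) + 6 * real t + 2"
              by (intro add_right_mono add_mono)
            then show "2 * ?s * real n / real m + 8 * real m + 6 * real t + 2 \<le> \<epsilon> * real n"
              using elim(3) by (rule order_trans)
          qed
          also have "\<dots> \<le> 2 ^ t * exp (- \<epsilon> * (?u n)\<^sup>2 / real n)"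
            using m u \<epsilon> by (intro mult_left_mono) (simp_all add: divide_right_mono mult_left_mono power_mono)
          finally have p2: "measure_pmf.prob ?p {h. real (card (cherries_in n (maker_set h))) < ?s \<and> cherry_level t (maker_set h) < t}
              \<le> 2 ^ t * exp (- \<epsilon> * (?u n)\<^sup>2 / real n)" .
          have "measure_pmf.prob ?p {h. ?bad (maker_set h)} \<le>
             measure_pmf.prob ?p {h. ?s \<le> real (card (cherries_in n (maker_set h)))} +
             measure_pmf.prob ?p {h. real (card (cherries_in n (maker_set h))) < ?s \<and> cherry_level t (maker_set h) < t}"
            unfolding Collect_disj_eq by (rule measure_subadditive) simp_all
          then show "measure_pmf.prob ?p {h. ?bad (maker_set h)} \<le> a n" using p1 p2 unfolding a_def by linarith
        qed (rule has_minor_mono)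
        then show "1 - a n \<le> minor_game_random_clever V E n b" by (simp add: minor_game_random_clever_def)
      qed
    qed
  qed
  ultimately show ?thesis by (intro exI[of _ a] conjI)
qed

section \<open>Thresholds\<close>

text \<open>Uniform in the bias, as a sharp threshold speaks of sequences of biases; the
  \<open>+ 1\<close> absorbs rounding, like the \<open>- 1\<close> in
  \<open>breaker_wins_above\<close>.\<close>

definition maker_wins_below :: "(nat \<Rightarrow> nat \<Rightarrow> real) \<Rightarrow> (nat \<Rightarrow> real) \<Rightarrow> bool" where
  "maker_wins_below p f \<longleftrightarrow> (\<forall>\<epsilon>. 0 < \<epsilon> \<longrightarrow> \<epsilon> < 1 \<longrightarrow> (\<exists>a. a \<longlonglongrightarrow> 0 \<and>
     (\<forall>\<^sub>F n in sequentially. \<forall>b. real b \<le> (1 - \<epsilon>) * f n + 1 \<longrightarrow> 1 - a n \<le> p n b)))"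

definition breaker_wins_above :: "(nat \<Rightarrow> nat \<Rightarrow> real) \<Rightarrow> (nat \<Rightarrow> real) \<Rightarrow> bool" where
  "breaker_wins_above p f \<longleftrightarrow> (\<forall>\<epsilon>>0. \<forall>\<^sub>F n in sequentially. \<forall>b. (1 + \<epsilon>) * f n - 1 \<le> real b \<longrightarrow> p n b = 0)"

lemma sharp_thresholdI:
  assumes f: "\<And>n. 0 \<le> f n" and p: "\<And>n b. p n b \<le> 1"
    and "maker_wins_below p f" "breaker_wins_above p f"
  shows "sharp_threshold p f"
  unfolding sharp_threshold_def
proof (intro allI impI conjI)
  fix \<epsilon> :: real and b :: "nat \<Rightarrow> nat"
  assume \<epsilon>: "\<epsilon> > 0" and b: "\<forall>n. \<bar>real (b n) - (1 - \<epsilon>) * f n\<bar> < 1"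
  \<comment> \<open>Maker's bounds assume an \<epsilon> below 1. Decreasing \<epsilon> only admits
    larger biases, because \<open>f\<close> is nonnegative.\<close>
  define \<epsilon>' where "\<epsilon>' = min \<epsilon> (1 / 2)"
  have e: "0 < \<epsilon>'" "\<epsilon>' < 1" "\<epsilon>' \<le> \<epsilon>" using \<epsilon> by (auto simp: \<epsilon>'_def)
  from assms(3)[unfolded maker_wins_below_def, THEN spec, THEN mp, OF e(1), THEN mp, OF e(2)]
  obtain a where a: "a \<longlonglongrightarrow> 0"
    "\<forall>\<^sub>F n in sequentially. \<forall>b. real b \<le> (1 - \<epsilon>') * f n + 1 \<longrightarrow> 1 - a n \<le> p n b"
    by (elim exE conjE)
  have "\<forall>\<^sub>F n in sequentially. 1 - a n \<le> p n (b n)"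
    using a(2)
  proof eventually_elim
    case (elim n)
    have "(1 - \<epsilon>) * f n \<le> (1 - \<epsilon>') * f n" using e(3) f by (intro mult_right_mono) simp_all
    moreover have "real (b n) < (1 - \<epsilon>) * f n + 1" using b[rule_format, of n] by linarith
    ultimately have "real (b n) \<le> (1 - \<epsilon>') * f n + 1" by linarith
    then show ?case using elim by simp
  qed
  moreover have "\<forall>\<^sub>F n in sequentially. p n (b n) \<le> 1" by (rule always_eventually, rule allI, rule p)
  moreover have "(\<lambda>n. 1 - a n) \<longlonglongrightarrow> 1" using tendsto_diff[OF tendsto_const a(1), of 1] by simp
  ultimately show "(\<lambda>n. p n (b n)) \<longlonglongrightarrow> 1" by (rule real_tendsto_sandwich[OF _ _ _ tendsto_const])
next
  fix \<epsilon> :: real and b :: "nat \<Rightarrow> nat"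
  assume \<epsilon>: "\<epsilon> > 0" and b: "\<forall>n. \<bar>real (b n) - (1 + \<epsilon>) * f n\<bar> < 1"
  have "\<forall>\<^sub>F n in sequentially. \<forall>b. (1 + \<epsilon>) * f n - 1 \<le> real b \<longrightarrow> p n b = 0"
    using assms(4) \<epsilon> unfolding breaker_wins_above_def by simp
  then have "\<forall>\<^sub>F n in sequentially. p n (b n) = 0"
  proof eventually_elim
    case (elim n)
    have "(1 + \<epsilon>) * f n - 1 \<le> real (b n)" using b[rule_format, of n] by linarith
    then show ?case using elim by simp
  qed
  then show "(\<lambda>n. p n (b n)) \<longlonglongrightarrow> 0" by (rule tendsto_eventually)
qed

lemma minor_game_random_clever_le_1: "minor_game_random_clever V E n b \<le> 1"
  unfolding minor_game_random_clever_def by (rule random_clever_prob_le_1)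

lemma minor_game_clever_clever_le_1: "minor_game_clever_clever V E n b \<le> 1"
  unfolding minor_game_clever_clever_def clever_clever_prob_def by simp

lemma clever_clever_1_if_random:
  assumes "minor_game_random_clever V E n b > 0"
  shows "minor_game_clever_clever V E n b = 1"
  unfolding minor_game_clever_clever_def
  by (rule clever_clever_prob_1_if_random[OF finite_complete_edges has_minor_mono])
     (use assms in \<open>simp_all add: minor_game_random_clever_def\<close>)

lemma maker_wins_below_clever:
  assumes "maker_wins_below (minor_game_random_clever V E) f"
  shows "maker_wins_below (minor_game_clever_clever V E) f"
  unfolding maker_wins_below_def
proof (intro allI impI)
  fix \<epsilon> :: real assume \<epsilon>: "0 < \<epsilon>" "\<epsilon> < 1"
  from assms[unfolded maker_wins_below_def, THEN spec, THEN mp, OF \<epsilon>(1), THEN mp, OF \<epsilon>(2)]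
  obtain a where a: "a \<longlonglongrightarrow> (0::real)"
    "\<forall>\<^sub>F n in sequentially. \<forall>b. real b \<le> (1 - \<epsilon>) * f n + 1 \<longrightarrow> 1 - a n \<le> minor_game_random_clever V E n b"
    by (elim exE conjE)
  have "\<forall>\<^sub>F n in sequentially. a n < 1" using a(1) by (rule order_tendstoD) simp
  with a(2) have "\<forall>\<^sub>F n in sequentially. \<forall>b. real b \<le> (1 - \<epsilon>) * f n + 1 \<longrightarrow> 1 - 0 \<le> minor_game_clever_clever V E n b"
  proof eventually_elim
    case (elim n)
    show ?case
    proof (intro allI impI)
      fix b assume "real b \<le> (1 - \<epsilon>) * f n + 1"
      then have "minor_game_random_clever V E n b > 0" using elim by force
      then show "1 - 0 \<le> minor_game_clever_clever V E n b" by (simp add: clever_clever_1_if_random)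
    qed
  qed
  then show "\<exists>a. a \<longlonglongrightarrow> 0 \<and> (\<forall>\<^sub>F n in sequentially. \<forall>b. real b \<le> (1 - \<epsilon>) * f n + 1 \<longrightarrow>
      1 - a n \<le> minor_game_clever_clever V E n b)"
    by (intro exI[of _ "\<lambda>_. 0"]) simp
qed

lemma minor_games_0:
  assumes "\<not> maker_wins b (\<lambda>M. has_minor {..<n} M V E) {} (complete_edges n)"
  shows "minor_game_clever_clever V E n b = 0" "minor_game_random_clever V E n b = 0"
  unfolding minor_game_clever_clever_def minor_game_random_clever_def
  by (rule clever_clever_prob_0[OF assms] random_clever_prob_0[OF finite_complete_edges assms])+

text \<open>A lower bound from RandomMaker and a single strategy of Breaker settle both games, the
  first passing to CleverMaker and the second working against every Maker.\<close>

lemma sharp_thresholds: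
  assumes f: "\<And>n. 0 \<le> f n" and lower: "maker_wins_below (minor_game_random_clever V E) f"
    and upper: "\<And>\<epsilon>. 0 < \<epsilon> \<Longrightarrow> \<forall>\<^sub>F n in sequentially. \<forall>b. (1 + \<epsilon>) * f n - 1 \<le> real b \<longrightarrow>
       \<not> maker_wins b (\<lambda>M. has_minor {..<n} M V E) {} (complete_edges n)"
  shows "sharp_threshold (minor_game_clever_clever V E) f \<and> sharp_threshold (minor_game_random_clever V E) f"
proof
  show "sharp_threshold (minor_game_clever_clever V E) f"
  proof (rule sharp_thresholdI[OF f minor_game_clever_clever_le_1 maker_wins_below_clever[OF lower]])
    show "breaker_wins_above (minor_game_clever_clever V E) f"
      unfolding breaker_wins_above_def
    proof (intro allI impI)
      fix \<epsilon> :: real assume "\<epsilon> > 0"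
      from upper[OF this] show "\<forall>\<^sub>F n in sequentially. \<forall>b. (1 + \<epsilon>) * f n - 1 \<le> real b \<longrightarrow>
         minor_game_clever_clever V E n b = 0"
        by eventually_elim (intro allI impI minor_games_0(1), simp)
    qed
  qed
  show "sharp_threshold (minor_game_random_clever V E) f"
  proof (rule sharp_thresholdI[OF f minor_game_random_clever_le_1 lower])
    show "breaker_wins_above (minor_game_random_clever V E) f"
      unfolding breaker_wins_above_def
    proof (intro allI impI)
      fix \<epsilon> :: real assume "\<epsilon> > 0"
      from upper[OF this] show "\<forall>\<^sub>F n in sequentially. \<forall>b. (1 + \<epsilon>) * f n - 1 \<le> real b \<longrightarrow>
         minor_game_random_clever V E n b = 0"
        by eventually_elim (intro allI impI minor_games_0(2), simp)
    qed
  qed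
qed

lemma tendsto_C_over_n: "(\<lambda>n. C / real n) \<longlonglongrightarrow> 0"
  by (rule tendsto_divide_0[OF tendsto_const filterlim_at_top_imp_at_infinity[OF filterlim_real_sequentially]])

section \<open>Bounds for the individual types of target graphs\<close>

lemma few_edges_breaker:
  assumes H: "simple_graph V E" and k: "k = card E" "2 \<le> k" and \<epsilon>: "0 < \<epsilon>"
    and b: "(1 + \<epsilon>) * ((real n)\<^sup>2 / (2 * real k - 2)) - 1 \<le> real b"
  shows "\<not> maker_wins b (\<lambda>M. has_minor {..<n} M V E) {} (complete_edges n)"
proof (rule maker_loses_few_edges[OF finite_complete_edges])
  have "1 * ((real n)\<^sup>2 / (2 * real k - 2)) \<le> (1 + \<epsilon>) * ((real n)\<^sup>2 / (2 * real k - 2))"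
    using \<epsilon> k by (intro mult_right_mono) simp_all
  then have "(real n)\<^sup>2 / (2 * real k - 2) \<le> real b + 1" using b by linarith
  then have "(real n)\<^sup>2 / 2 \<le> (real k - 1) * (real b + 1)" using k(2) by (simp add: field_simps)
  moreover have "real (card (complete_edges n)) \<le> (real n)\<^sup>2 / 2"
    unfolding card_complete_edges by (simp add: power2_eq_square field_simps)
  moreover have "real ((k - 1) * (b + 1)) = (real k - 1) * (real b + 1)"
  proof -
    have "1 \<le> k" using k(2) by simp
    then show ?thesis by (simp only: of_nat_mult of_nat_add of_nat_1 of_nat_diff)
  qed
  ultimately have "real (card (complete_edges n)) \<le> real ((k - 1) * (b + 1))" by linarith
  then show "card (complete_edges n) \<le> (k - 1) * (b + 1)" by (simp only: of_nat_le_iff)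
  show "1 \<le> k" using k(2) by simp
  fix M assume "finite M" "has_minor {..<n} M V E"
  then show "k \<le> card M" using has_minor_card_edges_le H k(1) unfolding simple_graph_def by metis
qed

lemma P3_breaker:
  assumes H: "simple_graph V E" and ef: "e \<in> E" "f \<in> E" "e \<noteq> f" "e \<inter> f \<noteq> {}" and b: "2 * n \<le> b"
  shows "\<not> maker_wins b (\<lambda>M. has_minor {..<n} M V E) {} (complete_edges n)"
proof (rule maker_loses_matching[OF b])
  fix M assume M: "has_minor {..<n} M V E"
  have E: "E \<subseteq> nsets V 2" using H by (simp add: simple_graph_def)
  obtain v where v: "v \<in> e" "v \<in> f" using ef by auto
  obtain a a' where a: "e = {a, a'}" "a \<noteq> a'" "a \<in> V" "a' \<in> V" using subsetD[OF E ef(1)] by (rule nsets_2D)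
  obtain c c' where c: "f = {c, c'}" "c \<noteq> c'" "c \<in> V" "c' \<in> V" using subsetD[OF E ef(2)] by (rule nsets_2D)
  obtain u where u: "e = {v, u}" "u \<noteq> v" "u \<in> V" using a v(1) by (auto simp: insert_commute)
  obtain w where w: "f = {v, w}" "w \<noteq> v" "w \<in> V" using c v(2) by (auto simp: insert_commute)
  have "v \<in> V" using a v(1) by auto
  moreover have "u \<noteq> w" using u w ef(3) by auto
  ultimately show "\<exists>e\<in>M. \<exists>f\<in>M. e \<noteq> f \<and> e \<inter> f \<noteq> {}"
    using u w ef(1,2) by (intro matching_no_P3_minor[OF M, of v u w]) simp_all
qed

text \<open>Three connected edges of a forest form a star with three leaves or a path with four
  vertices. The star is excluded by bounding Maker's degrees by 2, the path by confining Maker to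
  stars.\<close>

lemma path3_breaker:
  assumes H: "simple_graph V E" and "forest E" "path3 E" and b: "n \<le> b"
  shows "\<not> maker_wins b (\<lambda>M. has_minor {..<n} M V E) {} (complete_edges n)"
proof -
  have E: "E \<subseteq> nsets V 2" using H by (simp add: simple_graph_def)
  obtain e f g where efg: "e \<in> E" "f \<in> E" "g \<in> E" "e \<noteq> f" "f \<noteq> g" "e \<noteq> g" "e \<inter> f \<noteq> {}" "f \<inter> g \<noteq> {}"
    using assms(3) unfolding path3_def by (elim bexE conjE)
  have edge: "\<exists>w. h = {v, w} \<and> w \<noteq> v \<and> w \<in> V \<and> v \<in> V" if h: "h \<in> E" "v \<in> h" for h v
  proof -
    obtain x y where "h = {x, y}" "x \<noteq> y" "x \<in> V" "y \<in> V" using subsetD[OF E h(1)] by (rule nsets_2D)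
    then show ?thesis using h(2) by (auto simp: insert_commute)
  qed
  obtain v where v: "v \<in> e" "v \<in> f" using efg(7) by auto
  obtain a where a: "e = {v, a}" "a \<noteq> v" "a \<in> V" "v \<in> V" using edge[OF efg(1) v(1)] by (elim exE conjE)
  obtain c where c: "f = {v, c}" "c \<noteq> v" "c \<in> V" using edge[OF efg(2) v(2)] by (elim exE conjE)
  have ac: "a \<noteq> c" using a c efg(4) by auto
  show ?thesis
  proof (cases "v \<in> g")
    case True
    then obtain d where d: "g = {v, d}" "d \<noteq> v" "d \<in> V" using edge[OF efg(3)] by metis
    have "d \<noteq> a" "d \<noteq> c" using a c d efg(5,6) by auto
    then have dist: "distinct [a, v, c, d]" using a c d ac by auto
    show ?thesis
    proof (rule maker_loses_max_degree_2[OF b])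
      fix M assume M: "has_minor {..<n} M V E" "M \<subseteq> complete_edges n" and deg: "\<And>x. card {y. {x, y} \<in> M} \<le> 2"
      have fin: "finite {y. {x, y} \<in> M}" for x
      proof (rule finite_subset)
        show "{y. {x, y} \<in> M} \<subseteq> {..<n}" using subsetD[OF M(2)] by fastforce
      qed simp
      have loop: "{x} \<notin> M" for x using M(2) by (auto simp: nsets_def)
      show False
        by (rule max_degree_2_no_K13_minor[OF M(1) _ a(3,4) c(3) d(3) dist _ _ _ deg fin loop])
          (use a(1) c(1) d(1) efg in simp_all)
    qed
  next
    case False
    then have "c \<in> g" using efg(8) c by auto
    then obtain d where d: "g = {c, d}" "d \<noteq> c" "d \<in> V" using edge[OF efg(3)] by metis
    have "d \<noteq> v" using False d by auto
    \<comment> \<open>Otherwise the three edges form a triangle, against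
      \<open>forest E\<close>.\<close>
    have "d \<noteq> a"
    proof
      assume "d = a"
      have "is_cycle E [v, a, c]" unfolding is_cycle_def
      proof (intro conjI allI impI)
        show "3 \<le> length [v, a, c]" "distinct [v, a, c]" using a c ac by auto
        fix i assume "i < length [v, a, c]"
        then have "i = 0 \<or> i = 1 \<or> i = 2" by auto
        then show "{[v, a, c] ! i, [v, a, c] ! (Suc i mod length [v, a, c])} \<in> E"
          using a(1) c(1) d(1) efg \<open>d = a\<close> by (auto simp: insert_commute)
      qed
      with assms(2) show False by (auto simp: forest_def)
    qed
    then have dist: "distinct [a, v, c, d]" using a c d ac \<open>d \<noteq> v\<close> by auto
    have edges: "{a, v} \<in> E" "{v, c} \<in> E" "{c, d} \<in> E" using a(1) c(1) d(1) efg by (auto simp: insert_commute)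
    show ?thesis
    proof (rule maker_loses_stars[OF b])
      fix M and center :: "nat \<Rightarrow> nat"
      assume M: "has_minor {..<n} M V E"
        and star: "\<And>x y. {x, y} \<in> M \<Longrightarrow> center x = center y \<and> (x = center x \<or> y = center y)"
      show False by (rule stars_no_P4_minor[OF M a(3,4) c(3) d(3) dist edges star])
    qed
  qed
qed

lemma cycle_breaker:
  assumes H: "simple_graph V E" and "\<not> forest E" and b: "n \<le> 2 * b" "0 < n"
  shows "\<not> maker_wins b (\<lambda>M. has_minor {..<n} M V E) {} (complete_edges n)"
proof (rule maker_loses_acyclic[OF b])
  fix M assume M: "has_minor {..<n} M V E"
  show "\<not> all_bridges M"
    using minor_of_bridges_forest[OF M] assms(2) H unfolding simple_graph_def by metis
qed

lemma clever_maker_forest: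
  assumes H: "simple_graph V E" and "forest E" "V \<noteq> {}"
  shows "maker_wins_below (minor_game_clever_clever V E) (\<lambda>n. real n)"
  unfolding maker_wins_below_def
proof (intro allI impI)
  fix \<epsilon> :: real assume \<epsilon>: "0 < \<epsilon>" "\<epsilon> < 1"
  \<comment> \<open>\<open>g = h\<close> is about \<open>\<epsilon> / 4 * n\<close>, which leaves
    \<open>\<epsilon> / 2 * n\<close> of the surplus over the bias for the constant
    \<open>2 * R + 5\<close>. After rounding still \<open>g \<ge> \<epsilon> / 8 * n\<close>, whence
    \<open>8 / \<epsilon>\<close>; and \<open>g * h\<close> is quadratic in \<open>n\<close> against
    a linear left-hand side.\<close>
  define K where "K = nat \<lceil>8 / \<epsilon>\<rceil>"
  have K: "8 / \<epsilon> \<le> real K" unfolding K_def by linarith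
  define R where "R = blob_rounds K (card V)"
  have "\<forall>\<^sub>F n in sequentially. 2 * real R + 5 \<le> \<epsilon> / 2 * real n" using \<epsilon> by real_asymp
  moreover have "\<forall>\<^sub>F n in sequentially. 2 * (real R + 1) * (real R * (real n + 1)) < (\<epsilon> / 8 * real n) * (\<epsilon> / 8 * real n)"
    using \<epsilon> by real_asymp
  moreover have "\<forall>\<^sub>F n in sequentially. 1 \<le> \<epsilon> / 8 * real n" using \<epsilon> by real_asymp
  ultimately have "\<forall>\<^sub>F n in sequentially. \<forall>b. real b \<le> (1 - \<epsilon>) * real n + 1 \<longrightarrow> 1 - 0 \<le> minor_game_clever_clever V E n b"
  proof eventually_elim
    case (elim n)
    define g where "g = nat \<lfloor>\<epsilon> / 4 * real n\<rfloor>"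
    have "0 \<le> \<epsilon> / 4 * real n" using \<epsilon> by simp
    then have g: "real g \<le> \<epsilon> / 4 * real n" "\<epsilon> / 4 * real n - 1 < real g" unfolding g_def by linarith+
    then have g8: "\<epsilon> / 8 * real n \<le> real g" using elim(3) by linarith
    show ?case
    proof (intro allI impI)
      fix b assume b: "real b \<le> (1 - \<epsilon>) * real n + 1"
      have b': "real b \<le> real n - \<epsilon> * real n + 1" using b by (simp add: algebra_simps)
      have "maker_wins b (\<lambda>M. has_minor {..<n} M V E) {} (complete_edges n)"
      proof (rule maker_wins_forest_minor[OF H assms(2,3) _ _ _ R_def, where g = g and h = g])
        have "real b + real g + real g + 2 * real R + 4 \<le> real n" using b' g(1) elim(1) by linarith
        then show "b + g + g + 2 * R + 4 \<le> n" by linarith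
        have "real b \<le> real n" using b' g(1) elim(1) by linarith
        then have "2 * (real R + 1) * (real R * (real b + 1)) \<le> 2 * (real R + 1) * (real R * (real n + 1))"
          by (intro mult_left_mono) simp_all
        also have "\<dots> < (\<epsilon> / 8 * real n) * (\<epsilon> / 8 * real n)" by (rule elim(2))
        also have "\<dots> \<le> real g * real g" using g8 elim(3) by (intro mult_mono) simp_all
        finally have "real (2 * (R + 1) * (R * (b + 1))) < real (g * g)"
          by (simp only: of_nat_mult of_nat_add of_nat_1 of_nat_numeral)
        then show "2 * (R + 1) * (R * (b + 1)) < g * g" by (simp only: of_nat_less_iff)
        have "real n = 8 / \<epsilon> * (\<epsilon> / 8 * real n)" using \<epsilon> by simp
        also have "\<dots> \<le> real K * real g" using K g8 elim(3) \<epsilon> by (intro mult_mono) simp_all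
        finally have "real n \<le> real (K * g)" by simp
        then show "n \<le> K * g" by (simp only: of_nat_le_iff)
      qed
      then show "1 - 0 \<le> minor_game_clever_clever V E n b"
        unfolding minor_game_clever_clever_def
        by (subst clever_clever_prob_1[OF finite_complete_edges has_minor_mono]) simp_all
    qed
  qed
  then show "\<exists>a. a \<longlonglongrightarrow> 0 \<and> (\<forall>\<^sub>F n in sequentially. \<forall>b. real b \<le> (1 - \<epsilon>) * real n + 1 \<longrightarrow>
      1 - a n \<le> minor_game_clever_clever V E n b)"
    by (intro exI[of _ "\<lambda>_. 0"]) simp
qed

theorem theorem1:
  fixes V :: "'a set" and E :: "'a set set"
  assumes H: "simple_graph V E"
  defines "\<tau> \<equiv> max_component_edges V E"
    and "CC \<equiv> minor_game_clever_clever V E"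
    and "RC \<equiv> minor_game_random_clever V E"
  shows
    "(\<tau> = 1 \<longrightarrow>
        (if card E = 1 then infinite_threshold CC \<and> infinite_threshold RC
         else sharp_threshold CC (\<lambda>n. (real n)\<^sup>2 / (2 * real (card E) - 2)) \<and>
              sharp_threshold RC (\<lambda>n. (real n)\<^sup>2 / (2 * real (card E) - 2)))) \<and>
     (\<tau> = 2 \<longrightarrow>
        sharp_threshold CC (\<lambda>n. 2 * real n) \<and> sharp_threshold RC (\<lambda>n. 2 * real n)) \<and>
     (forest E \<and> 3 \<le> \<tau> \<longrightarrow>
        sharp_threshold CC (\<lambda>n. real n) \<and> threshold RC (\<lambda>n. real n)) \<and>
     (\<not> forest E \<longrightarrow>
        sharp_threshold CC (\<lambda>n. real n / 2) \<and> sharp_threshold RC (\<lambda>n. real n / 2))"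
proof (intro conjI impI)
  assume \<tau>: "\<tau> = 1"
  have disj: "disjoint E"
  proof (rule pairwiseI)
    fix e f assume ef: "e \<in> E" "f \<in> E" "e \<noteq> f"
    show "disjnt e f"
    proof (rule ccontr)
      assume "\<not> disjnt e f"
      then have "2 \<le> max_component_edges V E" using max_component_edges_ge_2[OF H ef] by (simp add: disjnt_def)
      then show False using \<tau> by (simp add: \<tau>_def)
    qed
  qed
  have "E \<noteq> {}"
  proof
    assume "E = {}"
    then have "max_component_edges V E \<le> 0" by (intro max_component_edges_leI[OF H]) simp
    then show False using \<tau> by (simp add: \<tau>_def)
  qed
  then have "card E \<noteq> 0" using finite_simple_graph[OF H] by simp
  show "if card E = 1 then infinite_threshold CC \<and> infinite_threshold RC
         else sharp_threshold CC (\<lambda>n. (real n)\<^sup>2 / (2 * real (card E) - 2)) \<and>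
              sharp_threshold RC (\<lambda>n. (real n)\<^sup>2 / (2 * real (card E) - 2))"
  proof (cases "card E = 1")
    \<comment> \<open>Here the denominator \<open>2 * card E - 2\<close> vanishes, and Maker wins at
      every bias.\<close>
    case True
    have one: "minor_game_random_clever V E n b = 1" "minor_game_clever_clever V E n b = 1"
      if "max 2 (card V) \<le> n" for n b
      using random_maker_single_edge[OF H True, of n b] clever_clever_1_if_random[of V E n b] that by simp_all
    have "infinite_threshold p" if p: "\<And>n b. max 2 (card V) \<le> n \<Longrightarrow> p n b = 1" for p :: "nat \<Rightarrow> nat \<Rightarrow> real"
      unfolding infinite_threshold_def
    proof (intro allI tendsto_eventually)
      fix b :: "nat \<Rightarrow> nat"
      show "\<forall>\<^sub>F n in sequentially. p n (b n) = 1"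
        using eventually_ge_at_top[of "max 2 (card V)"] by eventually_elim (rule p)
    qed
    then show ?thesis using True one by (simp add: CC_def RC_def)
  next
    case False
    then have k: "2 \<le> card E" using \<open>card E \<noteq> 0\<close> by linarith
    have "sharp_threshold CC (\<lambda>n. (real n)\<^sup>2 / (2 * real (card E) - 2)) \<and>
              sharp_threshold RC (\<lambda>n. (real n)\<^sup>2 / (2 * real (card E) - 2))"
      unfolding CC_def RC_def
    proof (rule sharp_thresholds)
      show "0 \<le> (real n)\<^sup>2 / (2 * real (card E) - 2)" for n using k by simp
      show "maker_wins_below (minor_game_random_clever V E) (\<lambda>n. (real n)\<^sup>2 / (2 * real (card E) - 2))"
        unfolding maker_wins_below_def
      proof (intro allI impI)
        fix \<epsilon> :: real assume "0 < \<epsilon>" "\<epsilon> < 1"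
        from random_maker_matching[OF H disj refl k this] obtain C where
          "\<forall>\<^sub>F n in sequentially. \<forall>b. real b \<le> (1 - \<epsilon>) * ((real n)\<^sup>2 / (2 * real (card E) - 2)) + 1 \<longrightarrow>
             1 - C / real n \<le> minor_game_random_clever V E n b" by (rule exE)
        then show "\<exists>a. a \<longlonglongrightarrow> 0 \<and> (\<forall>\<^sub>F n in sequentially. \<forall>b. real b \<le> (1 - \<epsilon>) * ((real n)\<^sup>2 / (2 * real (card E) - 2)) + 1 \<longrightarrow>
             1 - a n \<le> minor_game_random_clever V E n b)"
          by (intro exI[of _ "\<lambda>n. C / real n"] conjI tendsto_C_over_n)
      qed
      show "\<forall>\<^sub>F n in sequentially. \<forall>b. (1 + \<epsilon>) * ((real n)\<^sup>2 / (2 * real (card E) - 2)) - 1 \<le> real b \<longrightarrow>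
         \<not> maker_wins b (\<lambda>M. has_minor {..<n} M V E) {} (complete_edges n)" if "0 < \<epsilon>" for \<epsilon>
        by (intro always_eventually allI impI few_edges_breaker[OF H refl k that])
    qed
    then show ?thesis using False by simp
  qed
next
  assume \<tau>: "\<tau> = 2"
  have no3: "\<not> path3 E"
  proof
    assume "path3 E"
    from max_component_edges_ge_3[OF H this] show False using \<tau> by (simp add: \<tau>_def)
  qed
  have "\<exists>e\<in>E. \<exists>f\<in>E. e \<noteq> f \<and> e \<inter> f \<noteq> {}"
  proof (rule ccontr)
    assume "\<not> ?thesis"
    then have "max_component_edges V E \<le> 1" by (intro max_component_edges_le_1[OF H]) blast
    then show False using \<tau> by (simp add: \<tau>_def)
  qed
  then obtain e f where ef: "e \<in> E" "f \<in> E" "e \<noteq> f" "e \<inter> f \<noteq> {}" by (elim bexE conjE)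
  have both: "sharp_threshold CC (\<lambda>n. 2 * real n) \<and> sharp_threshold RC (\<lambda>n. 2 * real n)"
    unfolding CC_def RC_def
  proof (rule sharp_thresholds)
    show "maker_wins_below (minor_game_random_clever V E) (\<lambda>n. 2 * real n)"
      unfolding maker_wins_below_def by (intro allI impI random_maker_cherries[OF H no3])
    fix \<epsilon> :: real assume \<epsilon>: "0 < \<epsilon>"
    have "\<forall>\<^sub>F n in sequentially. 2 * real n \<le> (1 + \<epsilon>) * (2 * real n) - 1" using \<epsilon> by real_asymp
    then show "\<forall>\<^sub>F n in sequentially. \<forall>b. (1 + \<epsilon>) * (2 * real n) - 1 \<le> real b \<longrightarrow>
         \<not> maker_wins b (\<lambda>M. has_minor {..<n} M V E) {} (complete_edges n)"
    proof eventually_elim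
      case (elim n)
      show ?case
      proof (intro allI impI)
        fix b assume "(1 + \<epsilon>) * (2 * real n) - 1 \<le> real b"
        then have "2 * n \<le> b" using elim by linarith
        then show "\<not> maker_wins b (\<lambda>M. has_minor {..<n} M V E) {} (complete_edges n)" by (rule P3_breaker[OF H ef])
      qed
    qed
  qed simp
  then show "sharp_threshold CC (\<lambda>n. 2 * real n)" "sharp_threshold RC (\<lambda>n. 2 * real n)" by simp_all
next
  assume "forest E \<and> 3 \<le> \<tau>"
  then have forest: "forest E" and \<tau>: "3 \<le> \<tau>" by simp_all
  have p3: "path3 E"
  proof (rule ccontr)
    assume "\<not> path3 E"
    from max_component_edges_le_2[OF H this] show False using \<tau> by (simp add: \<tau>_def)
  qed
  then have "E \<noteq> {}" by (auto simp: path3_def)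
  then have V: "V \<noteq> {}" using H by (auto simp: simple_graph_def nsets_def)
  note lose = minor_games_0[OF path3_breaker[OF H forest p3]]
  show "sharp_threshold CC (\<lambda>n. real n)"
    unfolding CC_def
  proof (rule sharp_thresholdI[OF _ minor_game_clever_clever_le_1 clever_maker_forest[OF H forest V]])
    show "breaker_wins_above (minor_game_clever_clever V E) (\<lambda>n. real n)"
      unfolding breaker_wins_above_def
    proof (intro allI impI)
      fix \<epsilon> :: real assume \<epsilon>: "\<epsilon> > 0"
      have "\<forall>\<^sub>F n in sequentially. real n \<le> (1 + \<epsilon>) * real n - 1" using \<epsilon> by real_asymp
      then show "\<forall>\<^sub>F n in sequentially. \<forall>b. (1 + \<epsilon>) * real n - 1 \<le> real b \<longrightarrow> minor_game_clever_clever V E n b = 0"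
      proof eventually_elim
        case (elim n)
        show ?case
        proof (intro allI impI)
          fix b assume "(1 + \<epsilon>) * real n - 1 \<le> real b"
          then have "n \<le> b" using elim by linarith
          then show "minor_game_clever_clever V E n b = 0" by (rule lose(1))
        qed
      qed
    qed
  qed simp
  show "threshold RC (\<lambda>n. real n)"
    unfolding threshold_def RC_def
  proof (intro conjI allI impI)
    fix b :: "nat \<Rightarrow> nat" assume "(\<lambda>n. real (b n)) \<in> o(\<lambda>n. real n)"
    then have small: "\<forall>\<^sub>F n in sequentially. norm (real (b n)) \<le> 1 / 4 * norm (real n)"
      by (rule landau_o.smallD) simp
    \<comment> \<open>A bias in \<open>o(n)\<close> is eventually at most \<open>n / 4\<close>, so
      the bound obtained from clique minors with \<epsilon> equal to 1/2 applies to forests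
      too.\<close>
    obtain C where C: "\<forall>\<^sub>F n in sequentially. \<forall>b. real b \<le> (1 - 1 / 2) * (real n / 2) + 1 \<longrightarrow>
       1 - C / real n \<le> minor_game_random_clever V E n b"
      using random_maker_minor[OF H, of "1 / 2"] by auto
    from small C have "\<forall>\<^sub>F n in sequentially. 1 - C / real n \<le> minor_game_random_clever V E n (b n)"
      by eventually_elim simp
    moreover have "\<forall>\<^sub>F n in sequentially. minor_game_random_clever V E n (b n) \<le> 1"
      by (rule always_eventually, rule allI, rule minor_game_random_clever_le_1)
    moreover have "(\<lambda>n. 1 - C / real n) \<longlonglongrightarrow> 1" using tendsto_diff[OF tendsto_const tendsto_C_over_n, of 1 C] by simp
    ultimately show "(\<lambda>n. minor_game_random_clever V E n (b n)) \<longlonglongrightarrow> 1"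
      by (rule real_tendsto_sandwich[OF _ _ _ tendsto_const])
  next
    fix b :: "nat \<Rightarrow> nat" assume "(\<lambda>n. real (b n)) \<in> \<omega>(\<lambda>n. real n)"
    then have "\<forall>\<^sub>F n in sequentially. norm (real (b n)) \<ge> 1 * norm (real n)"
      by (rule landau_omega.smallD) simp
    then have "\<forall>\<^sub>F n in sequentially. minor_game_random_clever V E n (b n) = 0"
      by eventually_elim (simp add: lose(2))
    then show "(\<lambda>n. minor_game_random_clever V E n (b n)) \<longlonglongrightarrow> 0" by (rule tendsto_eventually)
  qed
next
  assume not_forest: "\<not> forest E"
  have both: "sharp_threshold CC (\<lambda>n. real n / 2) \<and> sharp_threshold RC (\<lambda>n. real n / 2)"
    unfolding CC_def RC_def
  proof (rule sharp_thresholds)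
    show "maker_wins_below (minor_game_random_clever V E) (\<lambda>n. real n / 2)"
      unfolding maker_wins_below_def
    proof (intro allI impI)
      fix \<epsilon> :: real assume "0 < \<epsilon>" "\<epsilon> < 1"
      from random_maker_minor[OF H this] obtain C where
        "\<forall>\<^sub>F n in sequentially. \<forall>b. real b \<le> (1 - \<epsilon>) * (real n / 2) + 1 \<longrightarrow>
           1 - C / real n \<le> minor_game_random_clever V E n b" by (rule exE)
      then show "\<exists>a. a \<longlonglongrightarrow> 0 \<and> (\<forall>\<^sub>F n in sequentially. \<forall>b. real b \<le> (1 - \<epsilon>) * (real n / 2) + 1 \<longrightarrow>
           1 - a n \<le> minor_game_random_clever V E n b)"
        by (intro exI[of _ "\<lambda>n. C / real n"] conjI tendsto_C_over_n)
    qed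
    fix \<epsilon> :: real assume \<epsilon>: "0 < \<epsilon>"
    have "\<forall>\<^sub>F n in sequentially. real n / 2 \<le> (1 + \<epsilon>) * (real n / 2) - 1" using \<epsilon> by real_asymp
    then show "\<forall>\<^sub>F n in sequentially. \<forall>b. (1 + \<epsilon>) * (real n / 2) - 1 \<le> real b \<longrightarrow>
         \<not> maker_wins b (\<lambda>M. has_minor {..<n} M V E) {} (complete_edges n)"
      using eventually_gt_at_top[of 0]
    proof eventually_elim
      case (elim n)
      show ?case
      proof (intro allI impI)
        fix b assume "(1 + \<epsilon>) * (real n / 2) - 1 \<le> real b"
        then have "n \<le> 2 * b" using elim(1) by linarith
        then show "\<not> maker_wins b (\<lambda>M. has_minor {..<n} M V E) {} (complete_edges n)"
          using elim(2) by (intro cycle_breaker[OF H not_forest])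
      qed
    qed
  qed simp
  then show "sharp_threshold CC (\<lambda>n. real n / 2)" "sharp_threshold RC (\<lambda>n. real n / 2)" by simp_all
qed

end
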